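(* The functionals $E_k$, for $1 \leq k \leq 4$, and $P_k$, for $2\leq k \leq 4$, are well-defined (all integrands are integrable) and continuous on $X^k(\mathbb{R})$. For $1 \leq k \leq 4$, the functional $p_k(\Psi)$ is well-defined for any function $\Psi \in X^k(\mathbb{R})$ which satisfies $E(\Psi) < \frac{2\sqrt{2}}{3}$. (Definitions of $E_k$, $P_k$, $p_k$ are in the context.)
   Context: For $u : \mathbb{R} \to \mathbb{C}$, $E(u) = \frac12 \int_{\mathbb{R}} |\partial_{\mathrm{x}} u|^2 + \frac14 \int_{\mathbb{R}} (1 - |u|^2)^2$, and $X^k(\mathbb{R}) = \{ u \in L^1_{\rm loc}(\mathbb{R}, \mathbb{C}) : E(u) < +\infty,\ \partial_{\mathrm{x}} u \in H^{k-1}(\mathbb{R}) \}$, with the distance $d(u,v) = \|u - v\|_{L^\infty} + \|\partial_{\mathrm{x}} (u-v)\|_{H^{k-1}} + \| |u|^2 - |v|^2 \|_{L^2}$. Any $\Psi\in X^1(\mathbb{R})$ with $E(\Psi) < \frac{2\sqrt2}{3}$ satisfies $\inf_{\mathbb{R}}|\Psi|>0$, so that $\Psi = \varrho \exp i\varphi$ with $\varrho=|\Psi|$ and $\varphi$ a continuous real-valued phase. Write $\langle z_1, z_2 \rangle = \mathrm{Re}(z_1 \overline{z_2})$, $\eta = 1 - |\Psi|^2$, $\partial = \partial_{\mathrm{x}}$; integrals are over $\mathbb{R}$. Define $E_1 = E$, $$E_2(\Psi) = \frac12 \int |\partial^2 \Psi|^2 - \frac32 \int \eta |\partial \Psi|^2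 + \frac14 \int (\partial \eta)^2 - \frac14 \int \eta^3,$$ $$E_3(\Psi) = \frac12 \int |\partial^3 \Psi|^2 + \frac14 \int |\partial^2 \eta|^2 + \frac54 \int |\partial \Psi|^4 + \frac52 \int \partial^2 \eta |\partial \Psi|^2 - \frac52 \int \eta |\partial^2 \Psi|^2 - \frac54 \int \eta (\partial \eta)^2 + \frac{15}{4} \int \eta^2 |\partial \Psi|^2 + \frac{5}{16} \int \eta^4,$$ $$\begin{aligned} E_4(\Psi) = {} & \frac12 \int |\partial^4 \Psi|^2 + \frac14 \int |\partial^3 \eta|^2 - \frac74 \int \eta (\partial^2 \eta)^2 - \frac72 \int \eta |\partial^3 \Psi|^2 + \frac{35}{8} \int \eta^2 (\partial \eta)^2 + \frac{35}{4} \int \eta^2 |\partial^2 \Psi|^2 \\ & - \frac{35}{4} \int (\partial \eta)^2 |\partial \Psi|^2 - \frac72 \int |\partial \Psi|^2 |\partial^2 \Psi|^2 - 7 \int \partial^2 \eta \langle \partial \Psi, \partial^3 \Psi\rangle - 7 \int |\partial \Psi|^2 \langle \partial \Psi, \partial^3 \Psi \rangle \\ & - \frac{35}{2} \int \eta\, \partial^2 \eta |\partial \Psi|^2 - \frac{35}{4} \int \eta^3 |\partial \Psi|^2 - \frac{35}{4} \int \eta |\partial \Psi|^4 - \frac{7}{16} \int \eta^5, \end{aligned}$$ $$P_2(\Psi) = \frac12 \int \langle i \partial^2 \Psi, \partial \Psi \rangle - \frac34 \int \eta \langle i \partial \Psi, \Psi \rangle,$$ $$P_3(\Psi) = \frac12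 \int \langle i \partial^3 \Psi, \partial^2 \Psi \rangle - \frac52 \int \eta \langle i \partial^2 \Psi, \partial \Psi \rangle + \frac54 \int (\eta^2 + \eta) \langle i \partial \Psi, \Psi \rangle,$$ $$\begin{aligned} P_4(\Psi) = {} & \frac12 \int \langle i \partial^4 \Psi, \partial^3 \Psi \rangle - \frac72 \int \eta \langle i \partial^3 \Psi, \partial^2 \Psi \rangle + \frac72 \int \partial^2 \eta \langle i \partial^2 \Psi, \partial \Psi \rangle + \frac74 \int |\partial \Psi|^2 \langle i \partial^2 \Psi, \partial \Psi \rangle \\ & + \frac{35}{4} \int \eta^2 \langle i \partial^2 \Psi, \partial \Psi \rangle - \frac{35}{16} \int (\eta^3 + \eta^2 + \eta) \langle i \partial \Psi, \Psi \rangle, \end{aligned}$$ and $p_1(\Psi) = \frac12\int \eta\,\partial\varphi$, $p_2 = P_2 - \frac32 p_1$, $p_3 = P_3 + \frac52 p_1$, $p_4 = P_4 - \frac{35}{8} p_1$. *)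

theory Defs
  imports "HOL-Analysis.Analysis" "HOL-Probability.Essential_Supremum"
begin

section \<open>Weak derivatives and Sobolev spaces on the real line\<close>

text \<open>
  Elements of the function spaces are represented by Borel functions, which are to be identified
  when they agree almost everywhere (every class of Lebesgue measurable functions contains a
  Borel function).
\<close>

definition locally_integrable :: "(real \<Rightarrow> 'a::{banach, second_countable_topology}) \<Rightarrow> bool" where
  "locally_integrable u \<longleftrightarrow> (\<forall>K. compact K \<longrightarrow> set_integrable lborel K u)"

definition test_function :: "(real \<Rightarrow> real) \<Rightarrow> bool" where
  "test_function \<phi> \<longleftrightarrow>
     (\<forall>n. (deriv ^^ n) \<phi> differentiable_on UNIV) \<and> compact (closure (support_on UNIV \<phi>))"

definition has_weak_derivative ::
    "nat \<Rightarrow> (real \<Rightarrow> 'a::{banach, second_countable_topology}) \<Rightarrow> (real \<Rightarrow> 'a) \<Rightarrow> bool" where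
  "has_weak_derivative j u v \<longleftrightarrow>
     locally_integrable u \<and> locally_integrable v \<and>
     (\<forall>\<phi>. test_function \<phi> \<longrightarrow>
        (LINT x|lborel. (deriv ^^ j) \<phi> x *\<^sub>R u x) = (-1) ^ j *\<^sub>R (LINT x|lborel. \<phi> x *\<^sub>R v x))"

definition weakly_differentiable ::
    "nat \<Rightarrow> (real \<Rightarrow> 'a::{banach, second_countable_topology}) \<Rightarrow> bool" where
  "weakly_differentiable j u \<longleftrightarrow> (\<exists>v. has_weak_derivative j u v)"

text \<open>
  A representative of the weak derivative of order \<open>j\<close>, which is unique up to null sets. It is
  meaningful only if \<^term>\<open>weakly_differentiable j u\<close>.
\<close>

definition wderiv ::
    "nat \<Rightarrow> (real \<Rightarrow> 'a::{banach, second_countable_topology}) \<Rightarrow> real \<Rightarrow> 'a" where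
  "wderiv j u = (SOME v. has_weak_derivative j u v)"

definition square_integrable :: "(real \<Rightarrow> 'a::{banach, second_countable_topology}) \<Rightarrow> bool" where
  "square_integrable f \<longleftrightarrow>
     f \<in> borel_measurable lborel \<and> integrable lborel (\<lambda>x. (norm (f x))\<^sup>2)"

definition L2_norm :: "(real \<Rightarrow> 'a::{banach, second_countable_topology}) \<Rightarrow> ereal" where
  "L2_norm f = (if square_integrable f then ereal (sqrt (LINT x|lborel. (norm (f x))\<^sup>2)) else \<infinity>)"

definition Linf_norm :: "(real \<Rightarrow> 'a::{banach, second_countable_topology}) \<Rightarrow> ereal" where
  "Linf_norm f = esssup lborel (\<lambda>x. ereal (norm (f x)))"

definition Sobolev_H :: "nat \<Rightarrow> (real \<Rightarrow> 'a::{banach, second_countable_topology}) set" where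
  "Sobolev_H m = {f. \<forall>j\<le>m. weakly_differentiable j f \<and> square_integrable (wderiv j f)}"

definition Sobolev_norm ::
    "nat \<Rightarrow> (real \<Rightarrow> 'a::{banach, second_countable_topology}) \<Rightarrow> ereal" where
  "Sobolev_norm m f =
     (if f \<in> Sobolev_H m
      then ereal (sqrt (\<Sum>j\<le>m. LINT x|lborel. (norm (wderiv j f x))\<^sup>2)) else \<infinity>)"


section \<open>The energy spaces\<close>

definition finite_energy :: "(real \<Rightarrow> complex) \<Rightarrow> bool" where
  "finite_energy u \<longleftrightarrow>
     weakly_differentiable 1 u \<and>
     integrable lborel (\<lambda>x. (cmod (wderiv 1 u x))\<^sup>2) \<and>
     integrable lborel (\<lambda>x. (1 - (cmod (u x))\<^sup>2)\<^sup>2)"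

text \<open>The spaces and distances below are used for \<open>k \<ge> 1\<close> only.\<close>

definition X :: "nat \<Rightarrow> (real \<Rightarrow> complex) set" where
  "X k = {u. locally_integrable u \<and> finite_energy u \<and> wderiv 1 u \<in> Sobolev_H (k - 1)}"

definition X_dist :: "nat \<Rightarrow> (real \<Rightarrow> complex) \<Rightarrow> (real \<Rightarrow> complex) \<Rightarrow> ereal" where
  "X_dist k u v =
     Linf_norm (\<lambda>x. u x - v x) +
     Sobolev_norm (k - 1) (wderiv 1 (\<lambda>x. u x - v x)) +
     L2_norm (\<lambda>x. (cmod (u x))\<^sup>2 - (cmod (v x))\<^sup>2)"

text \<open>
  As functions at distance zero are those that agree almost everywhere, continuity includes that
  the functional does not depend on the representative.
\<close>

definition continuous_on_X :: "nat \<Rightarrow> ((real \<Rightarrow> complex) \<Rightarrow> real) \<Rightarrow> bool" where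
  "continuous_on_X k F \<longleftrightarrow>
     (\<forall>u\<in>X k. \<forall>\<epsilon>>0. \<exists>\<delta>::real. \<delta> > 0 \<and>
        (\<forall>v\<in>X k. X_dist k u v < ereal \<delta> \<longrightarrow> \<bar>F v - F u\<bar> < \<epsilon>))"


section \<open>The functionals\<close>

definition dot :: "complex \<Rightarrow> complex \<Rightarrow> real" where
  "dot z w = Re (z * cnj w)"

definition eta :: "(real \<Rightarrow> complex) \<Rightarrow> real \<Rightarrow> real" where
  "eta \<Psi> x = 1 - (cmod (\<Psi> x))\<^sup>2"

text \<open>
  A functional is given by the list of its integrands together with their coefficients, so that
  the integrability of each integrand can be stated.
\<close>

definition functional_of :: "(real \<times> (real \<Rightarrow> real)) list \<Rightarrow> real" where
  "functional_of ts = (\<Sum>(c, f)\<leftarrow>ts. c * (LINT x|lborel. f x))"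

definition all_integrable :: "(real \<times> (real \<Rightarrow> real)) list \<Rightarrow> bool" where
  "all_integrable ts \<longleftrightarrow> (\<forall>(c, f)\<in>set ts. integrable lborel f)"

definition E1_terms :: "(real \<Rightarrow> complex) \<Rightarrow> (real \<times> (real \<Rightarrow> real)) list" where
  "E1_terms \<Psi> =
    [(1/2, \<lambda>x. (cmod (wderiv 1 \<Psi> x))\<^sup>2),
     (1/4, \<lambda>x. (1 - (cmod (\<Psi> x))\<^sup>2)\<^sup>2)]"

definition E2_terms :: "(real \<Rightarrow> complex) \<Rightarrow> (real \<times> (real \<Rightarrow> real)) list" where
  "E2_terms \<Psi> =
    [(1/2, \<lambda>x. (cmod (wderiv 2 \<Psi> x))\<^sup>2),
     (-(3/2), \<lambda>x. eta \<Psi> x * (cmod (wderiv 1 \<Psi> x))\<^sup>2),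
     (1/4, \<lambda>x. (wderiv 1 (eta \<Psi>) x)\<^sup>2),
     (-(1/4), \<lambda>x. (eta \<Psi> x) ^ 3)]"

definition E3_terms :: "(real \<Rightarrow> complex) \<Rightarrow> (real \<times> (real \<Rightarrow> real)) list" where
  "E3_terms \<Psi> =
    [(1/2, \<lambda>x. (cmod (wderiv 3 \<Psi> x))\<^sup>2),
     (1/4, \<lambda>x. \<bar>wderiv 2 (eta \<Psi>) x\<bar>\<^sup>2),
     (5/4, \<lambda>x. (cmod (wderiv 1 \<Psi> x)) ^ 4),
     (5/2, \<lambda>x. wderiv 2 (eta \<Psi>) x * (cmod (wderiv 1 \<Psi> x))\<^sup>2),
     (-(5/2), \<lambda>x. eta \<Psi> x * (cmod (wderiv 2 \<Psi> x))\<^sup>2),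
     (-(5/4), \<lambda>x. eta \<Psi> x * (wderiv 1 (eta \<Psi>) x)\<^sup>2),
     (15/4, \<lambda>x. (eta \<Psi> x)\<^sup>2 * (cmod (wderiv 1 \<Psi> x))\<^sup>2),
     (5/16, \<lambda>x. (eta \<Psi> x) ^ 4)]"

definition E4_terms :: "(real \<Rightarrow> complex) \<Rightarrow> (real \<times> (real \<Rightarrow> real)) list" where
  "E4_terms \<Psi> =
    [(1/2, \<lambda>x. (cmod (wderiv 4 \<Psi> x))\<^sup>2),
     (1/4, \<lambda>x. \<bar>wderiv 3 (eta \<Psi>) x\<bar>\<^sup>2),
     (-(7/4), \<lambda>x. eta \<Psi> x * (wderiv 2 (eta \<Psi>) x)\<^sup>2),
     (-(7/2), \<lambda>x. eta \<Psi> x * (cmod (wderiv 3 \<Psi> x))\<^sup>2),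
     (35/8, \<lambda>x. (eta \<Psi> x)\<^sup>2 * (wderiv 1 (eta \<Psi>) x)\<^sup>2),
     (35/4, \<lambda>x. (eta \<Psi> x)\<^sup>2 * (cmod (wderiv 2 \<Psi> x))\<^sup>2),
     (-(35/4), \<lambda>x. (wderiv 1 (eta \<Psi>) x)\<^sup>2 * (cmod (wderiv 1 \<Psi> x))\<^sup>2),
     (-(7/2), \<lambda>x. (cmod (wderiv 1 \<Psi> x))\<^sup>2 * (cmod (wderiv 2 \<Psi> x))\<^sup>2),
     (-7, \<lambda>x. wderiv 2 (eta \<Psi>) x * dot (wderiv 1 \<Psi> x) (wderiv 3 \<Psi> x)),
     (-7, \<lambda>x. (cmod (wderiv 1 \<Psi> x))\<^sup>2 * dot (wderiv 1 \<Psi> x) (wderiv 3 \<Psi> x)),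
     (-(35/2), \<lambda>x. eta \<Psi> x * wderiv 2 (eta \<Psi>) x * (cmod (wderiv 1 \<Psi> x))\<^sup>2),
     (-(35/4), \<lambda>x. (eta \<Psi> x) ^ 3 * (cmod (wderiv 1 \<Psi> x))\<^sup>2),
     (-(35/4), \<lambda>x. eta \<Psi> x * (cmod (wderiv 1 \<Psi> x)) ^ 4),
     (-(7/16), \<lambda>x. (eta \<Psi> x) ^ 5)]"

definition P2_terms :: "(real \<Rightarrow> complex) \<Rightarrow> (real \<times> (real \<Rightarrow> real)) list" where
  "P2_terms \<Psi> =
    [(1/2, \<lambda>x. dot (\<i> * wderiv 2 \<Psi> x) (wderiv 1 \<Psi> x)),
     (-(3/4), \<lambda>x. eta \<Psi> x * dot (\<i> * wderiv 1 \<Psi> x) (\<Psi> x))]"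

definition P3_terms :: "(real \<Rightarrow> complex) \<Rightarrow> (real \<times> (real \<Rightarrow> real)) list" where
  "P3_terms \<Psi> =
    [(1/2, \<lambda>x. dot (\<i> * wderiv 3 \<Psi> x) (wderiv 2 \<Psi> x)),
     (-(5/2), \<lambda>x. eta \<Psi> x * dot (\<i> * wderiv 2 \<Psi> x) (wderiv 1 \<Psi> x)),
     (5/4, \<lambda>x. ((eta \<Psi> x)\<^sup>2 + eta \<Psi> x) * dot (\<i> * wderiv 1 \<Psi> x) (\<Psi> x))]"

definition P4_terms :: "(real \<Rightarrow> complex) \<Rightarrow> (real \<times> (real \<Rightarrow> real)) list" where
  "P4_terms \<Psi> =
    [(1/2, \<lambda>x. dot (\<i> * wderiv 4 \<Psi> x) (wderiv 3 \<Psi> x)),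
     (-(7/2), \<lambda>x. eta \<Psi> x * dot (\<i> * wderiv 3 \<Psi> x) (wderiv 2 \<Psi> x)),
     (7/2, \<lambda>x. wderiv 2 (eta \<Psi>) x * dot (\<i> * wderiv 2 \<Psi> x) (wderiv 1 \<Psi> x)),
     (7/4, \<lambda>x. (cmod (wderiv 1 \<Psi> x))\<^sup>2 * dot (\<i> * wderiv 2 \<Psi> x) (wderiv 1 \<Psi> x)),
     (35/4, \<lambda>x. (eta \<Psi> x)\<^sup>2 * dot (\<i> * wderiv 2 \<Psi> x) (wderiv 1 \<Psi> x)),
     (-(35/16), \<lambda>x. ((eta \<Psi> x) ^ 3 + (eta \<Psi> x)\<^sup>2 + eta \<Psi> x) * dot (\<i> * wderiv 1 \<Psi> x) (\<Psi> x))]"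

text \<open>Only \<open>k \<in> {1..4}\<close> is relevant for \<open>E\<close> and \<open>k \<in> {2..4}\<close> for \<open>P\<close>.\<close>

definition E_terms :: "nat \<Rightarrow> (real \<Rightarrow> complex) \<Rightarrow> (real \<times> (real \<Rightarrow> real)) list" where
  "E_terms k = (if k = 1 then E1_terms else if k = 2 then E2_terms
                else if k = 3 then E3_terms else E4_terms)"

definition P_terms :: "nat \<Rightarrow> (real \<Rightarrow> complex) \<Rightarrow> (real \<times> (real \<Rightarrow> real)) list" where
  "P_terms k = (if k = 2 then P2_terms else if k = 3 then P3_terms else P4_terms)"

definition E :: "nat \<Rightarrow> (real \<Rightarrow> complex) \<Rightarrow> real" where
  "E k \<Psi> = functional_of (E_terms k \<Psi>)"

definition P :: "nat \<Rightarrow> (real \<Rightarrow> complex) \<Rightarrow> real" where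
  "P k \<Psi> = functional_of (P_terms k \<Psi>)"

text \<open>
  The highest derivatives occurring in \<open>E k\<close> are of order \<open>k\<close> for \<open>\<Psi>\<close> and of order \<open>k - 1\<close> for
  \<open>\<eta>\<close>, and those in \<open>P k\<close> are not higher. Their existence is part of well-definedness, since
  \<^const>\<open>wderiv\<close> is arbitrary otherwise.
\<close>

definition derivatives_exist :: "nat \<Rightarrow> (real \<Rightarrow> complex) \<Rightarrow> bool" where
  "derivatives_exist k \<Psi> \<longleftrightarrow>
     (\<forall>j\<le>k. weakly_differentiable j \<Psi>) \<and> (\<forall>j<k. weakly_differentiable j (eta \<Psi>))"

definition E_well_defined :: "nat \<Rightarrow> (real \<Rightarrow> complex) \<Rightarrow> bool" where
  "E_well_defined k \<Psi> \<longleftrightarrow> derivatives_exist k \<Psi> \<and> all_integrable (E_terms k \<Psi>)"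

definition P_well_defined :: "nat \<Rightarrow> (real \<Rightarrow> complex) \<Rightarrow> bool" where
  "P_well_defined k \<Psi> \<longleftrightarrow> derivatives_exist k \<Psi> \<and> all_integrable (P_terms k \<Psi>)"


section \<open>The renormalized momenta\<close>

definition is_phase :: "(real \<Rightarrow> complex) \<Rightarrow> (real \<Rightarrow> real) \<Rightarrow> bool" where
  "is_phase \<Psi> \<phi> \<longleftrightarrow>
     continuous_on UNIV \<phi> \<and>
     (AE x in lborel. \<Psi> x = complex_of_real (cmod (\<Psi> x)) * exp (\<i> * complex_of_real (\<phi> x)))"

definition p1_via :: "(real \<Rightarrow> real) \<Rightarrow> (real \<Rightarrow> complex) \<Rightarrow> real" where
  "p1_via \<phi> \<Psi> = 1/2 * (LINT x|lborel. eta \<Psi> x * wderiv 1 \<phi> x)"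

definition p1 :: "(real \<Rightarrow> complex) \<Rightarrow> real" where
  "p1 \<Psi> = p1_via (SOME \<phi>. is_phase \<Psi> \<phi>) \<Psi>"

definition p :: "nat \<Rightarrow> (real \<Rightarrow> complex) \<Rightarrow> real" where
  "p k \<Psi> = (if k = 1 then p1 \<Psi>
            else if k = 2 then P 2 \<Psi> - 3/2 * p1 \<Psi>
            else if k = 3 then P 3 \<Psi> + 5/2 * p1 \<Psi>
            else P 4 \<Psi> - 35/8 * p1 \<Psi>)"

text \<open>
  Besides the integrability of all integrands, this asserts that a continuous phase exists and
  that neither the chosen phase nor the representative of \<open>\<Psi>\<close> affects the value.
\<close>

definition p_well_defined :: "nat \<Rightarrow> (real \<Rightarrow> complex) \<Rightarrow> bool" where
  "p_well_defined k \<Psi> \<longleftrightarrow>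
     (\<exists>\<phi>. is_phase \<Psi> \<phi>) \<and>
     (\<forall>\<phi>. is_phase \<Psi> \<phi> \<longrightarrow>
        weakly_differentiable 1 \<phi> \<and>
        integrable lborel (\<lambda>x. eta \<Psi> x * wderiv 1 \<phi> x) \<and>
        p1_via \<phi> \<Psi> = p1 \<Psi>) \<and>
     (2 \<le> k \<longrightarrow> P_well_defined k \<Psi>) \<and>
     (\<forall>\<Psi>'\<in>X k. (AE x in lborel. \<Psi>' x = \<Psi> x) \<longrightarrow> p k \<Psi>' = p k \<Psi>)"

end

theory Submission
  imports Defs
begin

text \<open>
  Weakly differentiable functions are the functions that agree almost everywhere with a primitive
  of a locally integrable function, and calculus for such primitives (product rule, derivative of
  the exponential) rests on a bisection argument: a subadditive function of intervals that is
  bounded by the square of the increments of a continuous monotone function is not positive.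

  Near a point of the energy space the maps sending a function to its density \<open>\<eta>\<close>, to the
  derivatives of \<open>\<eta>\<close>, and to its derivatives of order at least 1 are continuous into \<open>L\<^sup>2\<close>, and
  except for the derivatives of highest order also into \<open>L\<^sup>\<infinity>\<close>, by the Sobolev inequality on
  intervals of length 1. Every integrand is a product of two factors converging in \<open>L\<^sup>2\<close>, hence
  converges in \<open>L\<^sup>1\<close>.

  For the momenta, \<open>r - r ^ 3 / 3\<close> evaluated at the modulus has increments bounded by the integral
  of \<open>\<bar>\<eta>\<bar> \<bar>\<partial>\<Psi>\<bar>\<close>, and the latter product is at most \<open>sqrt 2\<close> times the energy density. Comparing
  an arbitrary point with points near both infinities, where the modulus is close to 1, bounds the
  modulus from below. Then \<open>\<Psi> = q exp L\<close> with \<open>L\<close> a primitive of \<open>\<partial>\<Psi> / \<Psi>\<close>, and every continuous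
  phase is \<open>Im L\<close> up to a constant.
\<close>

section \<open>Primitives of locally integrable functions\<close>

text \<open>A function \<Psi> of the energy space has modulus close to 1 at infinity and is not
  square integrable, so it can enter an integrand only as a bounded factor; the decay has to come
  from \<eta> and from the derivatives of \<Psi>. Derivatives of order \<open>k\<close> are
  controlled in L2 only. They occur just in the leading integrand of each functional, where nothing
  but a second L2 factor stands beside them, and this is why the estimates close.

  Primitives are handled by their increments alone, without derivatives at points: an error that is
  of second order in the increments of a continuous monotone function has to vanish.

  The polynomial \<open>r - r ^ 3 / 3\<close> is the antiderivative of \<open>1 - r ^ 2\<close> that
  vanishes at 0. Its largest value on the half-line \<open>r \<ge> 0\<close> is 2/3, attained at 1.
  A modulus that starts near 1, drops to 0 and returns uses up twice 2/3 of the integral of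
  \<bar>\<eta>\<bar> \<bar>\<partial>\<Psi>\<bar>, hence an energy of at least
  \<open>(4/3) / sqrt 2 = 2 * sqrt 2 / 3\<close>. This is the origin of the threshold, which is the
  energy of the black soliton \<open>tanh (x / sqrt 2)\<close>.\<close>

lemma subadditive_quadratic_nonpos:
  fixes D :: "real \<Rightarrow> real \<Rightarrow> real" and H :: "real \<Rightarrow> real"
  assumes "a \<le> b" and cont: "continuous_on {a..b} H"
    and mono: "\<And>x y. a \<le> x \<Longrightarrow> x \<le> y \<Longrightarrow> y \<le> b \<Longrightarrow> H x \<le> H y"
    and sub: "\<And>x y z. a \<le> x \<Longrightarrow> x \<le> y \<Longrightarrow> y \<le> z \<Longrightarrow> z \<le> b \<Longrightarrow> D x z \<le> D x y + D y z"
    and quad: "\<And>x y. a \<le> x \<Longrightarrow> x \<le> y \<Longrightarrow> y \<le> b \<Longrightarrow> D x y \<le> C * (H y - H x)\<^sup>2"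
  shows "D a b \<le> 0"
proof -
  have bound: "D x y \<le> C * (H y - H x)\<^sup>2 / 2 ^ n" if "a \<le> x" "x \<le> y" "y \<le> b" for n x y
    using that
  proof (induction n arbitrary: x y)
    case 0
    then show ?case using quad by simp
  next
    case (Suc n)
    \<comment> \<open>The bisection is by the values of \<open>H\<close>, not by position: at
      \<open>m\<close> the increment of \<open>H\<close> is halved exactly, so the two quadratic
      bounds add up to half of the previous one.\<close>
    have "H x \<le> (H x + H y) / 2" "(H x + H y) / 2 \<le> H y"
      using mono[OF Suc.prems] by auto
    moreover have "continuous_on {x..y} H"
      using cont by (rule continuous_on_subset) (use Suc.prems in auto)
    ultimately obtain m where m: "x \<le> m" "m \<le> y" "H m = (H x + H y) / 2"
      using IVT'[of H x "(H x + H y) / 2" y] Suc.prems by blast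
    have "D x y \<le> D x m + D m y" using sub m Suc.prems by simp
    also have "\<dots> \<le> C * (H m - H x)\<^sup>2 / 2 ^ n + C * (H y - H m)\<^sup>2 / 2 ^ n"
      using m Suc.prems by (intro add_mono Suc.IH) auto
    also have "\<dots> = C * (H y - H x)\<^sup>2 / 2 ^ Suc n"
      unfolding m(3) by (simp add: field_simps power2_eq_square)
    finally show ?case .
  qed
  have "(\<lambda>n. C * (H b - H a)\<^sup>2 / 2 ^ n) \<longlonglongrightarrow> 0"
    by (rule LIMSEQ_divide_realpow_zero) simp
  then show ?thesis
    by (rule LIMSEQ_le_const) (use bound[OF order_refl \<open>a \<le> b\<close> order_refl] in blast)
qed

lemma locally_integrable_set_integrable:
  assumes "locally_integrable g" "A \<in> sets borel" "bounded A"
  shows "set_integrable lborel A g"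
proof -
  have "set_integrable lborel (closure A) g"
    using assms unfolding locally_integrable_def by (auto simp: compact_closure)
  then show ?thesis
    by (rule set_integrable_subset) (use assms closure_subset in auto)
qed

lemma locally_integrable_Ioc: "locally_integrable g \<Longrightarrow> set_integrable lborel {a<..b::real} g"
  by (rule locally_integrable_set_integrable) auto

lemma locally_integrableI:
  assumes "\<And>n::nat. set_integrable lborel {- real n..real n} g"
  shows "locally_integrable g"
  unfolding locally_integrable_def
proof (intro allI impI)
  fix K :: "real set" assume K: "compact K"
  then obtain B where B: "\<And>x. x \<in> K \<Longrightarrow> \<bar>x\<bar> \<le> B"
    using compact_imp_bounded bounded_iff by (metis real_norm_def)
  obtain n :: nat where "B \<le> real n" using real_arch_simple by blast
  then have "K \<subseteq> {- real n..real n}" using B by fastforce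
  then show "set_integrable lborel K g"
    using set_integrable_subset[OF assms[of n], of K] borel_closed[OF compact_imp_closed[OF K]] by simp
qed

lemma locally_integrable_measurable:
  fixes g :: "real \<Rightarrow> 'a::{banach, second_countable_topology}"
  assumes "locally_integrable g"
  shows "g \<in> borel_measurable borel"
proof (rule borel_measurable_LIMSEQ_metric)
  fix n :: nat
  have "integrable lborel (\<lambda>x. indicat_real {- real n..real n} x *\<^sub>R g x)"
    using assms unfolding locally_integrable_def set_integrable_def by blast
  then show "(\<lambda>x. indicat_real {- real n..real n} x *\<^sub>R g x) \<in> borel_measurable borel"
    using borel_measurable_integrable by fastforce
next
  fix x :: real
  obtain N :: nat where N: "\<bar>x\<bar> \<le> real N" using real_arch_simple by blast
  have "\<forall>\<^sub>F n in sequentially. indicat_real {- real n..real n} x *\<^sub>R g x = g x"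
    using eventually_ge_at_top[of N]
    by eventually_elim (use N in \<open>auto simp: indicator_def\<close>)
  then show "(\<lambda>n. indicat_real {- real n..real n} x *\<^sub>R g x) \<longlonglongrightarrow> g x"
    by (rule tendsto_eventually)
qed

lemma locally_integrable_bound:
  fixes f :: "real \<Rightarrow> 'a::{banach, second_countable_topology}"
    and g :: "real \<Rightarrow> 'b::{banach, second_countable_topology}"
  assumes g: "locally_integrable g" and f: "f \<in> borel_measurable borel"
    and le: "AE x in lborel. norm (f x) \<le> norm (g x)"
  shows "locally_integrable f"
proof (rule locally_integrableI)
  fix n :: nat
  have "set_integrable lborel {- real n..real n} g"
    by (rule locally_integrable_set_integrable[OF g]) auto
  then show "set_integrable lborel {- real n..real n} f"
    unfolding set_integrable_def
    by (rule Bochner_Integration.integrable_bound) (use f le in \<open>auto simp: indicator_def\<close>)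
qed

text \<open>Since \<open>lborel\<close> is not complete, equality almost everywhere does not
  transfer Borel measurability, which is therefore carried as a separate hypothesis here and in the
  later results on changing representatives.\<close>

lemma locally_integrable_cong_AE:
  fixes f g :: "real \<Rightarrow> 'a::{banach, second_countable_topology}"
  assumes "locally_integrable g" "f \<in> borel_measurable borel" "AE x in lborel. f x = g x"
  shows "locally_integrable f"
  by (rule locally_integrable_bound[OF assms(1,2)]) (use assms(3) in auto)

lemma locally_integrable_norm:
  fixes g :: "real \<Rightarrow> 'a::{banach, second_countable_topology}"
  assumes "locally_integrable g"
  shows "locally_integrable (\<lambda>x. norm (g x))"
  using locally_integrable_measurable[OF assms] by (intro locally_integrable_bound[OF assms]) auto

lemma locally_integrable_add:
  fixes f g :: "real \<Rightarrow> 'a::{banach, second_countable_topology}"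
  assumes "locally_integrable f" "locally_integrable g"
  shows "locally_integrable (\<lambda>x. f x + g x)"
  using assms unfolding locally_integrable_def by auto

lemma locally_integrable_diff:
  fixes f g :: "real \<Rightarrow> 'a::{banach, second_countable_topology}"
  assumes "locally_integrable f" "locally_integrable g"
  shows "locally_integrable (\<lambda>x. f x - g x)"
  using assms unfolding locally_integrable_def by auto

lemma locally_integrable_continuous:
  fixes f :: "real \<Rightarrow> 'a::{banach, second_countable_topology}"
  assumes "continuous_on UNIV f"
  shows "locally_integrable f"
  unfolding locally_integrable_def set_integrable_def
  using assms by (auto intro!: borel_integrable_compact intro: continuous_on_subset)

lemma locally_integrable_integrable:
  fixes f :: "real \<Rightarrow> 'a::{banach, second_countable_topology}"
  assumes "integrable lborel f"
  shows "locally_integrable f"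
  unfolding locally_integrable_def set_integrable_def
  using assms by (auto intro!: integrable_mult_indicator simp: borel_closed compact_imp_closed)

lemma bounded_bilinear_measurable:
  fixes B :: "'a::{real_normed_vector, second_countable_topology} \<Rightarrow>
      'b::{real_normed_vector, second_countable_topology} \<Rightarrow> 'c::real_normed_vector"
  assumes "bounded_bilinear B" "f \<in> borel_measurable M" "g \<in> borel_measurable M"
  shows "(\<lambda>x. B (f x) (g x)) \<in> borel_measurable M"
proof -
  have "continuous_on UNIV (\<lambda>p. B (fst p) (snd p))"
    by (intro bounded_bilinear.continuous_on[OF assms(1)] continuous_intros)
  then show ?thesis
    by (intro borel_measurable_continuous_Pair[OF assms(2,3)])
qed

text \<open>On a bounded interval the continuous factor is bounded. Products are treated for an
  arbitrary bounded bilinear map, so that real and complex multiplication, scaling by test functions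
  and \<open>dot\<close> are all instances.\<close>

lemma locally_integrable_bilinear:
  fixes B :: "'a::{banach, second_countable_topology} \<Rightarrow>
      'b::{banach, second_countable_topology} \<Rightarrow> 'c::{banach, second_countable_topology}"
  assumes B: "bounded_bilinear B" and f: "continuous_on UNIV f" and g: "locally_integrable g"
  shows "locally_integrable (\<lambda>x. B (f x) (g x))"
proof (rule locally_integrableI)
  fix n :: nat
  obtain K where K: "0 \<le> K" "\<And>a b. norm (B a b) \<le> norm a * norm b * K"
    using bounded_bilinear.nonneg_bounded[OF B] by blast
  have "compact (f ` {- real n..real n})"
    by (intro compact_continuous_image continuous_on_subset[OF f]) auto
  then obtain C where C: "\<And>x. x \<in> {- real n..real n} \<Longrightarrow> norm (f x) \<le> C"
    using compact_imp_bounded bounded_iff by (metis image_eqI)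
  have "set_integrable lborel {- real n..real n} g"
    by (rule locally_integrable_set_integrable[OF g]) auto
  then have "integrable lborel (\<lambda>x. (C * K) *\<^sub>R (indicat_real {- real n..real n} x *\<^sub>R g x))"
    unfolding set_integrable_def by (intro integrable_scaleR_right)
  then show "set_integrable lborel {- real n..real n} (\<lambda>x. B (f x) (g x))"
    unfolding set_integrable_def
  proof (rule Bochner_Integration.integrable_bound)
    have "(\<lambda>x. B (f x) (g x)) \<in> borel_measurable borel"
      by (rule bounded_bilinear_measurable[OF B borel_measurable_continuous_onI[OF f]
            locally_integrable_measurable[OF g]])
    then show "(\<lambda>x. indicat_real {- real n..real n} x *\<^sub>R B (f x) (g x)) \<in> borel_measurable lborel"
      by measurable
    show "AE x in lborel. norm (indicat_real {- real n..real n} x *\<^sub>R B (f x) (g x))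
      \<le> norm ((C * K) *\<^sub>R (indicat_real {- real n..real n} x *\<^sub>R g x))"
    proof (rule AE_I2)
      fix x
      show "norm (indicat_real {- real n..real n} x *\<^sub>R B (f x) (g x))
        \<le> norm ((C * K) *\<^sub>R (indicat_real {- real n..real n} x *\<^sub>R g x))"
      proof (cases "x \<in> {- real n..real n}")
        case True
        have "norm (B (f x) (g x)) \<le> norm (f x) * norm (g x) * K" by (rule K)
        also have "\<dots> \<le> C * norm (g x) * K"
          using C[OF True] K(1) by (intro mult_right_mono) auto
        also have "\<dots> \<le> norm ((C * K) *\<^sub>R g x)"
          using mult_right_mono[OF abs_ge_self[of "C * K"] norm_ge_zero[of "g x"]] by (simp add: mult_ac)
        finally show ?thesis using True by simp
      qed simp
    qed
  qed
qed

section \<open>Primitives described by their increments\<close>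

definition primitive :: "(real \<Rightarrow> 'a::{banach, second_countable_topology}) \<Rightarrow> (real \<Rightarrow> 'a) \<Rightarrow> bool" where
  "primitive f g \<longleftrightarrow>
     locally_integrable g \<and> (\<forall>x y. x \<le> y \<longrightarrow> f y - f x = (LINT s:{x<..y}|lborel. g s))"

lemma primitive_locally_integrable: "primitive f g \<Longrightarrow> locally_integrable g"
  by (simp add: primitive_def)

lemma primitive_diff_eq: "primitive f g \<Longrightarrow> x \<le> y \<Longrightarrow> f y - f x = (LINT s:{x<..y}|lborel. g s)"
  by (simp add: primitive_def)

text \<open>Half-open intervals are used throughout because adjacent ones are disjoint and join to
  an interval of the same kind; this additivity is what feeds the bisection argument.\<close>

lemma set_integral_Ioc_add:
  fixes g :: "real \<Rightarrow> 'a::{banach, second_countable_topology}"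
  assumes "locally_integrable g" "x \<le> y" "y \<le> z"
  shows "(LINT s:{x<..z}|lborel. g s) = (LINT s:{x<..y}|lborel. g s) + (LINT s:{y<..z}|lborel. g s)"
proof -
  have "{x<..z} = {x<..y} \<union> {y<..z}" using assms by auto
  then show ?thesis
    using assms by (simp add: set_integral_Un locally_integrable_Ioc)
qed

text \<open>Passing to the gauge integral gives access to the continuity of indefinite integrals and
  to the fundamental theorem of calculus; the missing end point is negligible.\<close>

lemma set_integral_Ioc_eq_integral:
  fixes g :: "real \<Rightarrow> 'a::euclidean_space"
  assumes "locally_integrable g"
  shows "(LINT s:{x<..y}|lborel. g s) = integral {x..y} g"
proof -
  have "(LINT s:{x<..y}|lborel. g s) = integral {x<..y} g"
    by (rule set_borel_integral_eq_integral(2)[OF locally_integrable_Ioc[OF assms]])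
  also have "\<dots> = integral {x..y} g"
    by (rule integral_subset_negligible) (auto intro: negligible_subset[of "{x}"])
  finally show ?thesis .
qed

lemma set_integral_Ioc_nonneg:
  fixes g :: "real \<Rightarrow> real"
  assumes "\<And>s. 0 \<le> g s"
  shows "0 \<le> (LINT s:{x<..y}|lborel. g s)"
  unfolding set_lebesgue_integral_def using assms by (intro integral_nonneg_AE) auto

lemma norm_set_integral_Ioc_le:
  fixes g :: "real \<Rightarrow> 'a::{banach, second_countable_topology}"
    and h :: "real \<Rightarrow> real"
  assumes "locally_integrable g" "locally_integrable h"
    and "\<And>s. x < s \<Longrightarrow> s \<le> y \<Longrightarrow> norm (g s) \<le> h s"
  shows "norm (LINT s:{x<..y}|lborel. g s) \<le> (LINT s:{x<..y}|lborel. h s)"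
proof -
  have "norm (LINT s:{x<..y}|lborel. g s) \<le> (LINT s|lborel. norm (indicator {x<..y} s *\<^sub>R g s))"
    unfolding set_lebesgue_integral_def by (rule integral_norm_bound)
  also have "\<dots> \<le> (LINT s|lborel. indicator {x<..y} s *\<^sub>R h s)"
    using locally_integrable_Ioc[OF assms(1), of x y] locally_integrable_Ioc[OF assms(2), of x y]
    unfolding set_integrable_def
    by (intro integral_mono integrable_norm) (auto simp: indicator_def assms(3))
  finally show ?thesis unfolding set_lebesgue_integral_def .
qed

lemma primitive_exists:
  fixes g :: "real \<Rightarrow> 'a::{banach, second_countable_topology}"
  assumes g: "locally_integrable g"
  obtains f where "primitive f g" "f 0 = 0"
proof -
  let ?f = "\<lambda>x. if 0 \<le> x then LINT s:{0<..x}|lborel. g s else - (LINT s:{x<..0}|lborel. g s)"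
  have "?f 0 = 0" by (simp add: set_lebesgue_integral_def)
  have "?f y - ?f x = (LINT s:{x<..y}|lborel. g s)" if "x \<le> y" for x y
    using set_integral_Ioc_add[OF g, of 0 x y] set_integral_Ioc_add[OF g, of x y 0]
      set_integral_Ioc_add[OF g, of x 0 y] that by auto
  then have "primitive ?f g" using g by (simp add: primitive_def)
  with \<open>?f 0 = 0\<close> show thesis using that by blast
qed

lemma primitive_norm_diff_le:
  assumes "primitive f g" "x \<le> y"
  shows "norm (f y - f x) \<le> (LINT s:{x<..y}|lborel. norm (g s))"
  unfolding primitive_diff_eq[OF assms]
  using primitive_locally_integrable[OF assms(1)]
  by (intro norm_set_integral_Ioc_le) (auto intro: locally_integrable_norm)

lemma primitive_mono:
  fixes f :: "real \<Rightarrow> real"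
  assumes "primitive f g" "\<And>s. 0 \<le> g s" "x \<le> y"
  shows "f x \<le> f y"
  using primitive_diff_eq[OF assms(1,3)] set_integral_Ioc_nonneg[of g, OF assms(2)] by (simp add: algebra_simps)

lemma primitive_continuous_real:
  fixes f :: "real \<Rightarrow> real"
  assumes "primitive f g"
  shows "continuous_on UNIV f"
proof -
  have g: "locally_integrable g" using assms by (simp add: primitive_def)
  have "isCont f x" for x
  proof -
    have eq: "f t = f (x - 1) + integral {x-1..t} g" if "t \<in> {x-1..x+1}" for t
      using primitive_diff_eq[OF assms, of "x-1" t] that set_integral_Ioc_eq_integral[OF g] by (simp add: algebra_simps)
    have "set_integrable lborel {x-1..x+1} g"
      by (rule locally_integrable_set_integrable[OF g]) auto
    then have "g integrable_on {x-1..x+1}" by (rule set_borel_integral_eq_integral(1))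
    then have "continuous_on {x-1..x+1} (\<lambda>t. f (x - 1) + integral {x-1..t} g)"
      by (intro continuous_intros indefinite_integral_continuous_1)
    then have "continuous_on {x-1..x+1} f"
      by (rule continuous_on_eq) (rule eq[symmetric])
    then show ?thesis
      by (rule continuous_on_interior) simp
  qed
  then show ?thesis by (simp add: continuous_at_imp_continuous_on)
qed

text \<open>The increments of \<open>f\<close> are dominated by those of a real primitive
  \<open>F\<close> of the norm of \<open>g\<close>, which reduces a Banach space valued function to
  the real case.\<close>

lemma primitive_continuous:
  fixes f :: "real \<Rightarrow> 'a::{banach, second_countable_topology}"
  assumes "primitive f g"
  shows "continuous_on UNIV f"
proof -
  have "locally_integrable (\<lambda>x. norm (g x))"
    using assms by (intro locally_integrable_norm primitive_locally_integrable)
  then obtain F where F: "primitive F (\<lambda>x. norm (g x))" using primitive_exists by blast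
  have le: "norm (f y - f x) \<le> \<bar>F y - F x\<bar>" for x y
  proof (cases "x \<le> y")
    case True
    then show ?thesis using primitive_norm_diff_le[OF assms True] primitive_diff_eq[OF F True] by simp
  next
    case False
    then have "y \<le> x" by simp
    from primitive_norm_diff_le[OF assms this] primitive_diff_eq[OF F this]
    show ?thesis by (simp add: norm_minus_commute abs_minus_commute)
  qed
  have "isCont F x" for x
    using primitive_continuous_real[OF F] by (simp add: continuous_on_eq_continuous_at)
  have "(f \<longlongrightarrow> f x) (at x)" for x
  proof (rule Lim_transform_bound[of _ "\<lambda>y. F y - F x", THEN LIM_zero_cancel])
    show "\<forall>\<^sub>F y in at x. norm (f y - f x) \<le> norm (F y - F x)" using le by simp
    show "((\<lambda>y. F y - F x) \<longlongrightarrow> 0) (at x)"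
      using \<open>isCont F x\<close> by (simp add: isCont_def LIM_zero)
  qed
  then show ?thesis by (simp add: continuous_on_def)
qed

text \<open>The defect \<open>f y - f x\<close> minus the integral of \<open>g\<close> is additive
  over adjacent intervals, so its norm is subadditive. With \<open>H\<close> a primitive of
  \<open>h\<close> the hypothesis bounds it by a multiple of the squared increment of
  \<open>H\<close>, and bisection makes it vanish. The constant may depend on \<open>a\<close> and
  \<open>b\<close>, but not on the subinterval.\<close>

lemma primitive_if_increments_le:
  fixes f :: "real \<Rightarrow> 'a::{banach, second_countable_topology}"
  assumes g: "locally_integrable g" and h: "locally_integrable h" "\<And>s. 0 \<le> h s"
    and le: "\<And>a b. a \<le> b \<Longrightarrow> \<exists>C. \<forall>x y. a \<le> x \<longrightarrow> x \<le> y \<longrightarrow> y \<le> b \<longrightarrow>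
       norm (f y - f x - (LINT s:{x<..y}|lborel. g s)) \<le> C * (LINT s:{x<..y}|lborel. h s)\<^sup>2"
  shows "primitive f g"
proof -
  obtain H where H: "primitive H h" using primitive_exists[OF h(1)] by blast
  have "f b - f a = (LINT s:{a<..b}|lborel. g s)" if ab: "a \<le> b" for a b
  proof -
    from le[OF ab] obtain C where C: "\<forall>x y. a \<le> x \<longrightarrow> x \<le> y \<longrightarrow> y \<le> b \<longrightarrow>
       norm (f y - f x - (LINT s:{x<..y}|lborel. g s)) \<le> C * (LINT s:{x<..y}|lborel. h s)\<^sup>2"
      by (rule exE)
    have "norm (f b - f a - (LINT s:{a<..b}|lborel. g s)) \<le> 0"
    proof (rule subadditive_quadratic_nonpos
        [where D = "\<lambda>x y. norm (f y - f x - (LINT s:{x<..y}|lborel. g s))" and H = H and C = C])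
      show "a \<le> b" by (rule ab)
      show "continuous_on {a..b} H"
        using primitive_continuous[OF H] by (rule continuous_on_subset) simp
      show "H x \<le> H y" if "x \<le> y" for x y using primitive_mono[OF H h(2) that] .
      show "norm (f z - f x - (LINT s:{x<..z}|lborel. g s)) \<le>
         norm (f y - f x - (LINT s:{x<..y}|lborel. g s)) + norm (f z - f y - (LINT s:{y<..z}|lborel. g s))"
        if "x \<le> y" "y \<le> z" for x y z
        unfolding set_integral_Ioc_add[OF g that]
        by (rule order_trans[OF _ norm_triangle_ineq]) (simp add: algebra_simps)
      show "norm (f y - f x - (LINT s:{x<..y}|lborel. g s)) \<le> C * (H y - H x)\<^sup>2"
        if "a \<le> x" "x \<le> y" "y \<le> b" for x y
        using C[rule_format, OF that] unfolding primitive_diff_eq[OF H that(2)] .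
    qed
    then show ?thesis by simp
  qed
  then show ?thesis using g by (simp add: primitive_def)
qed

section \<open>Product rule and exponential of a primitive\<close>

lemma set_integral_bounded_linear:
  assumes "bounded_linear T" "set_integrable M A f"
  shows "set_integrable M A (\<lambda>x. T (f x))" (is ?int)
    and "(LINT x:A|M. T (f x)) = T (LINT x:A|M. f x)" (is ?eq)
proof -
  have "(\<lambda>x. T (indicat_real A x *\<^sub>R f x)) = (\<lambda>x. indicat_real A x *\<^sub>R T (f x))"
    using assms(1) by (simp add: bounded_linear.linear linear_cmul)
  then show ?int ?eq
    using integrable_bounded_linear[OF assms[unfolded set_integrable_def]]
      integral_bounded_linear[OF assms[unfolded set_integrable_def]]
    unfolding set_integrable_def set_lebesgue_integral_def by simp_all
qed

lemma primitive_norm_diff_bound: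
  assumes f: "primitive f f'" and H: "primitive H h" and le: "\<And>s. norm (f' s) \<le> h s"
    and "a \<le> x" "x \<le> y" "y \<le> b"
  shows "norm (f y - f x) \<le> H b - H a"
proof -
  have h: "0 \<le> h s" for s using le[of s] norm_ge_zero order_trans by blast
  have "norm (f y - f x) \<le> (LINT s:{x<..y}|lborel. h s)"
    unfolding primitive_diff_eq[OF f \<open>x \<le> y\<close>]
    using f H le by (intro norm_set_integral_Ioc_le) (auto intro: primitive_locally_integrable)
  also have "\<dots> = H y - H x" using primitive_diff_eq[OF H \<open>x \<le> y\<close>] by simp
  also have "\<dots> \<le> H b - H a"
    using primitive_mono[OF H h \<open>a \<le> x\<close>] primitive_mono[OF H h \<open>y \<le> b\<close>] by simp
  finally show ?thesis .
qed

text \<open>Replacing \<open>g s\<close> by \<open>g y\<close> and \<open>f s\<close> by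
  \<open>f x\<close> in the integrand costs a density times an oscillation. Both the integral of the
  densities and the oscillations are bounded by the increment of \<open>H\<close>, so the defect is
  quadratic.\<close>

lemma primitive_bilinear:
  fixes B :: "'a::{banach, second_countable_topology} \<Rightarrow>
      'b::{banach, second_countable_topology} \<Rightarrow> 'c::{banach, second_countable_topology}"
  assumes B: "bounded_bilinear B" and f: "primitive f f'" and g: "primitive g g'"
  shows "primitive (\<lambda>x. B (f x) (g x)) (\<lambda>x. B (f' x) (g x) + B (f x) (g' x))"
proof -
  interpret B: bounded_bilinear B by (rule B)
  have f': "locally_integrable f'" and g': "locally_integrable g'"
    using f g by (auto intro: primitive_locally_integrable)
  have cf: "continuous_on UNIV f" and cg: "continuous_on UNIV g"
    using f g by (auto intro: primitive_continuous)
  let ?h = "\<lambda>s. norm (f' s) + norm (g' s)"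
  have h: "locally_integrable ?h"
    using f' g' by (intro locally_integrable_add locally_integrable_norm)
  obtain H where H: "primitive H ?h" using primitive_exists[OF h] by blast
  obtain K where K: "0 \<le> K" "\<And>a b. norm (B a b) \<le> norm a * norm b * K"
    using B.nonneg_bounded by blast
  have left: "locally_integrable (\<lambda>s. B (k s) (c s))"
    if "locally_integrable k" "continuous_on UNIV c" for k c
    using locally_integrable_bilinear[OF B.flip that(2,1)] .
  have right: "locally_integrable (\<lambda>s. B (c s) (k s))"
    if "locally_integrable k" "continuous_on UNIV c" for k c
    using locally_integrable_bilinear[OF B that(2,1)] .
  have lint: "locally_integrable (\<lambda>x. B (f' x) (g x) + B (f x) (g' x))"
    by (intro locally_integrable_add left right f' g' cf cg)
  show ?thesis
  proof (rule primitive_if_increments_le[OF lint h])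
    fix a b :: real
    have "norm (B (f y) (g y) - B (f x) (g x) - (LINT s:{x<..y}|lborel. B (f' s) (g s) + B (f s) (g' s)))
        \<le> K * (LINT s:{x<..y}|lborel. ?h s)\<^sup>2" if "x \<le> y" for x y
    proof -
      \<comment> \<open>Taking \<open>g\<close> at the right end and \<open>f\<close> at the left
        end makes this splitting exact, without a term that is bilinear in the two
        increments.\<close>
      have "B (f y) (g y) - B (f x) (g x) = B (f y - f x) (g y) + B (f x) (g y - g x)"
        by (simp add: B.diff_left B.diff_right)
      also have "\<dots> = (LINT s:{x<..y}|lborel. B (f' s) (g y)) + (LINT s:{x<..y}|lborel. B (f x) (g' s))"
        unfolding primitive_diff_eq[OF f that] primitive_diff_eq[OF g that]
        using set_integral_bounded_linear(2)[OF B.bounded_linear_left locally_integrable_Ioc[OF f']]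
          set_integral_bounded_linear(2)[OF B.bounded_linear_right locally_integrable_Ioc[OF g']]
        by simp
      finally have "B (f y) (g y) - B (f x) (g x)
          - (LINT s:{x<..y}|lborel. B (f' s) (g s) + B (f s) (g' s))
        = (LINT s:{x<..y}|lborel. (B (f' s) (g y) + B (f x) (g' s)) - (B (f' s) (g s) + B (f s) (g' s)))"
        using locally_integrable_Ioc[OF left[OF f' continuous_on_const]] locally_integrable_Ioc[OF right[OF g' continuous_on_const]]
          locally_integrable_Ioc[OF lint]
        by (subst set_integral_diff) (auto simp: set_integral_add)
      also have "\<dots> = (LINT s:{x<..y}|lborel. B (f' s) (g y - g s) + B (f x - f s) (g' s))"
        by (simp add: B.diff_left B.diff_right algebra_simps)
      finally have eq: "B (f y) (g y) - B (f x) (g x)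
          - (LINT s:{x<..y}|lborel. B (f' s) (g s) + B (f s) (g' s)) = \<dots>" .
      have "norm (LINT s:{x<..y}|lborel. B (f' s) (g y - g s) + B (f x - f s) (g' s))
        \<le> (LINT s:{x<..y}|lborel. (K * (H y - H x)) * ?h s)"
      proof (rule norm_set_integral_Ioc_le)
        show "locally_integrable (\<lambda>s. B (f' s) (g y - g s) + B (f x - f s) (g' s))"
          by (intro locally_integrable_add left right f' g' continuous_intros cf cg)
        show "locally_integrable (\<lambda>s. (K * (H y - H x)) * ?h s)"
          using locally_integrable_bilinear[OF bounded_bilinear_mult continuous_on_const h] .
        fix s assume s: "x < s" "s \<le> y"
        have "norm (g y - g s) \<le> H y - H x"
          by (rule primitive_norm_diff_bound[OF g H]) (use s in auto)
        moreover have "norm (f x - f s) \<le> H y - H x"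
          using primitive_norm_diff_bound[OF f H, of x x s y] s by (simp add: norm_minus_commute)
        ultimately have "norm (f' s) * norm (g y - g s) * K + norm (f x - f s) * norm (g' s) * K
          \<le> norm (f' s) * (H y - H x) * K + (H y - H x) * norm (g' s) * K"
          using K(1) by (intro add_mono mult_right_mono mult_left_mono) auto
        then show "norm (B (f' s) (g y - g s) + B (f x - f s) (g' s)) \<le> (K * (H y - H x)) * ?h s"
          using norm_triangle_ineq[of "B (f' s) (g y - g s)" "B (f x - f s) (g' s)"]
            K(2)[of "f' s" "g y - g s"] K(2)[of "f x - f s" "g' s"]
          by (simp add: algebra_simps)
      qed
      also have "\<dots> = K * (LINT s:{x<..y}|lborel. ?h s)\<^sup>2"
        unfolding set_integral_mult_right primitive_diff_eq[OF H that] by (simp add: power2_eq_square)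
      finally show ?thesis unfolding eq .
    qed
    then show "\<exists>C. \<forall>x y. a \<le> x \<longrightarrow> x \<le> y \<longrightarrow> y \<le> b \<longrightarrow>
       norm (B (f y) (g y) - B (f x) (g x) - (LINT s:{x<..y}|lborel. B (f' s) (g s) + B (f s) (g' s)))
        \<le> C * (LINT s:{x<..y}|lborel. ?h s)\<^sup>2" by blast
  qed simp
qed

text \<open>The defect is the sum of the Taylor remainder of the exponential at \<open>L x\<close>
  and of the error from freezing \<open>exp (L s)\<close> at \<open>s = x\<close> under the
  integral. Both are quadratic in the increment of \<open>H\<close>, which dominates the oscillation
  of \<open>L\<close>.\<close>

lemma primitive_exp:
  fixes L l :: "real \<Rightarrow> complex"
  assumes L: "primitive L l"
  shows "primitive (\<lambda>x. exp (L x)) (\<lambda>x. l x * exp (L x))"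
proof -
  have l: "locally_integrable l" and cL: "continuous_on UNIV L"
    using L by (auto intro: primitive_locally_integrable primitive_continuous)
  have h: "locally_integrable (\<lambda>s. norm (l s))" using l by (rule locally_integrable_norm)
  obtain H where H: "primitive H (\<lambda>s. norm (l s))" using primitive_exists[OF h] by blast
  have mult: "locally_integrable (\<lambda>s. l s * c s)" if "continuous_on UNIV c" for c
    using locally_integrable_bilinear[OF bounded_bilinear_mult that l] by (simp add: mult.commute)
  have lint: "locally_integrable (\<lambda>x. l x * exp (L x))"
    by (intro mult continuous_intros cL)
  show ?thesis
  proof (rule primitive_if_increments_le[OF lint h])
    fix a b :: real
    have "compact (L ` {a..b})"
      by (intro compact_continuous_image continuous_on_subset[OF cL]) auto
    then obtain R where R: "\<And>x. x \<in> {a..b} \<Longrightarrow> norm (L x) \<le> R"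
      using compact_imp_bounded bounded_iff by (metis image_eqI)
    have exp_bound: "norm (exp (L x)) \<le> exp R" if "x \<in> {a..b}" for x
      using norm_exp[of "L x"] R[OF that] by (meson exp_le_cancel_iff order_trans)
    have re: "exp \<bar>Re (L x - L y)\<bar> \<le> exp (2 * R)" if "x \<in> {a..b}" "y \<in> {a..b}" for x y
      using R[OF that(1)] R[OF that(2)] abs_Re_le_cmod[of "L x - L y"] norm_triangle_ineq4[of "L x" "L y"]
      by simp
    \<comment> \<open>The two errors contribute \<open>exp R * exp (2 * R)\<close> each:
      \<open>exp R\<close> bounds the factor \<open>exp (L x)\<close> taken out, and
      \<open>exp (2 * R)\<close> bounds the exponential of the real part in the Taylor
      remainder.\<close>
    have "norm (exp (L y) - exp (L x) - (LINT s:{x<..y}|lborel. l s * exp (L s)))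
        \<le> (2 * exp R * exp (2 * R)) * (LINT s:{x<..y}|lborel. norm (l s))\<^sup>2"
      if xy: "a \<le> x" "x \<le> y" "y \<le> b" for x y
    proof -
      have int: "L y - L x = (LINT s:{x<..y}|lborel. l s)" by (rule primitive_diff_eq[OF L xy(2)])
      have Hxy: "norm (L y - L x) \<le> H y - H x"
        by (rule primitive_norm_diff_bound[OF L H]) (use xy in auto)
      have "exp (L x) * (L y - L x) - (LINT s:{x<..y}|lborel. l s * exp (L s))
        = (LINT s:{x<..y}|lborel. l s * exp (L x) - l s * exp (L s))"
        unfolding int
        by (subst set_integral_diff) (auto intro!: locally_integrable_Ioc mult lint l)
      also have "\<dots> = (LINT s:{x<..y}|lborel. l s * (exp (L x) - exp (L s)))"
        by (simp add: algebra_simps)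
      finally have eq: "exp (L x) * (L y - L x) - (LINT s:{x<..y}|lborel. l s * exp (L s)) = \<dots>" .
      have "norm (LINT s:{x<..y}|lborel. l s * (exp (L x) - exp (L s)))
         \<le> (LINT s:{x<..y}|lborel. (exp R * exp (2 * R) * (H y - H x)) * norm (l s))"
      proof (rule norm_set_integral_Ioc_le)
        show "locally_integrable (\<lambda>s. l s * (exp (L x) - exp (L s)))"
          by (intro mult continuous_intros cL)
        show "locally_integrable (\<lambda>s. exp R * exp (2 * R) * (H y - H x) * norm (l s))"
          using locally_integrable_bilinear[OF bounded_bilinear_mult continuous_on_const h] .
        fix s assume s: "x < s" "s \<le> y"
        have "exp (L x) - exp (L s) = - (exp (L x) * (exp (L s - L x) - 1))"
          by (simp add: exp_diff algebra_simps)
        then have "norm (exp (L x) - exp (L s)) = norm (exp (L x)) * norm (exp (L s - L x) - 1)"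
          by (simp add: norm_mult)
        also have "\<dots> \<le> exp R * (exp (2 * R) * (H y - H x))"
        proof (intro mult_mono)
          have "norm (exp (L s - L x) - 1) \<le> exp \<bar>Re (L s - L x)\<bar> * norm (L s - L x)"
            using Taylor_exp[of "L s - L x" 0] by simp
          also have "\<dots> \<le> exp (2 * R) * (H y - H x)"
            using re[of s x] primitive_norm_diff_bound[OF L H, of x x s y] s xy
            by (intro mult_mono) auto
          finally show "norm (exp (L s - L x) - 1) \<le> exp (2 * R) * (H y - H x)" .
        qed (use exp_bound xy in auto)
        finally have "norm (l s) * norm (exp (L x) - exp (L s)) \<le> norm (l s) * (exp R * (exp (2 * R) * (H y - H x)))"
          by (rule mult_left_mono) simp
        then show "norm (l s * (exp (L x) - exp (L s))) \<le> exp R * exp (2 * R) * (H y - H x) * norm (l s)"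
          by (simp only: norm_mult mult_ac)
      qed
      also have "\<dots> = exp R * exp (2 * R) * (LINT s:{x<..y}|lborel. norm (l s))\<^sup>2"
        unfolding set_integral_mult_right primitive_diff_eq[OF H xy(2)] by (simp add: power2_eq_square)
      finally have 1: "norm (exp (L x) * (L y - L x) - (LINT s:{x<..y}|lborel. l s * exp (L s)))
         \<le> exp R * exp (2 * R) * (LINT s:{x<..y}|lborel. norm (l s))\<^sup>2" unfolding eq .
      have "exp (L y) - exp (L x) - exp (L x) * (L y - L x)
        = exp (L x) * (exp (L y - L x) - (1 + (L y - L x)))"
        by (simp add: exp_diff algebra_simps)
      then have "norm (exp (L y) - exp (L x) - exp (L x) * (L y - L x))
        = norm (exp (L x)) * norm (exp (L y - L x) - (1 + (L y - L x)))"
        by (simp add: norm_mult)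
      also have "\<dots> \<le> exp R * (exp (2 * R) * (H y - H x)\<^sup>2)"
      proof (intro mult_mono)
        have "norm (exp (L y - L x) - (1 + (L y - L x))) \<le> exp \<bar>Re (L y - L x)\<bar> * (norm (L y - L x))\<^sup>2"
          using Taylor_exp[of "L y - L x" 1] by (simp add: numeral_2_eq_2)
        also have "\<dots> \<le> exp (2 * R) * (H y - H x)\<^sup>2"
          using re[of y x] Hxy xy by (intro mult_mono power_mono) auto
        finally show "norm (exp (L y - L x) - (1 + (L y - L x))) \<le> exp (2 * R) * (H y - H x)\<^sup>2" .
      qed (use exp_bound xy in auto)
      finally have 2: "norm (exp (L y) - exp (L x) - exp (L x) * (L y - L x))
        \<le> exp R * exp (2 * R) * (LINT s:{x<..y}|lborel. norm (l s))\<^sup>2"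
        unfolding primitive_diff_eq[OF H xy(2)] by simp
      have eq: "exp (L y) - exp (L x) - (LINT s:{x<..y}|lborel. l s * exp (L s))
        = (exp (L y) - exp (L x) - exp (L x) * (L y - L x))
          + (exp (L x) * (L y - L x) - (LINT s:{x<..y}|lborel. l s * exp (L s)))" by simp
      show ?thesis
        unfolding eq by (rule order_trans[OF norm_triangle_ineq]) (use 1 2 in linarith)
    qed
    then show "\<exists>C. \<forall>x y. a \<le> x \<longrightarrow> x \<le> y \<longrightarrow> y \<le> b \<longrightarrow>
       norm (exp (L y) - exp (L x) - (LINT s:{x<..y}|lborel. l s * exp (L s)))
        \<le> C * (LINT s:{x<..y}|lborel. norm (l s))\<^sup>2" by blast
  qed simp
qed

section \<open>Test functions\<close>

definition smooth :: "(real \<Rightarrow> real) \<Rightarrow> bool" where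
  "smooth f \<longleftrightarrow> (\<forall>n. (deriv ^^ n) f differentiable_on UNIV)"

text \<open>Membership in a class that is closed under differentiation is an invariant of the
  iterated derivatives, so no formula for the derivative of order \<open>n\<close> has to be found;
  it suffices to choose the class large enough.\<close>

lemma smooth_coinduct:
  assumes "f \<in> C"
    and step: "\<And>f. f \<in> C \<Longrightarrow> \<exists>f'\<in>C. \<forall>x. (f has_real_derivative f' x) (at x)"
  shows "smooth f"
proof -
  have "(deriv ^^ n) f \<in> C" for n
  proof (induction n)
    case (Suc n)
    then obtain f' where "f' \<in> C" "\<forall>x. ((deriv ^^ n) f has_real_derivative f' x) (at x)"
      using step by blast
    moreover from this(2) have "deriv ((deriv ^^ n) f) = f'"
      by (auto intro: DERIV_imp_deriv)
    ultimately show ?case by simp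
  qed (simp add: assms)
  then have "(deriv ^^ n) f differentiable (at x)" for n x
    using step real_differentiable_def by metis
  then show ?thesis
    by (simp add: smooth_def differentiable_on_def)
qed

lemma smooth_DERIV: "smooth f \<Longrightarrow> (f has_real_derivative deriv f x) (at x)"
  unfolding smooth_def differentiable_on_def
  by (drule spec[of _ 0]) (simp add: DERIV_deriv_iff_real_differentiable)

lemma smooth_deriv: "smooth f \<Longrightarrow> smooth (deriv f)"
  unfolding smooth_def by (metis comp_apply funpow_Suc_right)

lemma smooth_continuous: "smooth f \<Longrightarrow> continuous_on UNIV f"
  by (meson DERIV_isCont smooth_DERIV continuous_at_imp_continuous_on)

text \<open>The derivative of a product of smooth functions is a sum of products, so products alone
  are not closed under differentiation. This algebra is, by the Leibniz rule and the chain rule for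
  affine maps, and thus serves as the class in \<open>smooth_coinduct\<close>.\<close>

inductive_set smooth_algebra :: "(real \<Rightarrow> real) set" where
  base: "smooth f \<Longrightarrow> f \<in> smooth_algebra"
| const: "(\<lambda>x. c) \<in> smooth_algebra"
| add: "f \<in> smooth_algebra \<Longrightarrow> g \<in> smooth_algebra \<Longrightarrow> (\<lambda>x. f x + g x) \<in> smooth_algebra"
| mult: "f \<in> smooth_algebra \<Longrightarrow> g \<in> smooth_algebra \<Longrightarrow> (\<lambda>x. f x * g x) \<in> smooth_algebra"
| affine: "f \<in> smooth_algebra \<Longrightarrow> (\<lambda>x. f (a * x + b)) \<in> smooth_algebra"

lemma smooth_algebra_smooth:
  assumes "f \<in> smooth_algebra"
  shows "smooth f"
  using assms
proof (rule smooth_coinduct)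
  fix f assume "f \<in> smooth_algebra"
  then show "\<exists>f'\<in>smooth_algebra. \<forall>x. (f has_real_derivative f' x) (at x)"
  proof induction
    case (base f)
    then show ?case
      using smooth_DERIV smooth_deriv smooth_algebra.base by blast
  next
    case (const c)
    show ?case by (rule bexI[OF _ smooth_algebra.const[of 0]]) auto
  next
    case (add f g)
    then obtain f' g' where "f' \<in> smooth_algebra" "\<forall>x. (f has_real_derivative f' x) (at x)"
      "g' \<in> smooth_algebra" "\<forall>x. (g has_real_derivative g' x) (at x)" by blast
    then show ?case
      by (intro bexI[of _ "\<lambda>x. f' x + g' x"] smooth_algebra.add) (auto intro!: derivative_eq_intros)
  next
    case (mult f g)
    then obtain f' g' where "f' \<in> smooth_algebra" "\<forall>x. (f has_real_derivative f' x) (at x)"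
      "g' \<in> smooth_algebra" "\<forall>x. (g has_real_derivative g' x) (at x)" by blast
    then show ?case
      using mult.hyps
      by (intro bexI[of _ "\<lambda>x. f' x * g x + f x * g' x"] smooth_algebra.add smooth_algebra.mult)
        (auto intro!: derivative_eq_intros)
  next
    case (affine f a b)
    then obtain f' where f': "f' \<in> smooth_algebra" "\<forall>x. (f has_real_derivative f' x) (at x)" by blast
    have "((\<lambda>x. f (a * x + b)) has_real_derivative a * f' (a * x + b)) (at x)" for x
      by (rule DERIV_cong[OF DERIV_chain2[OF f'(2)[rule_format]] mult.commute])
        (auto intro!: derivative_eq_intros)
    then show ?case
      using f' by (intro bexI[of _ "\<lambda>x. a * f' (a * x + b)"] smooth_algebra.mult smooth_algebra.const
          smooth_algebra.affine) auto
  qed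
qed

lemma smooth_const: "smooth (\<lambda>x. c)"
  by (rule smooth_algebra_smooth[OF smooth_algebra.const])

lemma smooth_add: "smooth f \<Longrightarrow> smooth g \<Longrightarrow> smooth (\<lambda>x. f x + g x)"
  by (rule smooth_algebra_smooth, rule smooth_algebra.add; rule smooth_algebra.base)

lemma smooth_mult: "smooth f \<Longrightarrow> smooth g \<Longrightarrow> smooth (\<lambda>x. f x * g x)"
  by (rule smooth_algebra_smooth, rule smooth_algebra.mult; rule smooth_algebra.base)

lemma smooth_affine: "smooth f \<Longrightarrow> smooth (\<lambda>x. f (a * x + b))"
  by (rule smooth_algebra_smooth, rule smooth_algebra.affine; rule smooth_algebra.base)

section \<open>Smooth functions supported in an interval\<close>

definition flat :: "real poly \<Rightarrow> real \<Rightarrow> real" where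
  "flat q x = (if x \<le> 0 then 0 else poly q (inverse x) * exp (- inverse x))"

lemma poly_exp_tendsto_0:
  fixes q :: "real poly"
  shows "((\<lambda>y. poly q y * exp (- y)) \<longlongrightarrow> 0) at_top"
proof -
  have "((\<lambda>y. \<Sum>i\<le>degree q. coeff q i * (y ^ i / exp y)) \<longlongrightarrow> (\<Sum>i\<le>degree q. coeff q i * 0)) at_top"
    by (intro tendsto_sum tendsto_mult tendsto_const tendsto_power_div_exp_0)
  then show ?thesis
    by (simp add: poly_altdef exp_minus divide_inverse sum_distrib_right mult.assoc)
qed

text \<open>With \<open>y = 1 / x\<close> one has \<open>dy/dx = - y ^ 2\<close>, so the derivative
  of \<open>q(y) exp(-y)\<close> is \<open>y ^ 2 (q(y) - q'(y)) exp(-y)\<close>; the polynomial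
  \<open>[:0, 0, 1:]\<close> is this square. The family is indexed by all polynomials because
  differentiation changes \<open>q\<close>; the classical function \<open>exp (-1/x)\<close> is
  \<open>flat 1\<close>.\<close>

lemma flat_DERIV:
  "(flat q has_real_derivative flat ([:0, 0, 1:] * (q - pderiv q)) x) (at x)"
proof -
  consider "x < 0" | "x = 0" | "x > 0" by linarith
  then show ?thesis
  proof cases
    case 1
    have "((\<lambda>x. 0) has_real_derivative 0) (at x)" by simp
    then have "(flat q has_real_derivative 0) (at x)"
      by (rule has_field_derivative_transform_within_open[of _ _ _ "{..<0}"])
        (use 1 in \<open>auto simp: flat_def\<close>)
    then show ?thesis using 1 by (simp add: flat_def)
  next
    case 2
    \<comment> \<open>At 0 the difference quotient from the right is again of this form: division by
      \<open>h\<close> multiplies the polynomial by its variable.\<close>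
    have "((\<lambda>h. poly ([:0, 1:] * q) (inverse h) * exp (- inverse h)) \<longlongrightarrow> 0) (at_right 0)"
      by (rule filterlim_compose[OF poly_exp_tendsto_0 filterlim_inverse_at_top_right])
    then have "((\<lambda>h. flat q h / h) \<longlongrightarrow> 0) (at_right 0)"
      by (rule Lim_transform_eventually)
        (auto simp: eventually_at_right_less flat_def field_simps intro!: eventually_mono[OF eventually_at_right_less[of 0]])
    moreover have "((\<lambda>h. flat q h / h) \<longlongrightarrow> 0) (at_left 0)"
      by (rule tendsto_eventually) (auto simp: flat_def eventually_at_filter)
    ultimately have "((\<lambda>h. flat q h / h) \<longlongrightarrow> 0) (at 0)"
      by (simp add: filterlim_split_at)
    then show ?thesis using 2 by (simp add: has_field_derivative_iff flat_def)
  next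
    case 3
    have "((\<lambda>x. poly q (inverse x) * exp (- inverse x)) has_real_derivative
       poly ([:0, 0, 1:] * (q - pderiv q)) (inverse x) * exp (- inverse x)) (at x)"
      using 3 by (auto intro!: derivative_eq_intros DERIV_chain2[OF poly_DERIV]
          simp: power2_eq_square field_simps)
    then have "(flat q has_real_derivative
       poly ([:0, 0, 1:] * (q - pderiv q)) (inverse x) * exp (- inverse x)) (at x)"
      by (rule has_field_derivative_transform_within_open[of _ _ _ "{0<..}"])
        (use 3 in \<open>auto simp: flat_def\<close>)
    then show ?thesis using 3 by (simp add: flat_def)
  qed
qed

lemma smooth_flat: "smooth (flat q)"
  by (rule smooth_coinduct[of _ "range flat"]) (use flat_DERIV in blast)+

lemma flat_1_bounds: "0 \<le> flat 1 x" "flat 1 x \<le> 1"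
  by (auto simp: flat_def)

lemma flat_1_dilation_tendsto: "(\<lambda>n. flat 1 (real n * x)) \<longlonglongrightarrow> (if 0 < x then 1 else 0)"
proof (cases "0 < x")
  case True
  have "(\<lambda>n. exp (- (inverse x * inverse (real n)))) \<longlonglongrightarrow> exp (- (inverse x * 0))"
    by (intro tendsto_intros lim_inverse_n)
  then have "(\<lambda>n. flat 1 (real n * x)) \<longlonglongrightarrow> exp (- (inverse x * 0))"
    by (rule Lim_transform_eventually)
      (use True in \<open>auto simp: flat_def mult_le_0_iff intro!: eventually_mono[OF eventually_gt_at_top[of 0]]\<close>)
  then show ?thesis using True by simp
next
  case False
  then have "flat 1 (real n * x) = 0" for n
    by (auto simp: flat_def mult_le_0_iff)
  then show ?thesis using False by simp
qed

text \<open>The dilation by \<open>n\<close> steepens both flanks, so that the indicator of the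
  interval is approached pointwise from below while the support stays inside the interval; this
  takes the place of mollification.\<close>

definition bump :: "nat \<Rightarrow> real \<Rightarrow> real \<Rightarrow> real \<Rightarrow> real" where
  "bump n a b x = flat 1 (real n * (x - a)) * flat 1 (real n * (b - x))"

lemma smooth_bump: "smooth (bump n a b)"
proof -
  have "smooth (\<lambda>x. flat 1 (real n * x + - (real n * a)) * flat 1 (- real n * x + real n * b))"
    by (intro smooth_mult smooth_affine smooth_flat)
  then show ?thesis by (simp add: bump_def[abs_def] algebra_simps)
qed

lemma bump_eq_0: "x \<notin> {a<..<b} \<Longrightarrow> bump n a b x = 0"
  by (auto simp: bump_def flat_def mult_le_0_iff)

lemma bump_bounds: "0 \<le> bump n a b x" "bump n a b x \<le> 1"
  unfolding bump_def using flat_1_bounds by (auto intro: mult_le_one)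

lemma bump_tendsto: "(\<lambda>n. bump n a b x) \<longlonglongrightarrow> indicator {a<..<b} x"
proof -
  have "(\<lambda>n. bump n a b x) \<longlonglongrightarrow> (if 0 < x - a then 1 else 0) * (if 0 < b - x then 1 else 0)"
    unfolding bump_def by (intro tendsto_mult flat_1_dilation_tendsto)
  then show ?thesis by (simp add: indicator_def split: if_splits)
qed

lemma test_function_iff:
  "test_function \<phi> \<longleftrightarrow> smooth \<phi> \<and> (\<exists>R. \<forall>x. R < \<bar>x\<bar> \<longrightarrow> \<phi> x = 0)"
proof -
  have "compact (closure (support_on UNIV \<phi>)) \<longleftrightarrow> (\<exists>R. \<forall>x. \<phi> x \<noteq> 0 \<longrightarrow> \<bar>x\<bar> \<le> R)"
    by (simp add: compact_closure bounded_iff support_on_def)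
  also have "\<dots> \<longleftrightarrow> (\<exists>R. \<forall>x. R < \<bar>x\<bar> \<longrightarrow> \<phi> x = 0)"
    by (meson not_less)
  finally show ?thesis by (simp add: test_function_def smooth_def)
qed

lemma test_function_bump: "test_function (bump n a b)"
proof -
  have "bump n a b x = 0" if "\<bar>a\<bar> + \<bar>b\<bar> < \<bar>x\<bar>" for x
    by (rule bump_eq_0) (use that in auto)
  then show ?thesis unfolding test_function_iff using smooth_bump by blast
qed

lemma test_function_smooth: "test_function \<phi> \<Longrightarrow> smooth \<phi>"
  by (simp add: test_function_iff)

lemma test_function_support:
  assumes "test_function \<phi>"
  obtains R where "0 < R" "\<And>x. R \<le> \<bar>x\<bar> \<Longrightarrow> \<phi> x = 0"
proof -
  obtain R where "\<And>x. R < \<bar>x\<bar> \<Longrightarrow> \<phi> x = 0" using assms test_function_iff by auto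
  then have "\<And>x. \<bar>R\<bar> + 1 \<le> \<bar>x\<bar> \<Longrightarrow> \<phi> x = 0" by auto
  then show thesis by (intro that[of "\<bar>R\<bar> + 1"]) auto
qed

lemma test_function_deriv_eq_0:
  assumes "test_function \<phi>" and R: "\<And>x. R \<le> \<bar>x\<bar> \<Longrightarrow> \<phi> x = 0" and "R < \<bar>x\<bar>"
  shows "deriv \<phi> x = 0"
proof (rule DERIV_imp_deriv)
  have "((\<lambda>x. 0) has_real_derivative 0) (at x)" by simp
  then show "(\<phi> has_real_derivative 0) (at x)"
  proof (rule has_field_derivative_transform_within_open)
    show "open {x::real. R < \<bar>x\<bar>}" by (intro open_Collect_less continuous_intros)
  qed (use assms in auto)
qed

lemma test_function_deriv:
  assumes "test_function \<phi>"
  shows "test_function (deriv \<phi>)"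
proof -
  obtain R where R: "\<And>x. R \<le> \<bar>x\<bar> \<Longrightarrow> \<phi> x = 0" using test_function_support[OF assms] by auto
  have "deriv \<phi> x = 0" if "R < \<bar>x\<bar>" for x
    using that by (rule test_function_deriv_eq_0[OF assms, rotated]) (rule R)
  then show ?thesis
    using assms smooth_deriv by (auto simp: test_function_iff)
qed

lemma test_function_funpow_deriv: "test_function \<phi> \<Longrightarrow> test_function ((deriv ^^ n) \<phi>)"
  by (induction n) (auto intro: test_function_deriv)

lemma test_function_linear:
  assumes "test_function \<phi>" "test_function \<psi>"
  shows "test_function (\<lambda>x. \<phi> x + c * \<psi> x)"
proof -
  obtain R where R: "\<And>x. R \<le> \<bar>x\<bar> \<Longrightarrow> \<phi> x = 0" using test_function_support[OF assms(1)] by auto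
  obtain S where S: "\<And>x. S \<le> \<bar>x\<bar> \<Longrightarrow> \<psi> x = 0" using test_function_support[OF assms(2)] by auto
  have "\<forall>x. max R S < \<bar>x\<bar> \<longrightarrow> \<phi> x + c * \<psi> x = 0" using R S by auto
  moreover have "smooth (\<lambda>x. \<phi> x + c * \<psi> x)"
    using assms by (intro smooth_add smooth_mult smooth_const test_function_smooth)
  ultimately show ?thesis unfolding test_function_iff by blast
qed

section \<open>Functions whose integrals against test functions vanish\<close>

lemma test_function_integrable:
  fixes v :: "real \<Rightarrow> 'a::{banach, second_countable_topology}"
  assumes \<phi>: "test_function \<phi>" and v: "locally_integrable v"
  shows "integrable lborel (\<lambda>x. \<phi> x *\<^sub>R v x)"
proof -
  obtain R where R: "\<And>x. R \<le> \<bar>x\<bar> \<Longrightarrow> \<phi> x = 0" using test_function_support[OF \<phi>] by auto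
  have "locally_integrable (\<lambda>x. \<phi> x *\<^sub>R v x)"
    using locally_integrable_bilinear[OF bounded_bilinear_scaleR _ v] \<phi>
    by (simp add: smooth_continuous test_function_smooth)
  then have "set_integrable lborel {-R..R} (\<lambda>x. \<phi> x *\<^sub>R v x)"
    by (rule locally_integrable_set_integrable) auto
  moreover have "(\<lambda>x. indicat_real {-R..R} x *\<^sub>R \<phi> x *\<^sub>R v x) = (\<lambda>x. \<phi> x *\<^sub>R v x)"
  proof
    fix x
    show "indicat_real {-R..R} x *\<^sub>R \<phi> x *\<^sub>R v x = \<phi> x *\<^sub>R v x"
      by (cases "R \<le> \<bar>x\<bar>") (auto simp: R indicator_def)
  qed
  ultimately show ?thesis unfolding set_integrable_def by simp
qed

text \<open>Open intervals are stable under intersection and generate the Borel sets, and the sets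
  over which the integral vanishes are closed under complements and countable disjoint unions.
  Cutting everything down to \<open>{- real n<..<real n}\<close> makes \<open>v\<close> integrable,
  so that countable additivity applies.\<close>

lemma AE_zero_if_interval_integrals_zero:
  fixes v :: "real \<Rightarrow> 'a::{banach, second_countable_topology}"
  assumes v: "locally_integrable v" and zero: "\<And>a b. (LINT x:{a<..<b}|lborel. v x) = 0"
  shows "AE x in lborel. v x = 0"
proof -
  have sets_borel: "sets borel = sigma_sets UNIV (range (\<lambda>(a, b). {a<..<b::real}))"
    using arg_cong[OF borel_eq_box[where 'a = real], of sets] by simp
  have "AE x in lborel. indicat_real {- real n<..<real n} x *\<^sub>R v x = 0" for n :: nat
  proof (rule sigma_finite_measure.density_zero[OF sigma_finite_lborel])
    let ?I = "{- real n<..<real n}"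
    have I: "set_integrable lborel ?I v"
      by (rule locally_integrable_set_integrable[OF v]) auto
    then show "integrable lborel (\<lambda>x. indicat_real ?I x *\<^sub>R v x)"
      by (simp add: set_integrable_def)
    have sub: "set_integrable lborel (A \<inter> ?I) v" if "A \<in> sets borel" for A
      by (rule set_integrable_subset[OF I]) (use that in auto)
    have *: "(LINT x:A \<inter> ?I|lborel. v x) = 0" if "A \<in> sigma_sets UNIV (range (\<lambda>(a, b). {a<..<b::real}))" for A
    proof (rule sigma_sets_induct_disjoint[OF _ _ that])
      have borel: "B \<in> sets borel" if "B \<in> sigma_sets UNIV (range (\<lambda>(a, b). {a<..<b::real}))" for B
        using that sets_borel by simp
      show "Int_stable (range (\<lambda>(a, b). {a<..<b::real}))"
        by (auto simp: Int_stable_def)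
      show "range (\<lambda>(a, b). {a<..<b::real}) \<subseteq> Pow UNIV" by simp
      show "(LINT x:A \<inter> ?I|lborel. v x) = 0" if A: "A \<in> range (\<lambda>(a, b). {a<..<b})" for A
      proof -
        obtain a b where "A = {a<..<b}" using A by auto
        then have "A \<inter> ?I = {max a (- real n)<..<min b (real n)}" by auto
        then show ?thesis using zero by simp
      qed
      show "(LINT x:{} \<inter> ?I|lborel. v x) = 0" by (simp add: set_lebesgue_integral_def)
      show "(LINT x:(UNIV - A) \<inter> ?I|lborel. v x) = 0"
        if A: "A \<in> sigma_sets UNIV (range (\<lambda>(a, b). {a<..<b}))" "(LINT x:A \<inter> ?I|lborel. v x) = 0" for A
      proof -
        have "?I = (UNIV - A) \<inter> ?I \<union> A \<inter> ?I" by auto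
        then have "(LINT x:?I|lborel. v x) = (LINT x:(UNIV - A) \<inter> ?I|lborel. v x) + (LINT x:A \<inter> ?I|lborel. v x)"
          using borel[OF A(1)] by (subst set_integral_Un[symmetric]) (auto intro!: sub)
        then show ?thesis using A(2) zero by simp
      qed
      show "(LINT x:(\<Union>i. A i) \<inter> ?I|lborel. v x) = 0"
        if A: "disjoint_family A" "range A \<subseteq> sigma_sets UNIV (range (\<lambda>(a, b). {a<..<b}))"
          "\<And>i. (LINT x:A i \<inter> ?I|lborel. v x) = 0" for A :: "nat \<Rightarrow> real set"
      proof -
        have m: "A i \<in> sets borel" for i using borel A(2) by auto
        have eq: "(\<Union>i. A i) \<inter> ?I = (\<Union>i. A i \<inter> ?I)" by auto
        have "set_integrable lborel ((\<Union>i. A i) \<inter> ?I) v" by (rule sub) (use m in auto)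
        then have "(LINT x:(\<Union>i. A i) \<inter> ?I|lborel. v x) = (\<Sum>i. (LINT x:A i \<inter> ?I|lborel. v x))"
          unfolding eq using A(1) m
          by (intro lebesgue_integral_countable_add) (auto simp: disjoint_family_on_def)
        then show ?thesis using A(3) by simp
      qed
    qed
    show "(LINT x:A|lborel. indicat_real ?I x *\<^sub>R v x) = 0" if "A \<in> sets lborel" for A
    proof -
      have "(LINT x:A \<inter> ?I|lborel. v x) = 0" using *[of A] that sets_borel by simp
      then show ?thesis
        by (simp add: set_lebesgue_integral_def indicator_inter_arith mult.commute)
    qed
  qed
  then have "AE x in lborel. \<forall>n::nat. indicat_real {- real n<..<real n} x *\<^sub>R v x = 0"
    unfolding AE_all_countable by blast
  then show ?thesis
  proof (eventually_elim)
    case (elim x)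
    obtain n :: nat where "\<bar>x\<bar> < real n" using reals_Archimedean2 by blast
    then have "x \<in> {- real n<..<real n}" by auto
    then show ?case using elim[rule_format, of n] by simp
  qed
qed

lemma bump_integral_tendsto:
  fixes v :: "real \<Rightarrow> 'a::{banach, second_countable_topology}"
  assumes v: "locally_integrable v"
  shows "(\<lambda>n. LINT x|lborel. bump n a b x *\<^sub>R v x) \<longlonglongrightarrow> (LINT x:{a<..<b}|lborel. v x)"
  unfolding set_lebesgue_integral_def
proof (rule integral_dominated_convergence)
  show "(\<lambda>x. indicat_real {a<..<b} x *\<^sub>R v x) \<in> borel_measurable lborel"
    using locally_integrable_measurable[OF v] by simp
  show "(\<lambda>x. bump n a b x *\<^sub>R v x) \<in> borel_measurable lborel" for n
    using test_function_integrable[OF test_function_bump v] by (rule borel_measurable_integrable)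
  have "set_integrable lborel {a<..<b} (\<lambda>x. norm (v x))"
    by (rule locally_integrable_set_integrable[OF locally_integrable_norm[OF v]]) auto
  then show "integrable lborel (\<lambda>x. indicat_real {a<..<b} x * norm (v x))"
    by (simp add: set_integrable_def)
  show "AE x in lborel. (\<lambda>n. bump n a b x *\<^sub>R v x) \<longlonglongrightarrow> indicat_real {a<..<b} x *\<^sub>R v x"
    by (intro AE_I2 tendsto_scaleR bump_tendsto tendsto_const)
  show "AE x in lborel. norm (bump n a b x *\<^sub>R v x) \<le> indicat_real {a<..<b} x * norm (v x)" for n
  proof (rule AE_I2)
    fix x
    show "norm (bump n a b x *\<^sub>R v x) \<le> indicat_real {a<..<b} x * norm (v x)"
      using bump_bounds[of n a b x] bump_eq_0[of x a b n]
      by (cases "x \<in> {a<..<b}") (auto intro: mult_left_le_one_le)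
  qed
qed

text \<open>The fundamental lemma of the calculus of variations; dominated convergence of the bumps
  turns test functions into interval indicators.\<close>

lemma AE_zero_if_test_integrals_zero:
  fixes v :: "real \<Rightarrow> 'a::{banach, second_countable_topology}"
  assumes v: "locally_integrable v"
    and zero: "\<And>\<phi>. test_function \<phi> \<Longrightarrow> (LINT x|lborel. \<phi> x *\<^sub>R v x) = 0"
  shows "AE x in lborel. v x = 0"
proof (rule AE_zero_if_interval_integrals_zero[OF v])
  fix a b :: real
  show "(LINT x:{a<..<b}|lborel. v x) = 0"
    using bump_integral_tendsto[OF v, of a b] zero[OF test_function_bump]
    by (simp add: LIMSEQ_const_iff)
qed

section \<open>Weak derivatives\<close>

lemma primitive_of_DERIV:
  fixes f :: "real \<Rightarrow> real"
  assumes f: "\<And>x. (f has_real_derivative f' x) (at x)" and cont: "continuous_on UNIV f'"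
  shows "primitive f f'"
proof -
  have f': "locally_integrable f'" using cont by (rule locally_integrable_continuous)
  have "f y - f x = (LINT s:{x<..y}|lborel. f' s)" if "x \<le> y" for x y
  proof -
    have "(f has_vector_derivative f' s) (at s within {x..y})" for s
      using f[of s] has_real_derivative_iff_has_vector_derivative has_vector_derivative_at_within by blast
    then have "(f' has_integral (f y - f x)) {x..y}"
      by (intro fundamental_theorem_of_calculus that)
    then show ?thesis
      unfolding set_integral_Ioc_eq_integral[OF f'] by (simp add: integral_unique)
  qed
  then show ?thesis using f' by (simp add: primitive_def)
qed

lemma primitive_DERIV:
  fixes f :: "real \<Rightarrow> real"
  assumes f: "primitive f g" and cont: "continuous_on UNIV g"
  shows "(f has_real_derivative g x) (at x)"
proof -
  have D: "((\<lambda>t. f (x - 1) + integral {x-1..t} g) has_real_derivative g x) (at x within {x-1..x+1})"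
    using integral_has_real_derivative[of "x-1" "x+1" g x] cont
    by (auto intro!: derivative_eq_intros intro: continuous_on_subset)
  have eq: "f (x - 1) + integral {x-1..t} g = f t" if "t \<in> {x-1..x+1}" for t
    using primitive_diff_eq[OF f, of "x-1" t] that primitive_locally_integrable[OF f]
    by (simp add: set_integral_Ioc_eq_integral)
  have "(f has_real_derivative g x) (at x within {x-1..x+1})"
    by (rule has_field_derivative_transform_within[OF D zero_less_one]) (use eq in auto)
  then show ?thesis
    by (simp add: at_within_Icc_at)
qed

lemma set_integral_eq_integral_if_support:
  fixes f :: "real \<Rightarrow> 'a::{banach, second_countable_topology}"
  assumes "\<And>x. x \<notin> A \<Longrightarrow> f x = 0"
  shows "(LINT x:A|lborel. f x) = (LINT x|lborel. f x)"
  unfolding set_lebesgue_integral_def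
  by (rule Bochner_Integration.integral_cong) (use assms in \<open>auto simp: indicator_def\<close>)

lemma primitive_integration_by_parts:
  fixes V :: "real \<Rightarrow> 'a::{banach, second_countable_topology}"
  assumes \<phi>: "test_function \<phi>" and V: "primitive V v"
  shows "(LINT x|lborel. deriv \<phi> x *\<^sub>R V x) = - (LINT x|lborel. \<phi> x *\<^sub>R v x)"
proof -
  obtain R where R: "0 < R" "\<And>x. R \<le> \<bar>x\<bar> \<Longrightarrow> \<phi> x = 0" using test_function_support[OF \<phi>] by auto
  have "primitive \<phi> (deriv \<phi>)"
    using \<phi> by (intro primitive_of_DERIV smooth_DERIV smooth_continuous smooth_deriv test_function_smooth)
  then have "primitive (\<lambda>x. \<phi> x *\<^sub>R V x) (\<lambda>x. deriv \<phi> x *\<^sub>R V x + \<phi> x *\<^sub>R v x)"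
    by (rule primitive_bilinear[OF bounded_bilinear_scaleR _ V])
  \<comment> \<open>The margin of 1 beyond the support keeps the complement of the interval inside
    the set \<open>R < \<bar>x\<bar>\<close>, on which \<open>deriv \<phi>\<close> is known to
    vanish.\<close>
  from primitive_diff_eq[OF this, of "- (R + 1)" "R + 1"]
  have zero: "(LINT x:{- (R + 1)<..R + 1}|lborel. deriv \<phi> x *\<^sub>R V x + \<phi> x *\<^sub>R v x) = 0"
    using R by simp
  have "deriv \<phi> x *\<^sub>R V x + \<phi> x *\<^sub>R v x = 0" if "x \<notin> {- (R + 1)<..R + 1}" for x
  proof -
    have "R < \<bar>x\<bar>" using that R(1) by auto
    moreover from this have "deriv \<phi> x = 0"
      by (rule test_function_deriv_eq_0[OF \<phi>, rotated]) (rule R)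
    ultimately show ?thesis using R(2)[of x] by simp
  qed
  then have "(LINT x:{- (R + 1)<..R + 1}|lborel. deriv \<phi> x *\<^sub>R V x + \<phi> x *\<^sub>R v x)
      = (LINT x|lborel. deriv \<phi> x *\<^sub>R V x + \<phi> x *\<^sub>R v x)"
    by (rule set_integral_eq_integral_if_support)
  with zero have "(LINT x|lborel. deriv \<phi> x *\<^sub>R V x + \<phi> x *\<^sub>R v x) = 0"
    by simp
  moreover have "integrable lborel (\<lambda>x. deriv \<phi> x *\<^sub>R V x)"
    by (intro test_function_integrable test_function_deriv \<phi> locally_integrable_continuous primitive_continuous[OF V])
  moreover have "integrable lborel (\<lambda>x. \<phi> x *\<^sub>R v x)"
    by (intro test_function_integrable \<phi> primitive_locally_integrable[OF V])
  ultimately show ?thesis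
    by (simp add: eq_neg_iff_add_eq_0)
qed

text \<open>The primitive that is 0 at \<open>- R\<close> stays 0 to the left of the support; to the
  right it equals the total integral, which is 0 by assumption.\<close>

lemma test_function_zero_mean:
  assumes \<psi>: "test_function \<psi>" and mean: "(LINT x|lborel. \<psi> x) = 0"
  obtains \<phi> where "test_function \<phi>" "deriv \<phi> = \<psi>"
proof -
  obtain R where R: "0 < R" "\<And>x. R \<le> \<bar>x\<bar> \<Longrightarrow> \<psi> x = 0" using test_function_support[OF \<psi>] by auto
  have cont: "continuous_on UNIV \<psi>" using \<psi> by (intro smooth_continuous test_function_smooth)
  obtain P where P: "primitive P \<psi>" using primitive_exists[OF locally_integrable_continuous[OF cont]] by blast
  define \<phi> where "\<phi> x = P x - P (- R)" for x
  have D: "(\<phi> has_real_derivative \<psi> x) (at x)" for x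
    unfolding \<phi>_def using primitive_DERIV[OF P cont] by (auto intro!: derivative_eq_intros)
  have deriv: "deriv \<phi> = \<psi>" using D by (auto intro: DERIV_imp_deriv)
  have "smooth \<phi>"
    by (rule smooth_coinduct[of _ "insert \<phi> (Collect smooth)"])
      (use D smooth_DERIV smooth_deriv test_function_smooth[OF \<psi>] in blast)+
  moreover have "\<phi> x = 0" if "R < \<bar>x\<bar>" for x
  proof (cases "0 \<le> x")
    case True
    then have "\<phi> x = (LINT s:{-R<..x}|lborel. \<psi> s)"
      using primitive_diff_eq[OF P, of "-R" x] R that by (simp add: \<phi>_def)
    also have "\<dots> = (LINT s|lborel. \<psi> s)"
      by (rule set_integral_eq_integral_if_support) (rule R, use that True in auto)
    finally show ?thesis using mean by simp
  next
    case False
    then have "- \<phi> x = (LINT s:{x<..-R}|lborel. \<psi> s)"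
      using primitive_diff_eq[OF P, of x "-R"] R that by (simp add: \<phi>_def)
    also have "\<dots> = (LINT s:{x<..-R}|lborel. 0)"
      by (rule set_lebesgue_integral_cong) (use R in auto)
    finally show ?thesis by simp
  qed
  ultimately have "test_function \<phi>" unfolding test_function_iff by blast
  then show thesis using that deriv by blast
qed

text \<open>The lemma of du Bois-Reymond. Subtracting from a test function \<psi> the multiple of a
  fixed \<theta> with the same integral leaves a derivative of a test function, against which
  \<open>w\<close> integrates to 0.\<close>

lemma AE_const_if_test_integrals_zero:
  fixes w :: "real \<Rightarrow> 'a::{banach, second_countable_topology}"
  assumes w: "locally_integrable w"
    and zero: "\<And>\<phi>. test_function \<phi> \<Longrightarrow> (LINT x|lborel. deriv \<phi> x *\<^sub>R w x) = 0"
  obtains c where "AE x in lborel. w x = c"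
proof -
  have const: "locally_integrable (\<lambda>x. c)" for c :: "'b::{banach, second_countable_topology}"
    by (intro locally_integrable_continuous continuous_intros)
  \<comment> \<open>The limit of the integrals yields a bump of positive mass, by which one can
    divide.\<close>
  have "(\<lambda>n. LINT x|lborel. bump n 0 1 x) \<longlonglongrightarrow> 1"
    using bump_integral_tendsto[OF const[of "1::real"], of 0 1]
    by (simp add: set_lebesgue_integral_def)
  then have "\<forall>\<^sub>F n in sequentially. 0 < (LINT x|lborel. bump n 0 1 x)"
    by (rule order_tendstoD) simp
  then obtain n where n: "0 < (LINT x|lborel. bump n 0 1 x)"
    using eventually_happens by fastforce
  define \<theta> where "\<theta> = bump n 0 1"
  define m where "m = (LINT x|lborel. \<theta> x)"
  have \<theta>: "test_function \<theta>" unfolding \<theta>_def by (rule test_function_bump)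
  have m: "0 < m" using n by (simp add: m_def \<theta>_def)
  have int1: "integrable lborel \<psi>" if "test_function \<psi>" for \<psi>
    using test_function_integrable[OF that const[of "1::real"]] by simp
  \<comment> \<open>If \<open>w\<close> is constant almost everywhere, this \<theta>-weighted mean
    is its value.\<close>
  define c where "c = (1 / m) *\<^sub>R (LINT x|lborel. \<theta> x *\<^sub>R w x)"
  have "AE x in lborel. w x - c = 0"
  proof (rule AE_zero_if_test_integrals_zero)
    show "locally_integrable (\<lambda>x. w x - c)" by (intro locally_integrable_diff w const)
    fix \<psi> assume \<psi>: "test_function \<psi>"
    define s where "s = (LINT x|lborel. \<psi> x)"
    have test: "test_function (\<lambda>x. \<psi> x + - (s / m) * \<theta> x)"
      by (intro test_function_linear \<psi> \<theta>)
    have "(LINT x|lborel. \<psi> x + - (s / m) * \<theta> x) = s + - (s / m) * m"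
      using int1[OF \<psi>] int1[OF \<theta>]
      by (subst Bochner_Integration.integral_add) (auto simp: s_def m_def)
    then have "(LINT x|lborel. \<psi> x + - (s / m) * \<theta> x) = 0" using m by simp
    from test_function_zero_mean[OF test this] obtain \<phi>
      where \<phi>: "test_function \<phi>" "deriv \<phi> = (\<lambda>x. \<psi> x + - (s / m) * \<theta> x)" by blast
    have "0 = (LINT x|lborel. \<psi> x *\<^sub>R w x + (- (s / m)) *\<^sub>R (\<theta> x *\<^sub>R w x))"
      using zero[OF \<phi>(1)] unfolding \<phi>(2) by (simp only: scaleR_add_left scaleR_scaleR)
    also have "\<dots> = (LINT x|lborel. \<psi> x *\<^sub>R w x) + (- (s / m)) *\<^sub>R (LINT x|lborel. \<theta> x *\<^sub>R w x)"
      using Bochner_Integration.integral_add[OF test_function_integrable[OF \<psi> w]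
          integrable_scaleR_right[OF test_function_integrable[OF \<theta> w]], of "- (s / m)"]
      unfolding Bochner_Integration.integral_scaleR_right .
    also have "\<dots> = (LINT x|lborel. \<psi> x *\<^sub>R w x) - s *\<^sub>R c"
      by (simp add: c_def)
    also have "s *\<^sub>R c = (LINT x|lborel. \<psi> x *\<^sub>R c)"
      unfolding s_def by (rule integral_scaleR_left[symmetric]) (use int1[OF \<psi>] in blast)
    finally show "(LINT x|lborel. \<psi> x *\<^sub>R (w x - c)) = 0"
      using Bochner_Integration.integral_diff[OF test_function_integrable[OF \<psi> w]
          test_function_integrable[OF \<psi> const, of c]]
      by (simp add: scaleR_diff_right)
  qed
  then have "AE x in lborel. w x = c" by simp
  then show thesis by (rule that)
qed

section \<open>Calculus of weak derivatives\<close>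

lemma has_weak_derivative_locally_integrable:
  assumes "has_weak_derivative j u v"
  shows "locally_integrable u" "locally_integrable v"
  using assms by (auto simp: has_weak_derivative_def)

lemma has_weak_derivativeD:
  assumes "has_weak_derivative j u v" "test_function \<phi>"
  shows "(LINT x|lborel. (deriv ^^ j) \<phi> x *\<^sub>R u x) = (-1) ^ j *\<^sub>R (LINT x|lborel. \<phi> x *\<^sub>R v x)"
  using assms by (simp add: has_weak_derivative_def)

lemma test_integral_cong_AE:
  fixes u v :: "real \<Rightarrow> 'a::{banach, second_countable_topology}"
  assumes "test_function \<phi>" "locally_integrable u" "locally_integrable v" "AE x in lborel. u x = v x"
  shows "(LINT x|lborel. \<phi> x *\<^sub>R u x) = (LINT x|lborel. \<phi> x *\<^sub>R v x)"
  using assms test_function_integrable[OF assms(1,2)] test_function_integrable[OF assms(1,3)]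
  by (intro integral_cong_AE borel_measurable_integrable) auto

lemma has_weak_derivative_cong_AE:
  fixes u v :: "real \<Rightarrow> 'a::{banach, second_countable_topology}"
  assumes uv: "has_weak_derivative j u v"
    and u': "u' \<in> borel_measurable borel" "AE x in lborel. u' x = u x"
    and v': "v' \<in> borel_measurable borel" "AE x in lborel. v' x = v x"
  shows "has_weak_derivative j u' v'"
proof -
  note lint = has_weak_derivative_locally_integrable[OF uv]
  have l': "locally_integrable u'" "locally_integrable v'"
    using locally_integrable_cong_AE[OF lint(1) u'] locally_integrable_cong_AE[OF lint(2) v'] by auto
  have "(LINT x|lborel. (deriv ^^ j) \<phi> x *\<^sub>R u' x) = (-1) ^ j *\<^sub>R (LINT x|lborel. \<phi> x *\<^sub>R v' x)"
    if "test_function \<phi>" for \<phi>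
    using test_integral_cong_AE[OF test_function_funpow_deriv[OF that] l'(1) lint(1) u'(2), of j]
      test_integral_cong_AE[OF that l'(2) lint(2) v'(2)] has_weak_derivativeD[OF uv that] by simp
  then show ?thesis using l' by (simp add: has_weak_derivative_def)
qed

text \<open>The functions \<open>u\<close> and \<open>u'\<close> are allowed to differ on a null set
  because weak derivatives of derivatives are taken of representatives that have been chosen
  independently.\<close>

lemma has_weak_derivative_unique:
  fixes u v :: "real \<Rightarrow> 'a::{banach, second_countable_topology}"
  assumes uv: "has_weak_derivative j u v" and uv': "has_weak_derivative j u' v'"
    and eq: "AE x in lborel. u x = u' x"
  shows "AE x in lborel. v x = v' x"
proof -
  note lint = has_weak_derivative_locally_integrable[OF uv] has_weak_derivative_locally_integrable[OF uv']
  have "AE x in lborel. v x - v' x = 0"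
  proof (rule AE_zero_if_test_integrals_zero)
    show "locally_integrable (\<lambda>x. v x - v' x)" using lint by (intro locally_integrable_diff)
    fix \<phi> assume \<phi>: "test_function \<phi>"
    have "(-1) ^ j *\<^sub>R (LINT x|lborel. \<phi> x *\<^sub>R v x) = (-1) ^ j *\<^sub>R (LINT x|lborel. \<phi> x *\<^sub>R v' x)"
      using test_integral_cong_AE[OF test_function_funpow_deriv[OF \<phi>] lint(1,3) eq, of j]
        has_weak_derivativeD[OF uv \<phi>] has_weak_derivativeD[OF uv' \<phi>] by simp
    then have "(LINT x|lborel. \<phi> x *\<^sub>R v x) = (LINT x|lborel. \<phi> x *\<^sub>R v' x)" by simp
    then show "(LINT x|lborel. \<phi> x *\<^sub>R (v x - v' x)) = 0"
      using test_function_integrable[OF \<phi> lint(2)] test_function_integrable[OF \<phi> lint(4)]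
      by (simp add: scaleR_diff_right)
  qed
  then show ?thesis by simp
qed

lemma has_weak_derivative_wderiv:
  "weakly_differentiable j u \<Longrightarrow> has_weak_derivative j u (wderiv j u)"
  unfolding weakly_differentiable_def wderiv_def by (erule someI_ex)

lemma has_weak_derivative_imp_wderiv:
  "has_weak_derivative j u v \<Longrightarrow> has_weak_derivative j u (wderiv j u)"
  by (rule has_weak_derivative_wderiv) (auto simp: weakly_differentiable_def)

lemma wderiv_unique:
  "has_weak_derivative j u v \<Longrightarrow> AE x in lborel. wderiv j u x = v x"
  by (rule has_weak_derivative_unique[OF has_weak_derivative_imp_wderiv]) auto

lemma has_weak_derivative_0: "locally_integrable u \<Longrightarrow> has_weak_derivative 0 u u"
  by (simp add: has_weak_derivative_def)

lemma has_weak_derivative_comp: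
  assumes uv: "has_weak_derivative i u v" and vw: "has_weak_derivative j v w"
  shows "has_weak_derivative (i + j) u w"
proof -
  have "(LINT x|lborel. (deriv ^^ (i + j)) \<phi> x *\<^sub>R u x) = (-1) ^ (i + j) *\<^sub>R (LINT x|lborel. \<phi> x *\<^sub>R w x)"
    if "test_function \<phi>" for \<phi>
    using has_weak_derivativeD[OF uv test_function_funpow_deriv[OF that, of j]] has_weak_derivativeD[OF vw that]
    by (simp add: funpow_add power_add)
  then show ?thesis
    using has_weak_derivative_locally_integrable[OF uv] has_weak_derivative_locally_integrable[OF vw]
    by (simp add: has_weak_derivative_def)
qed

text \<open>Testing with the derivative of order \<open>j\<close> of a test function relates
  \<open>v\<close> to \<open>u\<close>, and the sign \<open>(-1) ^ i\<close> cancels. This connects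
  successive \<open>wderiv j u\<close> and \<open>wderiv (Suc j) u\<close>, each of which is chosen
  with reference to \<open>u\<close> only.\<close>

lemma has_weak_derivative_uncomp:
  assumes uv: "has_weak_derivative i u v" and uw: "has_weak_derivative (i + j) u w"
  shows "has_weak_derivative j v w"
proof -
  have "(LINT x|lborel. (deriv ^^ j) \<phi> x *\<^sub>R v x) = (-1) ^ j *\<^sub>R (LINT x|lborel. \<phi> x *\<^sub>R w x)"
    if "test_function \<phi>" for \<phi>
  proof -
    have "(-1) ^ i *\<^sub>R (LINT x|lborel. (deriv ^^ j) \<phi> x *\<^sub>R v x)
       = (-1) ^ i *\<^sub>R ((-1) ^ j *\<^sub>R (LINT x|lborel. \<phi> x *\<^sub>R w x))"
      using has_weak_derivativeD[OF uv test_function_funpow_deriv[OF that, of j]] has_weak_derivativeD[OF uw that]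
      by (simp add: funpow_add power_add)
    then show ?thesis by (subst (asm) scaleR_cancel_left) simp
  qed
  then show ?thesis
    using has_weak_derivative_locally_integrable[OF uv] has_weak_derivative_locally_integrable[OF uw]
    by (simp add: has_weak_derivative_def)
qed

lemma has_weak_derivative_diff:
  assumes f: "has_weak_derivative j f f'" and g: "has_weak_derivative j g g'"
  shows "has_weak_derivative j (\<lambda>x. f x - g x) (\<lambda>x. f' x - g' x)"
proof -
  note lint = has_weak_derivative_locally_integrable[OF f] has_weak_derivative_locally_integrable[OF g]
  have "(LINT x|lborel. (deriv ^^ j) \<phi> x *\<^sub>R (f x - g x)) = (-1) ^ j *\<^sub>R (LINT x|lborel. \<phi> x *\<^sub>R (f' x - g' x))"
    if "test_function \<phi>" for \<phi>
    using has_weak_derivativeD[OF f that] has_weak_derivativeD[OF g that]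
      test_function_integrable[OF test_function_funpow_deriv[OF that, of j] lint(1)]
      test_function_integrable[OF test_function_funpow_deriv[OF that, of j] lint(3)]
      test_function_integrable[OF that lint(2)] test_function_integrable[OF that lint(4)]
    by (simp add: scaleR_diff_right)
  then show ?thesis
    using lint by (simp add: has_weak_derivative_def locally_integrable_diff)
qed

lemma has_weak_derivative_primitive:
  assumes V: "primitive V v"
  shows "has_weak_derivative 1 V v"
  using primitive_integration_by_parts[OF _ V] primitive_locally_integrable[OF V]
    locally_integrable_continuous[OF primitive_continuous[OF V]]
  by (simp add: has_weak_derivative_def)

text \<open>The difference of \<open>u\<close> and any primitive of \<open>v\<close> has weak
  derivative 0, hence is constant almost everywhere; the constant is absorbed into
  \<open>V\<close>.\<close>

lemma has_weak_derivative_obtain_primitive: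
  fixes u v :: "real \<Rightarrow> 'a::{banach, second_countable_topology}"
  assumes uv: "has_weak_derivative 1 u v"
  obtains V where "primitive V v" "AE x in lborel. u x = V x"
proof -
  note lint = has_weak_derivative_locally_integrable[OF uv]
  obtain V where V: "primitive V v" using primitive_exists[OF lint(2)] by blast
  have diff: "has_weak_derivative 1 (\<lambda>x. u x - V x) (\<lambda>x. v x - v x)"
    by (intro has_weak_derivative_diff uv has_weak_derivative_primitive V)
  have "(LINT x|lborel. deriv \<phi> x *\<^sub>R (u x - V x)) = 0" if "test_function \<phi>" for \<phi>
    using has_weak_derivativeD[OF diff that] by simp
  from AE_const_if_test_integrals_zero[OF has_weak_derivative_locally_integrable(1)[OF diff] this]
  obtain c where c: "AE x in lborel. u x - V x = c" by blast
  show thesis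
  proof (rule that)
    show "primitive (\<lambda>x. V x + c) v" using V by (simp add: primitive_def)
    show "AE x in lborel. u x = V x + c" using c by eventually_elim (simp add: algebra_simps)
  qed
qed

lemma has_weak_derivative_bilinear:
  fixes B :: "'a::{banach, second_countable_topology} \<Rightarrow>
      'b::{banach, second_countable_topology} \<Rightarrow> 'c::{banach, second_countable_topology}"
  assumes B: "bounded_bilinear B"
    and f: "has_weak_derivative 1 f f'" and g: "has_weak_derivative 1 g g'"
  shows "has_weak_derivative 1 (\<lambda>x. B (f x) (g x)) (\<lambda>x. B (f' x) (g x) + B (f x) (g' x))"
proof -
  note meas = has_weak_derivative_locally_integrable[OF f, THEN locally_integrable_measurable]
    has_weak_derivative_locally_integrable[OF g, THEN locally_integrable_measurable]
  obtain F where F: "primitive F f'" "AE x in lborel. f x = F x"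
    using has_weak_derivative_obtain_primitive[OF f] by blast
  obtain G where G: "primitive G g'" "AE x in lborel. g x = G x"
    using has_weak_derivative_obtain_primitive[OF g] by blast
  show ?thesis
  proof (rule has_weak_derivative_cong_AE[OF has_weak_derivative_primitive[OF primitive_bilinear[OF B F(1) G(1)]]])
    show "(\<lambda>x. B (f x) (g x)) \<in> borel_measurable borel"
      "(\<lambda>x. B (f' x) (g x) + B (f x) (g' x)) \<in> borel_measurable borel"
      using meas by (auto intro!: bounded_bilinear_measurable[OF B] borel_measurable_add)
    show "AE x in lborel. B (f x) (g x) = B (F x) (G x)"
      using F(2) G(2) by eventually_elim simp
    show "AE x in lborel. B (f' x) (g x) + B (f x) (g' x) = B (f' x) (G x) + B (F x) (g' x)"
      using F(2) G(2) by eventually_elim simp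
  qed
qed

section \<open>Convergence in Lebesgue spaces\<close>

text \<open>A real-valued companion of \<open>L2_norm\<close>, so that limits and estimates stay in
  the reals. If the square is not integrable the integral takes its default value 0, hence square
  integrability is always recorded separately.\<close>

definition l2 :: "(real \<Rightarrow> 'a::{banach, second_countable_topology}) \<Rightarrow> real" where
  "l2 f = sqrt (LINT x|lborel. (norm (f x))\<^sup>2)"

lemma l2_nonneg: "0 \<le> l2 f"
  by (simp add: l2_def)

lemma l2_power2: "(l2 f)\<^sup>2 = (LINT x|lborel. (norm (f x))\<^sup>2)"
  by (simp add: l2_def)

lemma square_integrableD:
  assumes "square_integrable f"
  shows "f \<in> borel_measurable borel" "integrable lborel (\<lambda>x. (norm (f x))\<^sup>2)"
  using assms by (auto simp: square_integrable_def)

lemma square_integrableI_bound: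
  fixes f :: "real \<Rightarrow> 'a::{banach, second_countable_topology}"
  assumes f: "f \<in> borel_measurable borel" and h: "integrable lborel h"
    and le: "AE x in lborel. (norm (f x))\<^sup>2 \<le> h x"
  shows "square_integrable f" "(l2 f)\<^sup>2 \<le> (LINT x|lborel. h x)"
proof -
  have int: "integrable lborel (\<lambda>x. (norm (f x))\<^sup>2)"
    by (rule Bochner_Integration.integrable_bound[OF h]) (use f le in auto)
  then show "square_integrable f" using f by (simp add: square_integrable_def)
  show "(l2 f)\<^sup>2 \<le> (LINT x|lborel. h x)"
    unfolding l2_power2 by (rule integral_mono_AE[OF int h le])
qed

lemma square_integrable_cong_AE:
  fixes f g :: "real \<Rightarrow> 'a::{banach, second_countable_topology}"
  assumes "square_integrable g" "f \<in> borel_measurable borel" "AE x in lborel. f x = g x"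
  shows "square_integrable f" "l2 f = l2 g"
proof -
  show "square_integrable f"
    by (rule square_integrableI_bound(1)[OF assms(2) square_integrableD(2)[OF assms(1)]])
      (use assms(3) in auto)
  have "(LINT x|lborel. (norm (f x))\<^sup>2) = (LINT x|lborel. (norm (g x))\<^sup>2)"
    by (rule integral_cong_AE) (use assms square_integrableD(1)[OF assms(1)] in auto)
  then show "l2 f = l2 g" by (simp add: l2_def)
qed

lemma norm_diff_power2_le:
  fixes a b :: "'a::real_normed_vector"
  shows "(norm (a - b))\<^sup>2 \<le> 2 * (norm a)\<^sup>2 + 2 * (norm b)\<^sup>2"
proof -
  have "(norm (a - b))\<^sup>2 \<le> (norm a + norm b)\<^sup>2"
    by (intro power_mono norm_triangle_ineq4) auto
  also have "\<dots> \<le> 2 * (norm a)\<^sup>2 + 2 * (norm b)\<^sup>2"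
    using sum_squares_ge_zero[of "norm a - norm b" 0] by (simp add: power2_eq_square algebra_simps)
  finally show ?thesis .
qed

lemma norm_add_power2_le:
  fixes a b :: "'a::real_normed_vector"
  shows "(norm (a + b))\<^sup>2 \<le> 2 * (norm a)\<^sup>2 + 2 * (norm b)\<^sup>2"
  using norm_diff_power2_le[of a "- b"] by simp

lemma square_integrable_diff:
  fixes f g :: "real \<Rightarrow> 'a::{banach, second_countable_topology}"
  assumes "square_integrable f" "square_integrable g"
  shows "square_integrable (\<lambda>x. f x - g x)"
  by (rule square_integrableI_bound(1)[of _ "\<lambda>x. 2 * (norm (f x))\<^sup>2 + 2 * (norm (g x))\<^sup>2"])
    (use assms norm_diff_power2_le in \<open>auto simp: square_integrable_def\<close>)

lemma square_integrable_add:
  fixes f g :: "real \<Rightarrow> 'a::{banach, second_countable_topology}"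
  assumes "square_integrable f" "square_integrable g"
  shows "square_integrable (\<lambda>x. f x + g x)"
  by (rule square_integrableI_bound(1)[of _ "\<lambda>x. 2 * (norm (f x))\<^sup>2 + 2 * (norm (g x))\<^sup>2"])
    (use assms norm_add_power2_le in \<open>auto simp: square_integrable_def\<close>)

lemma Cauchy_Schwarz_l2:
  fixes f :: "real \<Rightarrow> 'a::{banach, second_countable_topology}"
    and g :: "real \<Rightarrow> 'b::{banach, second_countable_topology}"
  assumes f: "square_integrable f" and g: "square_integrable g"
  shows "integrable lborel (\<lambda>x. norm (f x) * norm (g x))"
    and "(LINT x|lborel. norm (f x) * norm (g x)) \<le> l2 f * l2 g"
proof -
  note [measurable] = square_integrableD(1)[OF f] square_integrableD(1)[OF g]
  show int: "integrable lborel (\<lambda>x. norm (f x) * norm (g x))"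
  proof (rule Bochner_Integration.integrable_bound)
    show "integrable lborel (\<lambda>x. (norm (f x))\<^sup>2 + (norm (g x))\<^sup>2)"
      using f g by (auto dest: square_integrableD)
    have "norm (f x) * norm (g x) \<le> (norm (f x))\<^sup>2 + (norm (g x))\<^sup>2" for x
      using sum_squares_bound[of "norm (f x)" "norm (g x)"] mult_nonneg_nonneg[OF norm_ge_zero[of "f x"] norm_ge_zero[of "g x"]] by linarith
    then show "AE x in lborel. norm (norm (f x) * norm (g x)) \<le> norm ((norm (f x))\<^sup>2 + (norm (g x))\<^sup>2)"
      by simp
  qed measurable
  have "ennreal ((LINT x|lborel. norm (f x) * norm (g x))\<^sup>2) = (\<integral>\<^sup>+x. ennreal (norm (f x)) * ennreal (norm (g x)) \<partial>lborel)\<^sup>2"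
    using nn_integral_eq_integral[OF int] by (simp add: ennreal_mult ennreal_power integral_nonneg_AE)
  also have "\<dots> \<le> (\<integral>\<^sup>+x. (ennreal (norm (f x)))\<^sup>2 \<partial>lborel) * (\<integral>\<^sup>+x. (ennreal (norm (g x)))\<^sup>2 \<partial>lborel)"
    by (rule Cauchy_Schwarz_nn_integral) measurable
  also have "\<dots> = ennreal ((l2 f)\<^sup>2) * ennreal ((l2 g)\<^sup>2)"
    using nn_integral_eq_integral[OF square_integrableD(2)[OF f]] nn_integral_eq_integral[OF square_integrableD(2)[OF g]]
    by (simp add: ennreal_power l2_power2)
  also have "\<dots> = ennreal ((l2 f * l2 g)\<^sup>2)"
    by (simp add: ennreal_mult power_mult_distrib)
  finally have "(LINT x|lborel. norm (f x) * norm (g x))\<^sup>2 \<le> (l2 f * l2 g)\<^sup>2"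
    by (simp add: ennreal_le_iff)
  then show "(LINT x|lborel. norm (f x) * norm (g x)) \<le> l2 f * l2 g"
    by (rule power2_le_imp_le) (simp add: l2_nonneg)
qed

section \<open>A Sobolev inequality on intervals of length 1\<close>

lemma set_integral_norm_le_l2:
  fixes f :: "real \<Rightarrow> 'a::{banach, second_countable_topology}"
  assumes f: "square_integrable f"
  shows "(LINT s:{x<..x+1}|lborel. norm (f s)) \<le> l2 f"
proof -
  have eq: "(\<lambda>s. (norm (indicat_real {x<..x+1} s))\<^sup>2) = indicat_real {x<..x+1}"
    by (auto simp: indicator_def)
  have I: "square_integrable (indicat_real {x<..x+1})"
    unfolding square_integrable_def eq by simp
  have "l2 (indicat_real {x<..x+1}) = 1"
    unfolding l2_def eq by simp
  then show ?thesis
    using Cauchy_Schwarz_l2(2)[OF I f] by (simp add: set_lebesgue_integral_def)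
qed

lemma square_integrable_locally_integrable:
  fixes f :: "real \<Rightarrow> 'a::{banach, second_countable_topology}"
  assumes f: "square_integrable f"
  shows "locally_integrable f"
proof (rule locally_integrable_bound)
  show "locally_integrable (\<lambda>x. 1 + (norm (f x))\<^sup>2)"
    by (intro locally_integrable_add locally_integrable_integrable square_integrableD(2)[OF f]
        locally_integrable_continuous continuous_intros)
  have "norm (f x) \<le> 1 + (norm (f x))\<^sup>2" for x
    using sum_squares_bound[of 1 "norm (f x)"] norm_ge_zero[of "f x"] by (simp only: power_one)
  then show "AE x in lborel. norm (f x) \<le> norm (1 + (norm (f x))\<^sup>2)" by simp
qed (rule square_integrableD(1)[OF f])

text \<open>The value at \<open>x\<close> exceeds each value on the next unit interval by at most
  the integral of \<open>norm (g s)\<close>, and is then averaged over that interval; length 1 makes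
  the Cauchy-Schwarz constants 1. With \<open>c = 0\<close> and \<open>a = f\<close> this is the
  embedding of H1 into L\<infinity>; with \<open>c = 1\<close> and \<open>a = eta u\<close> it
  covers functions of finite energy, which are not in L2.\<close>

lemma weak_derivative_L2_bound:
  fixes f g :: "real \<Rightarrow> 'a::{banach, second_countable_topology}"
    and a :: "real \<Rightarrow> 'b::{banach, second_countable_topology}"
  assumes fg: "has_weak_derivative 1 f g" and g: "square_integrable g"
    and a: "square_integrable a" and le: "AE x in lborel. norm (f x) \<le> c + norm (a x)"
  shows "AE x in lborel. norm (f x) \<le> c + l2 a + l2 g"
proof -
  obtain V where V: "primitive V g" "AE x in lborel. f x = V x"
    using has_weak_derivative_obtain_primitive[OF fg] by blast
  have const: "locally_integrable (\<lambda>x. c)" for c :: real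
    by (intro locally_integrable_continuous continuous_intros)
  have lg: "locally_integrable (\<lambda>x. norm (g x))"
    by (intro locally_integrable_norm square_integrable_locally_integrable g)
  have la: "locally_integrable (\<lambda>x. c + norm (a x))"
    by (intro locally_integrable_add const locally_integrable_norm square_integrable_locally_integrable a)
  have "norm (V x) \<le> c + l2 a + l2 g" for x
  proof -
    define G where "G = (LINT s:{x<..x+1}|lborel. norm (g s))"
    have VG: "norm (V x) - G \<le> norm (V y)" if "x < y" "y \<le> x + 1" for y
    proof -
      have "norm (V y - V x) \<le> (LINT s:{x<..y}|lborel. norm (g s))"
        using that by (intro primitive_norm_diff_le[OF V(1)]) auto
      also have "\<dots> \<le> G"
        using set_integral_Ioc_add[OF lg, of x y "x + 1"] set_integral_Ioc_nonneg[of "\<lambda>s. norm (g s)" y "x+1"] that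
        by (simp add: G_def)
      finally show ?thesis using norm_triangle_sub[of "V x" "V y"] by (simp add: norm_minus_commute)
    qed
    have int: "set_integrable lborel {x<..x+1} (\<lambda>y. norm (V x) - G)"
      "set_integrable lborel {x<..x+1} (\<lambda>y. c + norm (a y))"
      "set_integrable lborel {x<..x+1} (\<lambda>y. norm (a y))"
      "set_integrable lborel {x<..x+1} (\<lambda>y. c)"
      using locally_integrable_Ioc[OF const] locally_integrable_Ioc[OF la]
        locally_integrable_Ioc[OF locally_integrable_norm[OF square_integrable_locally_integrable[OF a]]]
      by auto
    have "norm (V x) - G = (LINT y:{x<..x+1}|lborel. norm (V x) - G)"
      by (simp add: set_lebesgue_integral_def)
    also have "\<dots> \<le> (LINT y:{x<..x+1}|lborel. c + norm (a y))"
    proof (rule set_integral_mono_AE[OF int(1,2)])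
      show "AE y in lborel. y \<in> {x<..x+1} \<longrightarrow> norm (V x) - G \<le> c + norm (a y)"
        using V(2) le
      proof eventually_elim
        case (elim y)
        then show ?case using VG[of y] by auto
      qed
    qed
    also have "\<dots> = c + (LINT y:{x<..x+1}|lborel. norm (a y))"
      using set_integral_add(2)[OF int(4,3)] by (simp add: set_lebesgue_integral_def)
    finally show ?thesis
      using set_integral_norm_le_l2[OF a, of x] set_integral_norm_le_l2[OF g, of x] by (simp add: G_def)
  qed
  then show ?thesis using V(2) by (auto elim: eventually_mono)
qed

text \<open>An almost everywhere bound \<open>r i\<close> tending to 0 stands in for the essential
  supremum of the difference, which avoids extended reals. The boundedness of the limit is included
  because products are to converge as well.\<close>

definition conv_Linf ::
    "('i \<Rightarrow> real \<Rightarrow> 'a::{banach, second_countable_topology}) \<Rightarrow> (real \<Rightarrow> 'a) \<Rightarrow> 'i filter \<Rightarrow> bool" where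
  "conv_Linf f g F \<longleftrightarrow>
     g \<in> borel_measurable borel \<and> (\<exists>C. AE x in lborel. norm (g x) \<le> C) \<and>
     (\<exists>r. (r \<longlongrightarrow> 0) F \<and>
       (\<forall>\<^sub>F i in F. f i \<in> borel_measurable borel \<and> (AE x in lborel. norm (f i x - g x) \<le> r i)))"

definition conv_L2 ::
    "('i \<Rightarrow> real \<Rightarrow> 'a::{banach, second_countable_topology}) \<Rightarrow> (real \<Rightarrow> 'a) \<Rightarrow> 'i filter \<Rightarrow> bool" where
  "conv_L2 f g F \<longleftrightarrow>
     square_integrable g \<and> (\<forall>\<^sub>F i in F. square_integrable (f i)) \<and>
     ((\<lambda>i. l2 (\<lambda>x. f i x - g x)) \<longlongrightarrow> 0) F"

definition conv_L1 ::
    "('i \<Rightarrow> real \<Rightarrow> 'a::{banach, second_countable_topology}) \<Rightarrow> (real \<Rightarrow> 'a) \<Rightarrow> 'i filter \<Rightarrow> bool" where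
  "conv_L1 f g F \<longleftrightarrow>
     integrable lborel g \<and> (\<forall>\<^sub>F i in F. integrable lborel (f i)) \<and>
     ((\<lambda>i. LINT x|lborel. norm (f i x - g x)) \<longlongrightarrow> 0) F"

section \<open>Products and sums of convergent families\<close>

lemma conv_L1_integrable: "conv_L1 f g F \<Longrightarrow> integrable lborel g"
  by (simp add: conv_L1_def)

lemma conv_L1_integral_tendsto:
  assumes "conv_L1 f g F"
  shows "((\<lambda>i. LINT x|lborel. f i x) \<longlongrightarrow> (LINT x|lborel. g x)) F"
proof -
  have "((\<lambda>i. (LINT x|lborel. f i x) - (LINT x|lborel. g x)) \<longlongrightarrow> 0) F"
  proof (rule Lim_null_comparison)
    show "((\<lambda>i. LINT x|lborel. norm (f i x - g x)) \<longlongrightarrow> 0) F" using assms by (simp add: conv_L1_def)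
    have "\<forall>\<^sub>F i in F. integrable lborel (f i)" using assms by (simp add: conv_L1_def)
    then show "\<forall>\<^sub>F i in F. norm ((LINT x|lborel. f i x) - (LINT x|lborel. g x)) \<le> (LINT x|lborel. norm (f i x - g x))"
    proof eventually_elim
      case (elim i)
      then have "(LINT x|lborel. f i x) - (LINT x|lborel. g x) = (LINT x|lborel. f i x - g x)"
        using assms by (simp add: conv_L1_def)
      then show ?case by simp
    qed
  qed
  then show ?thesis by (rule LIM_zero_cancel)
qed

text \<open>Expanding around the limit gives \<open>B d d' + B d g' + B g d'\<close> with
  \<open>d\<close> and \<open>d'\<close> the differences, so that every summand is small and only
  the norms of the limits occur as constants.\<close>

lemma conv_L1_bilinear:
  fixes B :: "'a::{banach, second_countable_topology} \<Rightarrow>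
      'b::{banach, second_countable_topology} \<Rightarrow> 'c::{banach, second_countable_topology}"
  assumes B: "bounded_bilinear B" and f: "conv_L2 f g F" and f': "conv_L2 f' g' F"
  shows "conv_L1 (\<lambda>i x. B (f i x) (f' i x)) (\<lambda>x. B (g x) (g' x)) F"
proof -
  interpret B: bounded_bilinear B by (rule B)
  obtain K where K: "0 \<le> K" "\<And>a b. norm (B a b) \<le> norm a * norm b * K"
    using B.nonneg_bounded by blast
  have int: "integrable lborel (\<lambda>x. B (p x) (q x))" "(LINT x|lborel. norm (B (p x) (q x))) \<le> l2 p * l2 q * K"
    if p: "square_integrable p" and q: "square_integrable q" for p q
  proof -
    have h: "integrable lborel (\<lambda>x. norm (p x) * norm (q x) * K)"
      using Cauchy_Schwarz_l2(1)[OF p q] by simp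
    show *: "integrable lborel (\<lambda>x. B (p x) (q x))"
    proof (rule Bochner_Integration.integrable_bound[OF h])
      show "(\<lambda>x. B (p x) (q x)) \<in> borel_measurable lborel"
        using p q by (auto intro!: bounded_bilinear_measurable[OF B] dest: square_integrableD)
      show "AE x in lborel. norm (B (p x) (q x)) \<le> norm (norm (p x) * norm (q x) * K)"
        using K by (simp add: abs_mult)
    qed
    have "(LINT x|lborel. norm (B (p x) (q x))) \<le> (LINT x|lborel. norm (p x) * norm (q x) * K)"
      by (rule integral_mono) (use * h K(2) in auto)
    also have "\<dots> \<le> l2 p * l2 q * K"
      using Cauchy_Schwarz_l2(2)[OF p q] K(1) by (simp add: mult_right_mono)
    finally show "(LINT x|lborel. norm (B (p x) (q x))) \<le> l2 p * l2 q * K" .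
  qed
  have g: "square_integrable g" and g': "square_integrable g'"
    using f f' by (auto simp: conv_L2_def)
  let ?d = "\<lambda>i. l2 (\<lambda>x. f i x - g x)" and ?d' = "\<lambda>i. l2 (\<lambda>x. f' i x - g' x)"
  have ev: "\<forall>\<^sub>F i in F. square_integrable (f i) \<and> square_integrable (f' i)"
    using f f' by (simp add: conv_L2_def eventually_conj)
  have "((\<lambda>i. LINT x|lborel. norm (B (f i x) (f' i x) - B (g x) (g' x))) \<longlongrightarrow> 0) F"
  proof (rule Lim_null_comparison)
    have "((\<lambda>i. ?d i * ?d' i * K + ?d i * l2 g' * K + l2 g * ?d' i * K) \<longlongrightarrow>
        0 * 0 * K + 0 * l2 g' * K + l2 g * 0 * K) F"
      using f f' unfolding conv_L2_def by (intro tendsto_intros) auto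
    then show "((\<lambda>i. ?d i * ?d' i * K + ?d i * l2 g' * K + l2 g * ?d' i * K) \<longlongrightarrow> 0) F" by simp
    show "\<forall>\<^sub>F i in F. norm (LINT x|lborel. norm (B (f i x) (f' i x) - B (g x) (g' x)))
        \<le> ?d i * ?d' i * K + ?d i * l2 g' * K + l2 g * ?d' i * K"
      using ev
    proof eventually_elim
      case (elim i)
      have sd: "square_integrable (\<lambda>x. f i x - g x)" and sd': "square_integrable (\<lambda>x. f' i x - g' x)"
        using elim g g' by (auto intro: square_integrable_diff)
      have "B (f i x) (f' i x) - B (g x) (g' x) =
        B (f i x - g x) (f' i x - g' x) + B (f i x - g x) (g' x) + B (g x) (f' i x - g' x)" for x
        by (simp add: B.diff_left B.diff_right)
      then have le: "norm (B (f i x) (f' i x) - B (g x) (g' x)) \<le>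
        norm (B (f i x - g x) (f' i x - g' x)) + norm (B (f i x - g x) (g' x)) + norm (B (g x) (f' i x - g' x))" for x
        by (simp add: norm_triangle_le norm_triangle_ineq add_mono)
      note i1 = int(1)[OF sd sd'] int(1)[OF sd g'] int(1)[OF g sd'] int(1)[OF g g'] 
      have "(LINT x|lborel. norm (B (f i x) (f' i x) - B (g x) (g' x))) \<le>
        (LINT x|lborel. norm (B (f i x - g x) (f' i x - g' x)) + norm (B (f i x - g x) (g' x)) + norm (B (g x) (f' i x - g' x)))"
        using i1 int(1)[of "f i" "f' i"] elim le by (intro integral_mono) auto
      also have "\<dots> = (LINT x|lborel. norm (B (f i x - g x) (f' i x - g' x)))
          + (LINT x|lborel. norm (B (f i x - g x) (g' x))) + (LINT x|lborel. norm (B (g x) (f' i x - g' x)))"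
        using i1 by simp
      also have "\<dots> \<le> ?d i * ?d' i * K + ?d i * l2 g' * K + l2 g * ?d' i * K"
        using int(2)[OF sd sd'] int(2)[OF sd g'] int(2)[OF g sd'] by linarith
      finally show ?case by simp
    qed
  qed
  moreover have "\<forall>\<^sub>F i in F. integrable lborel (\<lambda>x. B (f i x) (f' i x))"
    using ev by eventually_elim (auto intro: int(1))
  ultimately show ?thesis using int(1)[OF g g'] by (simp add: conv_L1_def)
qed

text \<open>The difference is split as \<open>B f (f' - g') + B (f - g) g'\<close>, where
  \<open>f\<close> is bounded by \<open>C + r i\<close>. The squares of the norms are estimated, at
  the price of a factor 2, and the root is taken at the end.\<close>

lemma conv_L2_bilinear:
  fixes B :: "'a::{banach, second_countable_topology} \<Rightarrow>
      'b::{banach, second_countable_topology} \<Rightarrow> 'c::{banach, second_countable_topology}"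
  assumes B: "bounded_bilinear B" and f: "conv_Linf f g F" and f': "conv_L2 f' g' F"
  shows "conv_L2 (\<lambda>i x. B (f i x) (f' i x)) (\<lambda>x. B (g x) (g' x)) F"
proof -
  interpret B: bounded_bilinear B by (rule B)
  obtain K where K: "0 \<le> K" "\<And>a b. norm (B a b) \<le> norm a * norm b * K"
    using B.nonneg_bounded by blast
  \<comment> \<open>With both sides squared, the bound holds without a discussion of the sign of
    \<open>C\<close>.\<close>
  have prod: "square_integrable (\<lambda>x. B (p x) (q x))" "(l2 (\<lambda>x. B (p x) (q x)))\<^sup>2 \<le> (C * l2 q * K)\<^sup>2"
    if p: "p \<in> borel_measurable borel" "AE x in lborel. norm (p x) \<le> C" and q: "square_integrable q" for p q C
  proof -
    let ?h = "\<lambda>x. (C * K)\<^sup>2 * (norm (q x))\<^sup>2"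
    have meas: "(\<lambda>x. B (p x) (q x)) \<in> borel_measurable borel"
      using p q by (auto intro!: bounded_bilinear_measurable[OF B] dest: square_integrableD)
    have h: "integrable lborel ?h" using square_integrableD(2)[OF q] by simp
    have "AE x in lborel. (norm (B (p x) (q x)))\<^sup>2 \<le> ?h x"
      using p(2)
    proof eventually_elim
      case (elim x)
      have "norm (B (p x) (q x)) \<le> norm (p x) * norm (q x) * K" by (rule K)
      also have "\<dots> \<le> C * norm (q x) * K" using elim K(1) by (intro mult_right_mono) auto
      finally have "(norm (B (p x) (q x)))\<^sup>2 \<le> (C * norm (q x) * K)\<^sup>2" by (rule power_mono) simp
      then show ?case by (simp add: power_mult_distrib algebra_simps)
    qed
    from square_integrableI_bound[OF meas h this]
    show "square_integrable (\<lambda>x. B (p x) (q x))" "(l2 (\<lambda>x. B (p x) (q x)))\<^sup>2 \<le> (C * l2 q * K)\<^sup>2"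
      by (auto simp: l2_power2 power_mult_distrib algebra_simps)
  qed
  obtain C r where g: "g \<in> borel_measurable borel" "AE x in lborel. norm (g x) \<le> C"
    and r: "(r \<longlongrightarrow> 0) F"
    and ev: "\<forall>\<^sub>F i in F. f i \<in> borel_measurable borel \<and> (AE x in lborel. norm (f i x - g x) \<le> r i)"
    using f unfolding conv_Linf_def by blast
  have g': "square_integrable g'" using f' by (simp add: conv_L2_def)
  let ?d' = "\<lambda>i. l2 (\<lambda>x. f' i x - g' x)"
  have d': "(?d' \<longlongrightarrow> 0) F" and ev': "\<forall>\<^sub>F i in F. square_integrable (f' i)"
    using f' by (simp_all add: conv_L2_def)
  have bd: "AE x in lborel. norm (f i x) \<le> C + r i" if "AE x in lborel. norm (f i x - g x) \<le> r i" for i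
    using that g(2)
  proof eventually_elim
    case (elim x)
    then show ?case using norm_triangle_sub[of "f i x" "g x"] by simp
  qed
  let ?b = "\<lambda>i. 2 * ((C + r i) * ?d' i * K)\<^sup>2 + 2 * (r i * l2 g' * K)\<^sup>2"
  have "((\<lambda>i. (l2 (\<lambda>x. B (f i x) (f' i x) - B (g x) (g' x)))\<^sup>2) \<longlongrightarrow> 0) F"
  proof (rule Lim_null_comparison)
    have "(?b \<longlongrightarrow> 2 * ((C + 0) * 0 * K)\<^sup>2 + 2 * (0 * l2 g' * K)\<^sup>2) F"
      by (intro tendsto_intros r d')
    then show "(?b \<longlongrightarrow> 0) F" by simp
    show "\<forall>\<^sub>F i in F. norm ((l2 (\<lambda>x. B (f i x) (f' i x) - B (g x) (g' x)))\<^sup>2) \<le> ?b i"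
      using ev ev'
    proof eventually_elim
      case (elim i)
      have sd': "square_integrable (\<lambda>x. f' i x - g' x)" using elim g' by (auto intro: square_integrable_diff)
      have m: "(\<lambda>x. f i x - g x) \<in> borel_measurable borel" using elim g by auto
      note p1 = prod[OF _ bd sd', of i] and p2 = prod[OF m _ g', of "r i"]
      let ?u = "\<lambda>x. B (f i x) (f' i x - g' x)" and ?v = "\<lambda>x. B (f i x - g x) (g' x)"
      have u: "square_integrable ?u" "(l2 ?u)\<^sup>2 \<le> ((C + r i) * ?d' i * K)\<^sup>2" using p1 elim by auto
      have v: "square_integrable ?v" "(l2 ?v)\<^sup>2 \<le> (r i * l2 g' * K)\<^sup>2" using p2 elim by auto
      have "B (f i x) (f' i x) - B (g x) (g' x) = ?u x + ?v x" for x
        by (simp add: B.diff_left B.diff_right)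
      then have "(l2 (\<lambda>x. B (f i x) (f' i x) - B (g x) (g' x)))\<^sup>2 = (l2 (\<lambda>x. ?u x + ?v x))\<^sup>2" by simp
      also have "\<dots> \<le> (LINT x|lborel. 2 * (norm (?u x))\<^sup>2 + 2 * (norm (?v x))\<^sup>2)"
        using square_integrableD[OF u(1)] square_integrableD[OF v(1)] norm_add_power2_le[of "?u _" "?v _"]
        by (intro square_integrableI_bound(2)) (auto simp: borel_measurable_add)
      also have "\<dots> = 2 * (l2 ?u)\<^sup>2 + 2 * (l2 ?v)\<^sup>2"
        using square_integrableD[OF u(1)] square_integrableD[OF v(1)] by (simp add: l2_power2)
      also have "\<dots> \<le> ?b i" using u(2) v(2) by linarith
      finally show ?case by simp
    qed
  qed
  then have "((\<lambda>i. sqrt ((l2 (\<lambda>x. B (f i x) (f' i x) - B (g x) (g' x)))\<^sup>2)) \<longlongrightarrow> sqrt 0) F"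
    by (rule tendsto_real_sqrt)
  then have "((\<lambda>i. l2 (\<lambda>x. B (f i x) (f' i x) - B (g x) (g' x))) \<longlongrightarrow> 0) F"
    by (simp add: l2_nonneg)
  moreover have "\<forall>\<^sub>F i in F. square_integrable (\<lambda>x. B (f i x) (f' i x))"
    using ev ev' by eventually_elim (use bd prod(1) in blast)
  moreover have "square_integrable (\<lambda>x. B (g x) (g' x))" by (rule prod(1)[OF g g'])
  ultimately show ?thesis by (simp add: conv_L2_def)
qed

lemma conv_Linf_bilinear:
  fixes B :: "'a::{banach, second_countable_topology} \<Rightarrow>
      'b::{banach, second_countable_topology} \<Rightarrow> 'c::{banach, second_countable_topology}"
  assumes B: "bounded_bilinear B" and f: "conv_Linf f g F" and f': "conv_Linf f' g' F"
  shows "conv_Linf (\<lambda>i x. B (f i x) (f' i x)) (\<lambda>x. B (g x) (g' x)) F"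
proof -
  interpret B: bounded_bilinear B by (rule B)
  obtain K where K: "0 \<le> K" "\<And>a b. norm (B a b) \<le> norm a * norm b * K"
    using B.nonneg_bounded by blast
  obtain C r where g: "g \<in> borel_measurable borel" "AE x in lborel. norm (g x) \<le> C"
    and r: "(r \<longlongrightarrow> 0) F"
    and ev: "\<forall>\<^sub>F i in F. f i \<in> borel_measurable borel \<and> (AE x in lborel. norm (f i x - g x) \<le> r i)"
    using f unfolding conv_Linf_def by blast
  obtain C' r' where g': "g' \<in> borel_measurable borel" "AE x in lborel. norm (g' x) \<le> C'"
    and r': "(r' \<longlongrightarrow> 0) F"
    and ev': "\<forall>\<^sub>F i in F. f' i \<in> borel_measurable borel \<and> (AE x in lborel. norm (f' i x - g' x) \<le> r' i)"
    using f' unfolding conv_Linf_def by blast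
  have bound: "norm (B a b) \<le> c * d * K" if "norm a \<le> c" "norm b \<le> d" for a b c d
  proof -
    have "norm (B a b) \<le> norm a * norm b * K" by (rule K)
    also have "\<dots> \<le> c * d * K"
      using that K(1) norm_ge_zero[of a] norm_ge_zero[of b]
      by (intro mult_right_mono mult_mono) linarith+
    finally show ?thesis .
  qed
  let ?r = "\<lambda>i. r i * r' i * K + r i * C' * K + C * r' i * K"
  have "(?r \<longlongrightarrow> 0 * 0 * K + 0 * C' * K + C * 0 * K) F"
    by (intro tendsto_intros r r')
  then have lim: "(?r \<longlongrightarrow> 0) F" by simp
  have "\<forall>\<^sub>F i in F. (\<lambda>x. B (f i x) (f' i x)) \<in> borel_measurable borel \<and>
     (AE x in lborel. norm (B (f i x) (f' i x) - B (g x) (g' x)) \<le> ?r i)"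
    using ev ev'
  proof eventually_elim
    case (elim i)
    have "AE x in lborel. norm (B (f i x) (f' i x) - B (g x) (g' x)) \<le> ?r i"
      using conjunct2[OF elim(1)] conjunct2[OF elim(2)] g(2) g'(2)
    proof eventually_elim
      case (elim x)
      have eq: "B (f i x) (f' i x) - B (g x) (g' x) =
        B (f i x - g x) (f' i x - g' x) + B (f i x - g x) (g' x) + B (g x) (f' i x - g' x)"
        by (simp add: B.diff_left B.diff_right)
      show ?case
        unfolding eq by (intro norm_triangle_le add_mono bound elim)
    qed
    then show ?case using elim by (auto intro!: bounded_bilinear_measurable[OF B])
  qed
  moreover have "AE x in lborel. norm (B (g x) (g' x)) \<le> C * C' * K"
    using g(2) g'(2) by eventually_elim (rule bound)
  ultimately show ?thesis
    using lim bounded_bilinear_measurable[OF B g(1) g'(1)] unfolding conv_Linf_def by blast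
qed

lemma conv_L2_bilinear':
  fixes B :: "'a::{banach, second_countable_topology} \<Rightarrow>
      'b::{banach, second_countable_topology} \<Rightarrow> 'c::{banach, second_countable_topology}"
  assumes B: "bounded_bilinear B" and f: "conv_L2 f g F" and f': "conv_Linf f' g' F"
  shows "conv_L2 (\<lambda>i x. B (f i x) (f' i x)) (\<lambda>x. B (g x) (g' x)) F"
  using conv_L2_bilinear[OF bounded_bilinear.flip[OF B] f' f] .

lemma conv_Linf_const: "conv_Linf (\<lambda>i x. c) (\<lambda>x. c) F"
  unfolding conv_Linf_def by (auto intro!: exI[of _ "\<lambda>_. 0"])

lemma conv_Linf_diff:
  assumes f: "conv_Linf f g F" and f': "conv_Linf f' g' F"
  shows "conv_Linf (\<lambda>i x. f i x - f' i x) (\<lambda>x. g x - g' x) F"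
proof -
  obtain C r where g: "g \<in> borel_measurable borel" "AE x in lborel. norm (g x) \<le> C"
    and r: "(r \<longlongrightarrow> 0) F"
    and ev: "\<forall>\<^sub>F i in F. f i \<in> borel_measurable borel \<and> (AE x in lborel. norm (f i x - g x) \<le> r i)"
    using f unfolding conv_Linf_def by blast
  obtain C' r' where g': "g' \<in> borel_measurable borel" "AE x in lborel. norm (g' x) \<le> C'"
    and r': "(r' \<longlongrightarrow> 0) F"
    and ev': "\<forall>\<^sub>F i in F. f' i \<in> borel_measurable borel \<and> (AE x in lborel. norm (f' i x - g' x) \<le> r' i)"
    using f' unfolding conv_Linf_def by blast
  have "((\<lambda>i. r i + r' i) \<longlongrightarrow> 0) F" using tendsto_add[OF r r'] by simp
  moreover have "\<forall>\<^sub>F i in F. (\<lambda>x. f i x - f' i x) \<in> borel_measurable borel \<and>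
     (AE x in lborel. norm (f i x - f' i x - (g x - g' x)) \<le> r i + r' i)"
    using ev ev'
  proof eventually_elim
    case (elim i)
    have "AE x in lborel. norm (f i x - f' i x - (g x - g' x)) \<le> r i + r' i"
      using conjunct2[OF elim(1)] conjunct2[OF elim(2)]
    proof eventually_elim
      case (elim x)
      have eq: "f i x - f' i x - (g x - g' x) = (f i x - g x) - (f' i x - g' x)" by simp
      show ?case unfolding eq using norm_triangle_ineq4[of "f i x - g x" "f' i x - g' x"] elim by simp
    qed
    then show ?case using elim by auto
  qed
  moreover have "AE x in lborel. norm (g x - g' x) \<le> C + C'"
    using g(2) g'(2)
    by eventually_elim (meson add_mono norm_triangle_ineq4 order_trans)
  ultimately show ?thesis
    using borel_measurable_diff[OF g(1) g'(1)] unfolding conv_Linf_def by blast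
qed

lemma conv_L2_add:
  assumes f: "conv_L2 f g F" and f': "conv_L2 f' g' F"
  shows "conv_L2 (\<lambda>i x. f i x + f' i x) (\<lambda>x. g x + g' x) F"
proof -
  let ?d = "\<lambda>i. l2 (\<lambda>x. f i x - g x)" and ?d' = "\<lambda>i. l2 (\<lambda>x. f' i x - g' x)"
  have g: "square_integrable g" "square_integrable g'"
    and ev: "\<forall>\<^sub>F i in F. square_integrable (f i)" "\<forall>\<^sub>F i in F. square_integrable (f' i)"
    and lim: "(?d \<longlongrightarrow> 0) F" "(?d' \<longlongrightarrow> 0) F"
    using f f' by (simp_all add: conv_L2_def)
  have "((\<lambda>i. (l2 (\<lambda>x. f i x + f' i x - (g x + g' x)))\<^sup>2) \<longlongrightarrow> 0) F"
  proof (rule Lim_null_comparison)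
    have "((\<lambda>i. 2 * (?d i)\<^sup>2 + 2 * (?d' i)\<^sup>2) \<longlongrightarrow> 2 * 0\<^sup>2 + 2 * 0\<^sup>2) F"
      by (intro tendsto_intros lim)
    then show "((\<lambda>i. 2 * (?d i)\<^sup>2 + 2 * (?d' i)\<^sup>2) \<longlongrightarrow> 0) F" by simp
    show "\<forall>\<^sub>F i in F. norm ((l2 (\<lambda>x. f i x + f' i x - (g x + g' x)))\<^sup>2) \<le> 2 * (?d i)\<^sup>2 + 2 * (?d' i)\<^sup>2"
      using ev
    proof eventually_elim
      case (elim i)
      let ?u = "\<lambda>x. f i x - g x" and ?v = "\<lambda>x. f' i x - g' x"
      have uv: "square_integrable ?u" "square_integrable ?v"
        using elim g by (auto intro: square_integrable_diff)
      have "f i x + f' i x - (g x + g' x) = ?u x + ?v x" for x by simp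
      then have "(l2 (\<lambda>x. f i x + f' i x - (g x + g' x)))\<^sup>2 = (l2 (\<lambda>x. ?u x + ?v x))\<^sup>2"
        by (simp only:)
      also have "\<dots> \<le> (LINT x|lborel. 2 * (norm (?u x))\<^sup>2 + 2 * (norm (?v x))\<^sup>2)"
        using square_integrableD[OF uv(1)] square_integrableD[OF uv(2)] norm_add_power2_le[of "?u _" "?v _"]
        by (intro square_integrableI_bound(2)) (auto simp: borel_measurable_add)
      also have "\<dots> = 2 * (?d i)\<^sup>2 + 2 * (?d' i)\<^sup>2"
        using square_integrableD[OF uv(1)] square_integrableD[OF uv(2)] by (simp add: l2_power2)
      finally show ?case by simp
    qed
  qed
  then have "((\<lambda>i. sqrt ((l2 (\<lambda>x. f i x + f' i x - (g x + g' x)))\<^sup>2)) \<longlongrightarrow> sqrt 0) F"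
    by (rule tendsto_real_sqrt)
  then have "((\<lambda>i. l2 (\<lambda>x. f i x + f' i x - (g x + g' x))) \<longlongrightarrow> 0) F"
    by (simp add: l2_nonneg)
  moreover have "\<forall>\<^sub>F i in F. square_integrable (\<lambda>x. f i x + f' i x)"
    using ev by eventually_elim (rule square_integrable_add)
  ultimately show ?thesis using square_integrable_add[OF g] by (simp add: conv_L2_def)
qed

lemma conv_L2_cong_AE:
  fixes f f' :: "'i \<Rightarrow> real \<Rightarrow> 'a::{banach, second_countable_topology}"
  assumes f: "conv_L2 f g F" and g': "g' \<in> borel_measurable borel" "AE x in lborel. g' x = g x"
    and f': "\<forall>\<^sub>F i in F. f' i \<in> borel_measurable borel \<and> (AE x in lborel. f' i x = f i x)"
  shows "conv_L2 f' g' F"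
proof -
  have g: "square_integrable g" and ev: "\<forall>\<^sub>F i in F. square_integrable (f i)"
    and lim: "((\<lambda>i. l2 (\<lambda>x. f i x - g x)) \<longlongrightarrow> 0) F"
    using f by (simp_all add: conv_L2_def)
  have "\<forall>\<^sub>F i in F. l2 (\<lambda>x. f i x - g x) = l2 (\<lambda>x. f' i x - g' x)"
    using ev f'
  proof eventually_elim
    case (elim i)
    have "AE x in lborel. f' i x - g' x = f i x - g x"
      using conjunct2[OF elim(2)] g'(2) by eventually_elim simp
    then show ?case
      using elim g' by (intro square_integrable_cong_AE(2)[symmetric] square_integrable_diff g) auto
  qed
  then have "((\<lambda>i. l2 (\<lambda>x. f' i x - g' x)) \<longlongrightarrow> 0) F"
    using lim by (rule Lim_transform_eventually[rotated])
  moreover have "\<forall>\<^sub>F i in F. square_integrable (f' i)"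
    using ev f' by eventually_elim (auto intro: square_integrable_cong_AE(1))
  ultimately show ?thesis
    using square_integrable_cong_AE(1)[OF g g'] by (simp add: conv_L2_def)
qed

text \<open>The Sobolev inequality with \<open>c = 0\<close>, applied to the difference. It consumes
  one derivative, which is the reason why the derivatives of highest order converge in L2
  only.\<close>

lemma conv_Linf_if_weak_derivative:
  fixes f f' :: "'i \<Rightarrow> real \<Rightarrow> 'a::{banach, second_countable_topology}"
  assumes f: "conv_L2 f g F" and f': "conv_L2 f' g' F"
    and wd: "has_weak_derivative 1 g g'" "\<forall>\<^sub>F i in F. has_weak_derivative 1 (f i) (f' i)"
  shows "conv_Linf f g F"
proof -
  have g: "square_integrable g" "square_integrable g'"
    and ev: "\<forall>\<^sub>F i in F. square_integrable (f i)" "\<forall>\<^sub>F i in F. square_integrable (f' i)"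
    using f f' by (simp_all add: conv_L2_def)
  let ?r = "\<lambda>i. l2 (\<lambda>x. f i x - g x) + l2 (\<lambda>x. f' i x - g' x)"
  have "(?r \<longlongrightarrow> 0 + 0) F" using f f' unfolding conv_L2_def by (intro tendsto_add) auto
  then have lim: "(?r \<longlongrightarrow> 0) F" by simp
  have "\<forall>\<^sub>F i in F. f i \<in> borel_measurable borel \<and> (AE x in lborel. norm (f i x - g x) \<le> ?r i)"
    using wd(2) ev
  proof eventually_elim
    case (elim i)
    have "AE x in lborel. norm (f i x - g x) \<le> 0 + l2 (\<lambda>x. f i x - g x) + l2 (\<lambda>x. f' i x - g' x)"
      using elim g wd(1)
      by (intro weak_derivative_L2_bound has_weak_derivative_diff square_integrable_diff) auto
    then show ?case using square_integrableD(1)[OF elim(2)] by simp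
  qed
  moreover have "AE x in lborel. norm (g x) \<le> 0 + l2 g + l2 g'"
    using g wd(1) by (intro weak_derivative_L2_bound) auto
  ultimately show ?thesis
    using lim square_integrableD(1)[OF g(1)] unfolding conv_Linf_def by blast
qed

section \<open>Neighbourhoods in the energy space\<close>

text \<open>The balls of the extended-valued distance form a filter base, so that the
  \<epsilon>-\<delta> continuity on \<open>X k\<close> becomes a limit along a filter and the rules
  for \<open>tendsto\<close> apply.\<close>

definition nhds_X :: "nat \<Rightarrow> (real \<Rightarrow> complex) \<Rightarrow> (real \<Rightarrow> complex) filter" where
  "nhds_X k u = (INF \<delta>\<in>{0<..}. principal {v \<in> X k. X_dist k u v < ereal \<delta>})"

lemma eventually_nhds_X:
  "eventually Q (nhds_X k u) \<longleftrightarrow> (\<exists>\<delta>>0. \<forall>v\<in>X k. X_dist k u v < ereal \<delta> \<longrightarrow> Q v)"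
proof -
  have "eventually Q (nhds_X k u) \<longleftrightarrow>
    (\<exists>\<delta>\<in>{0<..}. eventually Q (principal {v \<in> X k. X_dist k u v < ereal \<delta>}))"
    unfolding nhds_X_def
  proof (rule eventually_INF_base)
    fix a b :: real assume "a \<in> {0<..}" "b \<in> {0<..}"
    then show "\<exists>x\<in>{0<..}. principal {v \<in> X k. X_dist k u v < ereal x} \<le>
        inf (principal {v \<in> X k. X_dist k u v < ereal a}) (principal {v \<in> X k. X_dist k u v < ereal b})"
      by (intro bexI[of _ "min a b"]) auto
  qed simp
  then show ?thesis by (auto simp: eventually_principal)
qed

lemma continuous_on_X_iff: "continuous_on_X k G \<longleftrightarrow> (\<forall>u\<in>X k. (G \<longlongrightarrow> G u) (nhds_X k u))"
  unfolding continuous_on_X_def tendsto_iff eventually_nhds_X dist_real_def ..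

lemma eventually_nhds_X_in: "\<forall>\<^sub>F v in nhds_X k u. v \<in> X k"
  unfolding eventually_nhds_X by (auto intro: exI[of _ 1])

lemma Linf_norm_nonneg: "0 \<le> Linf_norm f"
proof -
  have "0 = esssup lborel (\<lambda>x::real. 0::ereal)" by (subst esssup_const) auto
  also have "\<dots> \<le> Linf_norm f"
    unfolding Linf_norm_def by (rule esssup_mono) auto
  finally show ?thesis .
qed

lemma Sobolev_norm_nonneg: "0 \<le> Sobolev_norm m f"
  by (auto simp: Sobolev_norm_def intro!: sum_nonneg)

lemma L2_norm_nonneg: "0 \<le> L2_norm f"
  by (auto simp: L2_norm_def)

lemma X_dist_nonneg: "0 \<le> X_dist k u v"
  unfolding X_dist_def by (intro add_nonneg_nonneg Linf_norm_nonneg Sobolev_norm_nonneg L2_norm_nonneg)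

lemma X_dist_parts:
  "Linf_norm (\<lambda>x. u x - v x) \<le> X_dist k u v"
  "Sobolev_norm (k - 1) (wderiv 1 (\<lambda>x. u x - v x)) \<le> X_dist k u v"
  "L2_norm (\<lambda>x. (cmod (u x))\<^sup>2 - (cmod (v x))\<^sup>2) \<le> X_dist k u v"
  unfolding X_dist_def
  by (simp_all add: add_increasing add_increasing2 Linf_norm_nonneg Sobolev_norm_nonneg L2_norm_nonneg)

text \<open>An infinite distance is sent to 0, which does no harm since the distance is finite
  eventually along \<open>nhds_X k u\<close>.\<close>

definition X_dist_real :: "nat \<Rightarrow> (real \<Rightarrow> complex) \<Rightarrow> (real \<Rightarrow> complex) \<Rightarrow> real" where
  "X_dist_real k u v = real_of_ereal (X_dist k u v)"

lemma X_dist_finite: "\<forall>\<^sub>F v in nhds_X k u. X_dist k u v = ereal (X_dist_real k u v)"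
proof -
  have "X_dist k u v = ereal (X_dist_real k u v)" if "X_dist k u v < ereal 1" for v
    using that X_dist_nonneg[of k u v] unfolding X_dist_real_def
    by (cases "X_dist k u v") auto
  then show ?thesis unfolding eventually_nhds_X by (auto intro!: exI[of _ 1])
qed

lemma X_dist_real_tendsto: "(X_dist_real k u \<longlongrightarrow> 0) (nhds_X k u)"
proof (rule tendstoI)
  fix e :: real assume "0 < e"
  have "\<bar>X_dist_real k u v\<bar> < e" if "X_dist k u v < ereal e" for v
    using that X_dist_nonneg[of k u v] unfolding X_dist_real_def
    by (cases "X_dist k u v") auto
  then show "\<forall>\<^sub>F v in nhds_X k u. dist (X_dist_real k u v) 0 < e"
    using \<open>0 < e\<close> unfolding eventually_nhds_X by (auto intro!: exI[of _ e])
qed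

section \<open>Derivatives of functions in the energy space\<close>

lemma X_has_weak_derivative_1: "u \<in> X k \<Longrightarrow> has_weak_derivative 1 u (wderiv 1 u)"
  by (auto simp: X_def finite_energy_def intro: has_weak_derivative_wderiv)

lemma X_locally_integrable: "u \<in> X k \<Longrightarrow> locally_integrable u"
  by (simp add: X_def)

text \<open>Membership in \<open>X k\<close> speaks of \<open>wderiv j (wderiv 1 u)\<close>, while
  the functionals use \<open>wderiv (Suc j) u\<close>. These are independent choices of a
  representative that agree almost everywhere, because both are weak derivatives of \<open>u\<close>
  of the same order.\<close>

lemma X_has_weak_derivative_wderiv:
  assumes u: "u \<in> X k" and j: "j < k"
  shows "has_weak_derivative j (wderiv 1 u) (wderiv j (wderiv 1 u))"
    and "has_weak_derivative (Suc j) u (wderiv j (wderiv 1 u))"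
proof -
  have "j \<le> k - 1" using j by simp
  then show 1: "has_weak_derivative j (wderiv 1 u) (wderiv j (wderiv 1 u))"
    using u by (auto simp: X_def Sobolev_H_def intro: has_weak_derivative_wderiv)
  show "has_weak_derivative (Suc j) u (wderiv j (wderiv 1 u))"
    using has_weak_derivative_comp[OF X_has_weak_derivative_1[OF u] 1] by simp
qed

lemma X_has_weak_derivative:
  assumes u: "u \<in> X k" and j: "1 \<le> j" "j \<le> k"
  shows "has_weak_derivative j u (wderiv j u)"
proof -
  have "has_weak_derivative (Suc (j - 1)) u (wderiv (j - 1) (wderiv 1 u))"
    using j by (intro X_has_weak_derivative_wderiv(2)[OF u]) simp
  then show ?thesis using j by (simp add: has_weak_derivative_imp_wderiv)
qed

lemma X_has_weak_derivative_step:
  assumes u: "u \<in> X k" and j: "1 \<le> j" "j < k"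
  shows "has_weak_derivative 1 (wderiv j u) (wderiv (Suc j) u)"
  using has_weak_derivative_uncomp[of j u _ 1] X_has_weak_derivative[OF u, of j]
    X_has_weak_derivative[OF u, of "Suc j"] j by simp

lemma X_square_integrable:
  assumes u: "u \<in> X k" and j: "1 \<le> j" "j \<le> k"
  shows "square_integrable (wderiv j u)"
proof -
  have *: "j - 1 < k" "Suc (j - 1) = j" using j by auto
  note wd = X_has_weak_derivative_wderiv(2)[OF u *(1), unfolded *(2)]
  show ?thesis
  proof (rule square_integrable_cong_AE(1))
    show "square_integrable (wderiv (j - 1) (wderiv 1 u))"
      using u j by (auto simp: X_def Sobolev_H_def)
    show "wderiv j u \<in> borel_measurable borel"
      using X_has_weak_derivative[OF u j]
      by (intro locally_integrable_measurable has_weak_derivative_locally_integrable)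
    show "AE x in lborel. wderiv j u x = wderiv (j - 1) (wderiv 1 u) x"
      by (rule wderiv_unique[OF wd])
  qed
qed

lemma eta_square_integrable:
  assumes u: "u \<in> X k"
  shows "square_integrable (eta u)"
proof -
  have "u \<in> borel_measurable borel"
    by (intro locally_integrable_measurable X_locally_integrable[OF u])
  then have "eta u \<in> borel_measurable borel" unfolding eta_def[abs_def] by measurable
  then show ?thesis using u by (auto simp: square_integrable_def X_def finite_energy_def eta_def)
qed

text \<open>The Sobolev inequality with \<open>c = 1\<close>: a modulus above 1 is at most its
  square, so it exceeds 1 by at most \<bar>\<eta>\<bar>.\<close>

lemma X_bounded:
  assumes u: "u \<in> X k" and k: "1 \<le> k"
  shows "AE x in lborel. norm (u x) \<le> 1 + l2 (eta u) + l2 (wderiv 1 u)"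
proof (rule weak_derivative_L2_bound)
  show "has_weak_derivative 1 u (wderiv 1 u)" using u by (rule X_has_weak_derivative_1)
  show "square_integrable (wderiv 1 u)" using X_square_integrable[OF u _ k] by simp
  show "square_integrable (eta u)" using u by (rule eta_square_integrable)
  have "cmod z \<le> 1 + \<bar>1 - (cmod z)\<^sup>2\<bar>" for z
  proof (cases "cmod z \<le> 1")
    case False
    then have "cmod z \<le> (cmod z)\<^sup>2" by (simp add: self_le_power)
    then show ?thesis by linarith
  qed simp
  then show "AE x in lborel. cmod (u x) \<le> 1 + norm (eta u x)" by (simp add: eta_def)
qed

lemma conv_Linf_X:
  assumes u: "u \<in> X k" and k: "1 \<le> k"
  shows "conv_Linf (\<lambda>v. v) u (nhds_X k u)"
  unfolding conv_Linf_def
proof (intro conjI exI)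
  show "u \<in> borel_measurable borel"
    by (intro locally_integrable_measurable X_locally_integrable[OF u])
  show "AE x in lborel. norm (u x) \<le> 1 + l2 (eta u) + l2 (wderiv 1 u)" by (rule X_bounded[OF u k])
  show "(X_dist_real k u \<longlongrightarrow> 0) (nhds_X k u)" by (rule X_dist_real_tendsto)
  show "\<forall>\<^sub>F v in nhds_X k u. v \<in> borel_measurable borel \<and>
      (AE x in lborel. norm (v x - u x) \<le> X_dist_real k u v)"
    using X_dist_finite eventually_nhds_X_in
  proof eventually_elim
    case (elim v)
    have le: "Linf_norm (\<lambda>x. u x - v x) \<le> ereal (X_dist_real k u v)"
      using X_dist_parts(1)[of u v k] elim by simp
    have "AE x in lborel. ereal (norm (u x - v x)) \<le> Linf_norm (\<lambda>x. u x - v x)"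
      unfolding Linf_norm_def by (rule esssup_AE)
    then have "AE x in lborel. ereal (norm (u x - v x)) \<le> ereal (X_dist_real k u v)"
    proof eventually_elim
      case (elim x)
      then show ?case using le by (rule order_trans)
    qed
    then show ?case
      using locally_integrable_measurable[OF X_locally_integrable[OF elim(2)]]
      by (simp add: norm_minus_commute)
  qed
qed

text \<open>The distance measures iterated derivatives of one chosen derivative of
  \<open>u - v\<close>; this identifies them with differences of the derivatives that occur in the
  functionals.\<close>

lemma wderiv_diff_X:
  assumes u: "u \<in> X k" and v: "v \<in> X k" and j: "1 \<le> j" "j \<le> k"
    and H: "wderiv 1 (\<lambda>x. u x - v x) \<in> Sobolev_H (k - 1)"
  shows "AE x in lborel. wderiv (j - 1) (wderiv 1 (\<lambda>x. u x - v x)) x = wderiv j u x - wderiv j v x"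
proof (rule has_weak_derivative_unique)
  have "has_weak_derivative 1 (\<lambda>x. u x - v x) (wderiv 1 (\<lambda>x. u x - v x))"
    using has_weak_derivative_diff[OF X_has_weak_derivative_1[OF u] X_has_weak_derivative_1[OF v]]
    by (rule has_weak_derivative_imp_wderiv)
  moreover have "has_weak_derivative (j - 1) (wderiv 1 (\<lambda>x. u x - v x)) (wderiv (j - 1) (wderiv 1 (\<lambda>x. u x - v x)))"
    using H j by (auto simp: Sobolev_H_def intro: has_weak_derivative_wderiv)
  ultimately have "has_weak_derivative (1 + (j - 1)) (\<lambda>x. u x - v x) (wderiv (j - 1) (wderiv 1 (\<lambda>x. u x - v x)))"
    by (rule has_weak_derivative_comp)
  then show "has_weak_derivative j (\<lambda>x. u x - v x) (wderiv (j - 1) (wderiv 1 (\<lambda>x. u x - v x)))"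
    using j by simp
  show "has_weak_derivative j (\<lambda>x. u x - v x) (\<lambda>x. wderiv j u x - wderiv j v x)"
    by (intro has_weak_derivative_diff X_has_weak_derivative[OF u j] X_has_weak_derivative[OF v j])
qed simp

lemma conv_L2_wderiv:
  assumes u: "u \<in> X k" and j: "1 \<le> j" "j \<le> k"
  shows "conv_L2 (\<lambda>v. wderiv j v) (wderiv j u) (nhds_X k u)"
  unfolding conv_L2_def
proof (intro conjI)
  show "square_integrable (wderiv j u)" using X_square_integrable[OF u j] .
  show "\<forall>\<^sub>F v in nhds_X k u. square_integrable (wderiv j v)"
    using eventually_nhds_X_in by eventually_elim (rule X_square_integrable[OF _ j])
  show "((\<lambda>v. l2 (\<lambda>x. wderiv j v x - wderiv j u x)) \<longlongrightarrow> 0) (nhds_X k u)"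
  proof (rule Lim_null_comparison[OF _ X_dist_real_tendsto])
    show "\<forall>\<^sub>F v in nhds_X k u. norm (l2 (\<lambda>x. wderiv j v x - wderiv j u x)) \<le> X_dist_real k u v"
      using X_dist_finite eventually_nhds_X_in
    proof eventually_elim
      case (elim v)
      let ?w = "wderiv 1 (\<lambda>x. u x - v x)"
      have le: "Sobolev_norm (k - 1) ?w \<le> ereal (X_dist_real k u v)"
        using X_dist_parts(2)[of k u v] elim by simp
      \<comment> \<open>The Sobolev norm is \<infinity> outside of the Sobolev space, so a finite
        bound on it gives membership.\<close>
      then have H: "?w \<in> Sobolev_H (k - 1)"
        by (auto simp: Sobolev_norm_def split: if_splits)
      have "l2 (\<lambda>x. wderiv j v x - wderiv j u x) = l2 (\<lambda>x. wderiv j u x - wderiv j v x)"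
        by (simp add: l2_def norm_minus_commute)
      also have "\<dots> = l2 (wderiv (j - 1) ?w)"
      proof (rule square_integrable_cong_AE(2))
        show "square_integrable (wderiv (j - 1) ?w)"
          using H j by (auto simp: Sobolev_H_def)
        show "(\<lambda>x. wderiv j u x - wderiv j v x) \<in> borel_measurable borel"
          by (intro square_integrableD square_integrable_diff X_square_integrable[OF u j] X_square_integrable[OF elim(2) j])
        show "AE x in lborel. wderiv j u x - wderiv j v x = wderiv (j - 1) ?w x"
          using wderiv_diff_X[OF u elim(2) j H] by (auto elim: eventually_mono)
      qed
      also have "\<dots> \<le> sqrt (\<Sum>i\<le>k - 1. LINT x|lborel. (norm (wderiv i ?w x))\<^sup>2)"
        unfolding l2_def using j
        by (intro real_sqrt_le_mono member_le_sum) auto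
      also have "\<dots> \<le> X_dist_real k u v"
        using le H by (simp add: Sobolev_norm_def)
      finally show ?case by (simp add: l2_nonneg)
    qed
  qed
qed

text \<open>Up to sign, the difference of the two densities is the function measured by the third
  summand of the distance. The other summands do not control it in L2.\<close>

lemma conv_L2_eta:
  assumes u: "u \<in> X k"
  shows "conv_L2 eta (eta u) (nhds_X k u)"
  unfolding conv_L2_def
proof (intro conjI)
  show "square_integrable (eta u)" using u by (rule eta_square_integrable)
  show "\<forall>\<^sub>F v in nhds_X k u. square_integrable (eta v)"
    using eventually_nhds_X_in by eventually_elim (rule eta_square_integrable)
  show "((\<lambda>v. l2 (\<lambda>x. eta v x - eta u x)) \<longlongrightarrow> 0) (nhds_X k u)"
  proof (rule Lim_null_comparison[OF _ X_dist_real_tendsto])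
    show "\<forall>\<^sub>F v in nhds_X k u. norm (l2 (\<lambda>x. eta v x - eta u x)) \<le> X_dist_real k u v"
      using X_dist_finite
    proof eventually_elim
      case (elim v)
      have "L2_norm (\<lambda>x. (cmod (u x))\<^sup>2 - (cmod (v x))\<^sup>2) \<le> ereal (X_dist_real k u v)"
        using X_dist_parts(3)[of u v k] elim by simp
      then show ?case
        by (auto simp: L2_norm_def l2_def eta_def split: if_splits)
    qed
  qed
qed

lemma conv_Linf_wderiv:
  assumes u: "u \<in> X k" and j: "1 \<le> j" "j < k"
  shows "conv_Linf (\<lambda>v. wderiv j v) (wderiv j u) (nhds_X k u)"
proof (rule conv_Linf_if_weak_derivative)
  show "conv_L2 (\<lambda>v. wderiv j v) (wderiv j u) (nhds_X k u)"
    "conv_L2 (\<lambda>v. wderiv (Suc j) v) (wderiv (Suc j) u) (nhds_X k u)"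
    using j by (auto intro!: conv_L2_wderiv u)
  show "has_weak_derivative 1 (wderiv j u) (wderiv (Suc j) u)"
    by (rule X_has_weak_derivative_step[OF u j])
  show "\<forall>\<^sub>F v in nhds_X k u. has_weak_derivative 1 (wderiv j v) (wderiv (Suc j) v)"
    using eventually_nhds_X_in by eventually_elim (rule X_has_weak_derivative_step[OF _ j])
qed

lemma dot_eq_inner: "dot = inner"
  by (auto simp: fun_eq_iff dot_def inner_complex_def)

lemma bounded_bilinear_dot: "bounded_bilinear dot"
  unfolding dot_eq_inner by (rule bounded_bilinear_inner)

lemma eta_eq_dot: "eta v x = 1 - dot (v x) (v x)"
  by (simp add: eta_def dot_eq_inner power2_norm_eq_inner)

lemma conv_Linf_eta:
  assumes u: "u \<in> X k" and k: "1 \<le> k"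
  shows "conv_Linf eta (eta u) (nhds_X k u)"
  using conv_Linf_diff[OF conv_Linf_const[of 1]
      conv_Linf_bilinear[OF bounded_bilinear_dot conv_Linf_X[OF u k] conv_Linf_X[OF u k]]]
  by (simp add: eta_eq_dot[abs_def])

section \<open>Derivatives of the density\<close>

lemma has_weak_derivative_const: "has_weak_derivative 1 (\<lambda>x. c) (\<lambda>x. 0)"
  by (rule has_weak_derivative_primitive)
    (auto simp: primitive_def intro!: locally_integrable_continuous)

lemma has_weak_derivative_add:
  assumes f: "has_weak_derivative 1 f f'" and g: "has_weak_derivative 1 g g'"
  shows "has_weak_derivative 1 (\<lambda>x. f x + g x) (\<lambda>x. f' x + g' x)"
  using has_weak_derivative_diff[OF f has_weak_derivative_diff[OF has_weak_derivative_const[of 0] g]]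
  by simp

lemma has_weak_derivative_cmult:
  fixes f :: "real \<Rightarrow> real"
  assumes f: "has_weak_derivative 1 f f'"
  shows "has_weak_derivative 1 (\<lambda>x. c * f x) (\<lambda>x. c * f' x)"
  using has_weak_derivative_bilinear[OF bounded_bilinear_mult has_weak_derivative_const[of c] f] by simp

text \<open>The Leibniz formulas for \<eta> = 1 - \<langle>v, v\<rangle> up to order 3, the last
  branch being order 3. As \<open>wderiv j (eta v)\<close> is an arbitrary representative,
  convergence is shown for these explicit functions and then transferred almost everywhere.\<close>

definition eta_deriv :: "nat \<Rightarrow> (real \<Rightarrow> complex) \<Rightarrow> real \<Rightarrow> real" where
  "eta_deriv j v x = -2 * (
     if j = 1 then dot (v x) (wderiv 1 v x)
     else if j = 2 then dot (wderiv 1 v x) (wderiv 1 v x) + dot (v x) (wderiv 2 v x)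
     else dot (wderiv 2 v x) (wderiv 1 v x) + 2 * dot (wderiv 1 v x) (wderiv 2 v x) + dot (v x) (wderiv 3 v x))"

lemma dot_commute: "dot z w = dot w z"
  by (simp add: dot_eq_inner inner_commute)

lemma has_weak_derivative_eta_step:
  assumes v: "v \<in> X k"
  shows "1 \<le> k \<Longrightarrow> has_weak_derivative 1 (eta v) (eta_deriv 1 v)"
    and "2 \<le> k \<Longrightarrow> has_weak_derivative 1 (eta_deriv 1 v) (eta_deriv 2 v)"
    and "3 \<le> k \<Longrightarrow> has_weak_derivative 1 (eta_deriv 2 v) (eta_deriv 3 v)"
proof -
  note B = has_weak_derivative_bilinear[OF bounded_bilinear_dot]
  note v0 = X_has_weak_derivative_1[OF v]
  have "has_weak_derivative 1 (eta v) (\<lambda>x. 0 - (dot (wderiv 1 v x) (v x) + dot (v x) (wderiv 1 v x)))"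
    unfolding eta_eq_dot[abs_def] by (intro has_weak_derivative_diff has_weak_derivative_const B v0)
  then show "has_weak_derivative 1 (eta v) (eta_deriv 1 v)"
    by (simp add: eta_deriv_def[abs_def] dot_commute[of "wderiv _ v _" "v _"])
  show "has_weak_derivative 1 (eta_deriv 1 v) (eta_deriv 2 v)" if "2 \<le> k"
  proof -
    have v1: "has_weak_derivative 1 (wderiv 1 v) (wderiv 2 v)"
      using X_has_weak_derivative_step[OF v, of 1] that by (simp add: numeral_2_eq_2)
    show ?thesis
      using has_weak_derivative_cmult[OF B[OF v0 v1], of "-2"] by (simp add: eta_deriv_def[abs_def])
  qed
  show "has_weak_derivative 1 (eta_deriv 2 v) (eta_deriv 3 v)" if "3 \<le> k"
  proof -
    have v1: "has_weak_derivative 1 (wderiv 1 v) (wderiv 2 v)"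
      using X_has_weak_derivative_step[OF v, of 1] that by (simp add: numeral_2_eq_2)
    have v2: "has_weak_derivative 1 (wderiv 2 v) (wderiv 3 v)"
      using X_has_weak_derivative_step[OF v, of 2] that by (simp add: numeral_3_eq_3)
    show ?thesis
      using has_weak_derivative_cmult[OF has_weak_derivative_add[OF B[OF v1 v1] B[OF v0 v2]], of "-2"]
      by (simp add: eta_deriv_def[abs_def] algebra_simps)
  qed
qed

lemma has_weak_derivative_eta:
  assumes v: "v \<in> X k" and j: "1 \<le> j" "j \<le> 3" "j \<le> k"
  shows "has_weak_derivative j (eta v) (eta_deriv j v)"
proof -
  note s = has_weak_derivative_eta_step[OF v]
  consider "j = 1" | "j = 2" | "j = 3" using j by linarith
  then show ?thesis
  proof cases
    case 1
    then show ?thesis using s(1) j by simp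
  next
    case 2
    then show ?thesis using has_weak_derivative_comp[OF s(1,2)] j by (simp add: numeral_2_eq_2)
  next
    case 3
    have "has_weak_derivative (1 + 1) (eta v) (eta_deriv 2 v)"
      using 3 j by (intro has_weak_derivative_comp[OF s(1,2)]) auto
    then have "has_weak_derivative (1 + 1 + 1) (eta v) (eta_deriv 3 v)"
      using 3 j by (intro has_weak_derivative_comp[OF _ s(3)]) auto
    then show ?thesis using 3 by (simp add: numeral_3_eq_3)
  qed
qed

text \<open>In every Leibniz product one factor converges in L\<infinity>, namely the function
  itself or a derivative of order below \<open>k\<close>, and the other one is a derivative of order
  between 1 and \<open>k\<close>, which converges in L2.\<close>

lemma conv_L2_eta_deriv:
  assumes u: "u \<in> X k" and j: "1 \<le> j" "j \<le> 3" "j \<le> k"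
  shows "conv_L2 (eta_deriv j) (eta_deriv j u) (nhds_X k u)"
proof -
  note U = conv_Linf_X[OF u order_trans[OF j(1,3)]]
  have scale: "conv_L2 (\<lambda>v x. c * f v x) (\<lambda>x. c * f u x) (nhds_X k u)"
    if "conv_L2 f (f u) (nhds_X k u)" for c and f :: "(real \<Rightarrow> complex) \<Rightarrow> real \<Rightarrow> real"
    using conv_L2_bilinear[OF bounded_bilinear_mult conv_Linf_const that] .
  have Ud: "conv_L2 (\<lambda>v x. dot (v x) (wderiv i v x)) (\<lambda>x. dot (u x) (wderiv i u x)) (nhds_X k u)"
    if "1 \<le> i" "i \<le> k" for i
    using conv_L2_bilinear[OF bounded_bilinear_dot U conv_L2_wderiv[OF u that]] .
  have dd: "conv_L2 (\<lambda>v x. dot (wderiv i v x) (wderiv i' v x)) (\<lambda>x. dot (wderiv i u x) (wderiv i' u x)) (nhds_X k u)"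
    if "1 \<le> i" "i < k" "1 \<le> i'" "i' \<le> k" for i i'
    using conv_L2_bilinear[OF bounded_bilinear_dot conv_Linf_wderiv[OF u that(1,2)] conv_L2_wderiv[OF u that(3,4)]] .
  consider "j = 1" | "j = 2" | "j = 3" using j by linarith
  then show ?thesis
  proof cases
    case 1
    then show ?thesis unfolding eta_deriv_def[abs_def] using scale[OF Ud[of 1], of "-2"] j by simp
  next
    case 2
    then show ?thesis unfolding eta_deriv_def[abs_def]
      using scale[OF conv_L2_add[OF dd[of 1 1] Ud[of 2]], of "-2"] j by simp
  next
    case 3
    then show ?thesis unfolding eta_deriv_def[abs_def]
      using scale[OF conv_L2_add[OF conv_L2_add[OF dd[of 2 1] scale[OF dd[of 1 2], of 2]] Ud[of 3]], of "-2"] j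
      by simp
  qed
qed

lemma conv_L2_wderiv_eta:
  assumes u: "u \<in> X k" and j: "1 \<le> j" "j \<le> 3" "j \<le> k"
  shows "conv_L2 (\<lambda>v. wderiv j (eta v)) (wderiv j (eta u)) (nhds_X k u)"
proof (rule conv_L2_cong_AE[OF conv_L2_eta_deriv[OF u j]])
  have *: "wderiv j (eta v) \<in> borel_measurable borel \<and> (AE x in lborel. wderiv j (eta v) x = eta_deriv j v x)"
    if "v \<in> X k" for v
  proof
    note wd = has_weak_derivative_eta[OF that j]
    show "wderiv j (eta v) \<in> borel_measurable borel"
      using has_weak_derivative_imp_wderiv[OF wd]
      by (intro locally_integrable_measurable has_weak_derivative_locally_integrable)
    show "AE x in lborel. wderiv j (eta v) x = eta_deriv j v x" by (rule wderiv_unique[OF wd])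
  qed
  show "wderiv j (eta u) \<in> borel_measurable borel" "AE x in lborel. wderiv j (eta u) x = eta_deriv j u x"
    using *[OF u] by auto
  show "\<forall>\<^sub>F v in nhds_X k u. wderiv j (eta v) \<in> borel_measurable borel \<and>
      (AE x in lborel. wderiv j (eta v) x = eta_deriv j v x)"
    using eventually_nhds_X_in by eventually_elim (rule *)
qed

lemma conv_Linf_wderiv_eta:
  assumes u: "u \<in> X k" and j: "1 \<le> j" "j < 3" "j < k"
  shows "conv_Linf (\<lambda>v. wderiv j (eta v)) (wderiv j (eta u)) (nhds_X k u)"
proof (rule conv_Linf_if_weak_derivative)
  show "conv_L2 (\<lambda>v. wderiv j (eta v)) (wderiv j (eta u)) (nhds_X k u)"
    "conv_L2 (\<lambda>v. wderiv (Suc j) (eta v)) (wderiv (Suc j) (eta u)) (nhds_X k u)"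
    using j by (auto intro!: conv_L2_wderiv_eta u)
  have *: "has_weak_derivative 1 (wderiv j (eta v)) (wderiv (Suc j) (eta v))" if "v \<in> X k" for v
  proof (rule has_weak_derivative_uncomp)
    show "has_weak_derivative j (eta v) (wderiv j (eta v))"
      "has_weak_derivative (j + 1) (eta v) (wderiv (Suc j) (eta v))"
      using has_weak_derivative_imp_wderiv[OF has_weak_derivative_eta[OF that, of j]]
        has_weak_derivative_imp_wderiv[OF has_weak_derivative_eta[OF that, of "Suc j"]] j by auto
  qed
  show "has_weak_derivative 1 (wderiv j (eta u)) (wderiv (Suc j) (eta u))" by (rule *[OF u])
  show "\<forall>\<^sub>F v in nhds_X k u. has_weak_derivative 1 (wderiv j (eta v)) (wderiv (Suc j) (eta v))"
    using eventually_nhds_X_in by eventually_elim (rule *)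
qed

text \<open>For \<open>k \<le> 4\<close> the orders of the derivatives of \<eta> are at most 3, the
  range covered by \<open>eta_deriv\<close>.\<close>

lemma derivatives_exist_X:
  assumes u: "u \<in> X k" and k: "1 \<le> k" "k \<le> 4"
  shows "derivatives_exist k u"
  unfolding derivatives_exist_def
proof (intro conjI allI impI)
  fix j assume j: "j \<le> k"
  show "weakly_differentiable j u"
    unfolding weakly_differentiable_def
    using has_weak_derivative_0[OF X_locally_integrable[OF u]] X_has_weak_derivative[OF u, of j] j
    by (cases "j = 0") auto
next
  fix j assume j: "j < k"
  have "has_weak_derivative 0 (eta u) (eta u)"
    by (intro has_weak_derivative_0 square_integrable_locally_integrable eta_square_integrable[OF u])
  then show "weakly_differentiable j (eta u)"
    unfolding weakly_differentiable_def
    using has_weak_derivative_eta[OF u, of j] j k by (cases "j = 0") auto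
qed

section \<open>Convergence of the integrands\<close>

definition conv_both ::
    "('i \<Rightarrow> real \<Rightarrow> 'a::{banach, second_countable_topology}) \<Rightarrow> (real \<Rightarrow> 'a) \<Rightarrow> 'i filter \<Rightarrow> bool" where
  "conv_both f g F \<longleftrightarrow> conv_L2 f g F \<and> conv_Linf f g F"

lemma conv_both_L2: "conv_both f g F \<Longrightarrow> conv_L2 f g F"
  by (simp add: conv_both_def)

text \<open>Convergence in L2 and L\<infinity> together is stable under products, which neither L1
  nor L2 convergence alone is. Any number of factors below the top order can therefore be grouped
  into a single L2 factor.\<close>

lemma conv_both_bilinear:
  fixes B :: "'a::{banach, second_countable_topology} \<Rightarrow>
      'b::{banach, second_countable_topology} \<Rightarrow> 'c::{banach, second_countable_topology}"
  assumes "bounded_bilinear B" "conv_both f g F" "conv_both f' g' F"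
  shows "conv_both (\<lambda>i x. B (f i x) (f' i x)) (\<lambda>x. B (g x) (g' x)) F"
  using assms conv_L2_bilinear conv_Linf_bilinear unfolding conv_both_def by blast

lemmas conv_both_mult = conv_both_bilinear[OF bounded_bilinear_mult]
lemmas conv_both_dot = conv_both_bilinear[OF bounded_bilinear_dot]

lemma conv_both_power:
  fixes f :: "'i \<Rightarrow> real \<Rightarrow> real"
  assumes "conv_both f g F" "0 < n"
  shows "conv_both (\<lambda>i x. f i x ^ n) (\<lambda>x. g x ^ n) F"
  using assms(2)
proof (induction n rule: nat_induct_non_zero)
  case 1
  then show ?case using assms(1) by simp
next
  case (Suc n)
  then show ?case using conv_both_mult[OF assms(1) Suc.IH] by simp
qed

lemma conv_L2_norm:
  fixes f :: "'i \<Rightarrow> real \<Rightarrow> 'a::{banach, second_countable_topology}"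
  assumes f: "conv_L2 f g F"
  shows "conv_L2 (\<lambda>i x. norm (f i x)) (\<lambda>x. norm (g x)) F"
proof -
  have norm: "square_integrable (\<lambda>x. norm (h x))" if "square_integrable h" for h :: "real \<Rightarrow> 'a"
    using that by (auto simp: square_integrable_def)
  have g: "square_integrable g" and ev: "\<forall>\<^sub>F i in F. square_integrable (f i)"
    and lim: "((\<lambda>i. l2 (\<lambda>x. f i x - g x)) \<longlongrightarrow> 0) F"
    using f by (simp_all add: conv_L2_def)
  have "((\<lambda>i. l2 (\<lambda>x. norm (f i x) - norm (g x))) \<longlongrightarrow> 0) F"
  proof (rule Lim_null_comparison[OF _ lim])
    show "\<forall>\<^sub>F i in F. norm (l2 (\<lambda>x. norm (f i x) - norm (g x))) \<le> l2 (\<lambda>x. f i x - g x)"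
      using ev
    proof eventually_elim
      case (elim i)
      have "(norm (norm (f i x) - norm (g x)))\<^sup>2 \<le> (norm (f i x - g x))\<^sup>2" for x
        by (intro power_mono) (auto simp: norm_triangle_ineq3)
      then have "(l2 (\<lambda>x. norm (f i x) - norm (g x)))\<^sup>2 \<le> (LINT x|lborel. (norm (f i x - g x))\<^sup>2)"
        using square_integrableD(1)[OF elim] square_integrableD(1)[OF g]
        by (intro square_integrableI_bound(2) square_integrableD(2) square_integrable_diff elim g) auto
      then have "(l2 (\<lambda>x. norm (f i x) - norm (g x)))\<^sup>2 \<le> (l2 (\<lambda>x. f i x - g x))\<^sup>2"
        by (simp add: l2_power2)
      then have "l2 (\<lambda>x. norm (f i x) - norm (g x)) \<le> l2 (\<lambda>x. f i x - g x)"
        by (rule power2_le_imp_le) (rule l2_nonneg)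
      then show ?case by (simp add: l2_nonneg)
    qed
  qed
  moreover have "\<forall>\<^sub>F i in F. square_integrable (\<lambda>x. norm (f i x))"
    using ev by eventually_elim (rule norm)
  ultimately show ?thesis using norm[OF g] by (simp add: conv_L2_def)
qed

lemma conv_Linf_norm:
  fixes f :: "'i \<Rightarrow> real \<Rightarrow> 'a::{banach, second_countable_topology}"
  assumes f: "conv_Linf f g F"
  shows "conv_Linf (\<lambda>i x. norm (f i x)) (\<lambda>x. norm (g x)) F"
proof -
  obtain C r where g: "g \<in> borel_measurable borel" "AE x in lborel. norm (g x) \<le> C"
    and r: "(r \<longlongrightarrow> 0) F"
    and ev: "\<forall>\<^sub>F i in F. f i \<in> borel_measurable borel \<and> (AE x in lborel. norm (f i x - g x) \<le> r i)"
    using f unfolding conv_Linf_def by blast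
  have "\<forall>\<^sub>F i in F. (\<lambda>x. norm (f i x)) \<in> borel_measurable borel \<and>
      (AE x in lborel. norm (norm (f i x) - norm (g x)) \<le> r i)"
    using ev
  proof eventually_elim
    case (elim i)
    then have "AE x in lborel. norm (norm (f i x) - norm (g x)) \<le> r i"
      by (auto elim!: eventually_mono intro: order_trans[OF norm_triangle_ineq3])
    moreover have "(\<lambda>x. norm (f i x)) \<in> borel_measurable borel"
      using elim by (auto intro: borel_measurable_norm)
    ultimately show ?case by simp
  qed
  moreover have "(\<lambda>x. norm (g x)) \<in> borel_measurable borel" "AE x in lborel. norm (norm (g x)) \<le> C"
    using g by auto
  ultimately show ?thesis using r unfolding conv_Linf_def by blast
qed

lemma conv_both_norm:
  fixes f :: "'i \<Rightarrow> real \<Rightarrow> 'a::{banach, second_countable_topology}"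
  assumes "conv_both f g F"
  shows "conv_both (\<lambda>i x. norm (f i x)) (\<lambda>x. norm (g x)) F"
  using assms conv_L2_norm conv_Linf_norm unfolding conv_both_def by blast

lemma conv_both_add:
  assumes f: "conv_both f g F" and f': "conv_both f' g' F"
  shows "conv_both (\<lambda>i x. f i x + f' i x) (\<lambda>x. g x + g' x) F"
proof -
  have "conv_Linf (\<lambda>i x. f i x - (0 - f' i x)) (\<lambda>x. g x - (0 - g' x)) F"
    using f f' unfolding conv_both_def by (intro conv_Linf_diff conv_Linf_const) auto
  then show ?thesis using conv_L2_add[of f g F f' g'] f f' by (simp add: conv_both_def)
qed

lemma conv_L2_imaginary:
  "conv_L2 f g F \<Longrightarrow> conv_L2 (\<lambda>i x. \<i> * f i x) (\<lambda>x. \<i> * g x) F"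
  by (rule conv_L2_bilinear[OF bounded_bilinear_mult conv_Linf_const])

lemma conv_both_imaginary:
  "conv_both f g F \<Longrightarrow> conv_both (\<lambda>i x. \<i> * f i x) (\<lambda>x. \<i> * g x) F"
  unfolding conv_both_def
  using conv_L2_imaginary conv_Linf_bilinear[OF bounded_bilinear_mult conv_Linf_const] by blast

lemma conv_L2_dot_Linf:
  "conv_L2 f g F \<Longrightarrow> conv_Linf f' g' F \<Longrightarrow> conv_L2 (\<lambda>i x. dot (f i x) (f' i x)) (\<lambda>x. dot (g x) (g' x)) F"
  by (rule conv_L2_bilinear'[OF bounded_bilinear_dot])

lemma conv_L1_power2:
  fixes f :: "'i \<Rightarrow> real \<Rightarrow> real"
  assumes "conv_L2 f g F"
  shows "conv_L1 (\<lambda>i x. (f i x)\<^sup>2) (\<lambda>x. (g x)\<^sup>2) F"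
  using conv_L1_bilinear[OF bounded_bilinear_mult assms assms] by (simp add: power2_eq_square)

lemma conv_L1_power:
  fixes f :: "'i \<Rightarrow> real \<Rightarrow> real"
  assumes f: "conv_both f g F" and n: "1 < n"
  shows "conv_L1 (\<lambda>i x. f i x ^ n) (\<lambda>x. g x ^ n) F"
proof -
  obtain m where m: "n = Suc m" "0 < m" using n by (cases n) auto
  show ?thesis
    using conv_L1_bilinear[OF bounded_bilinear_mult conv_both_L2[OF f] conv_both_L2[OF conv_both_power[OF f m(2)]]]
    by (simp add: m(1))
qed

lemmas conv_L1_mult = conv_L1_bilinear[OF bounded_bilinear_mult]
lemmas conv_L1_dot = conv_L1_bilinear[OF bounded_bilinear_dot]

text \<open>Integrability at the limit and convergence of the functional are bundled, so that a
  single pass along the list of integrands establishes both well-definedness and continuity.\<close>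

definition conv_terms ::
    "('i \<Rightarrow> (real \<times> (real \<Rightarrow> real)) list) \<Rightarrow> (real \<times> (real \<Rightarrow> real)) list \<Rightarrow> 'i filter \<Rightarrow> bool" where
  "conv_terms T t F \<longleftrightarrow>
     all_integrable t \<and> ((\<lambda>v. functional_of (T v)) \<longlongrightarrow> functional_of t) F"

lemma conv_terms_Nil: "conv_terms (\<lambda>v. []) [] F"
  by (simp add: conv_terms_def all_integrable_def functional_of_def)

lemma conv_terms_Cons:
  assumes "conv_L1 f g F" "conv_terms T t F"
  shows "conv_terms (\<lambda>v. (c, f v) # T v) ((c, g) # t) F"
  using assms conv_L1_integrable[OF assms(1)]
  by (auto simp: conv_terms_def all_integrable_def functional_of_def
      intro!: tendsto_add tendsto_mult conv_L1_integral_tendsto)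

section \<open>The factors that occur in the functionals\<close>

context
  fixes k :: nat and u :: "real \<Rightarrow> complex"
  assumes u: "u \<in> X k"
begin

lemma conv_both_wderiv:
  "1 \<le> j \<Longrightarrow> j < k \<Longrightarrow> conv_both (\<lambda>v. wderiv j v) (wderiv j u) (nhds_X k u)"
  unfolding conv_both_def by (simp add: conv_L2_wderiv[OF u] conv_Linf_wderiv[OF u])

lemma conv_both_eta: "1 \<le> k \<Longrightarrow> conv_both eta (eta u) (nhds_X k u)"
  unfolding conv_both_def by (simp add: conv_L2_eta[OF u] conv_Linf_eta[OF u])

lemma conv_both_wderiv_eta:
  "1 \<le> j \<Longrightarrow> j < 3 \<Longrightarrow> j < k \<Longrightarrow>
    conv_both (\<lambda>v. wderiv j (eta v)) (wderiv j (eta u)) (nhds_X k u)"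
  unfolding conv_both_def by (simp add: conv_L2_wderiv_eta[OF u] conv_Linf_wderiv_eta[OF u])

text \<open>The function itself is bounded but does not decay, so the current \<langle>i
  \<partial>\<Psi>, \<Psi>\<rangle> is treated as one factor, which inherits its convergence in L2
  and L\<infinity> from \<partial>\<Psi>.\<close>

lemma conv_both_current:
  assumes "2 \<le> k"
  shows "conv_both (\<lambda>v x. dot (\<i> * wderiv 1 v x) (v x)) (\<lambda>x. dot (\<i> * wderiv 1 u x) (u x)) (nhds_X k u)"
proof -
  have "conv_both (\<lambda>v x. \<i> * wderiv 1 v x) (\<lambda>x. \<i> * wderiv 1 u x) (nhds_X k u)"
    using assms by (intro conv_both_imaginary conv_both_wderiv) auto
  then show ?thesis
    unfolding conv_both_def using assms conv_Linf_X[OF u]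
    by (simp add: conv_L2_dot_Linf conv_Linf_bilinear[OF bounded_bilinear_dot])
qed

text \<open>The two shapes in which order \<open>k\<close> occurs: as a squared modulus in
  \<open>E k\<close>, and as the first argument of the leading \<open>dot\<close> in
  \<open>P k\<close>, whose second argument has order \<open>k - 1\<close>.\<close>

lemma conv_L2_top:
  assumes "1 \<le> k"
  shows "conv_L2 (\<lambda>v x. cmod (wderiv k v x)) (\<lambda>x. cmod (wderiv k u x)) (nhds_X k u)"
    and "conv_L2 (\<lambda>v x. \<i> * wderiv k v x) (\<lambda>x. \<i> * wderiv k u x) (nhds_X k u)"
  using assms by (auto intro!: conv_L2_norm conv_L2_imaginary conv_L2_wderiv[OF u])

text \<open>The third derivative of \<eta> enters the functionals only through its square, so L2
  convergence suffices for it.\<close>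

lemma conv_L2_eta_top:
  "3 \<le> k \<Longrightarrow> conv_L2 (\<lambda>v x. \<bar>wderiv 3 (eta v) x\<bar>) (\<lambda>x. \<bar>wderiv 3 (eta u) x\<bar>) (nhds_X k u)"
  using conv_L2_norm[OF conv_L2_wderiv_eta[OF u, of 3]] by simp

end

lemmas conv_X_rules =
  conv_L2_top conv_L2_eta_top conv_both_eta conv_both_wderiv conv_both_wderiv_eta conv_both_current

text \<open>The rules are directed by the syntax of an integrand: its outermost product,
  \<open>dot\<close> or power is split into two L2 factors, compound factors are decomposed by the
  closure properties of \<open>conv_both\<close>, and the list is consumed from its head. The
  instance of \<open>conv_both_norm\<close> for real functions matches the absolute value bars
  around derivatives of \<eta>.\<close>

lemmas conv_term_rules =
  conv_L1_power2 conv_L1_power conv_L1_mult conv_L1_dot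
  conv_both_power conv_both_norm conv_both_norm[where 'a = real, unfolded real_norm_def]
  conv_both_imaginary conv_both_mult conv_both_dot conv_both_add
  conv_both_L2 conv_terms_Cons conv_terms_Nil

section \<open>Continuity of the energies and momenta\<close>

lemma conv_terms_E:
  assumes u: "u \<in> X k" and k: "k \<in> {1..4}"
  shows "conv_terms (E_terms k) (E_terms k u) (nhds_X k u)"
proof -
  consider "k = 1" | "k = 2" | "k = 3" | "k = 4" using k by force
  then show ?thesis
  proof cases
    case 1
    have v: "u \<in> X 1" using u 1 by simp
    have "conv_terms E1_terms (E1_terms u) (nhds_X 1 u)"
      \<comment> \<open>The potential term of the first energy is written out in terms of \<Psi>; it
        is folded to \<eta> so that the convergence rules match.\<close>
      unfolding E1_terms_def[abs_def] eta_def[symmetric]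
      \<comment> \<open>The simplifier only discharges the numerical side conditions on orders and
        exponents.\<close>
      by (rule conv_X_rules[OF v] conv_term_rules | (simp; fail))+
    then show ?thesis by (simp add: 1 E_terms_def)
  next
    case 2
    have v: "u \<in> X 2" using u 2 by simp
    have "conv_terms E2_terms (E2_terms u) (nhds_X 2 u)"
      unfolding E2_terms_def[abs_def]
      by (rule conv_X_rules[OF v] conv_term_rules | (simp; fail))+
    then show ?thesis by (simp add: 2 E_terms_def)
  next
    case 3
    have v: "u \<in> X 3" using u 3 by simp
    have "conv_terms E3_terms (E3_terms u) (nhds_X 3 u)"
      unfolding E3_terms_def[abs_def]
      by (rule conv_X_rules[OF v] conv_term_rules | (simp; fail))+
    then show ?thesis by (simp add: 3 E_terms_def)
  next
    case 4
    have v: "u \<in> X 4" using u 4 by simp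
    have "conv_terms E4_terms (E4_terms u) (nhds_X 4 u)"
      unfolding E4_terms_def[abs_def]
      by (rule conv_X_rules[OF v] conv_term_rules | (simp; fail))+
    then show ?thesis by (simp add: 4 E_terms_def)
  qed
qed

lemma conv_terms_P:
  assumes u: "u \<in> X k" and k: "k \<in> {2..4}"
  shows "conv_terms (P_terms k) (P_terms k u) (nhds_X k u)"
proof -
  consider "k = 2" | "k = 3" | "k = 4" using k by force
  then show ?thesis
  proof cases
    case 1
    have v: "u \<in> X 2" using u 1 by simp
    have "conv_terms P2_terms (P2_terms u) (nhds_X 2 u)"
      unfolding P2_terms_def[abs_def]
      by (rule conv_X_rules[OF v] conv_term_rules | (simp; fail))+
    then show ?thesis by (simp add: 1 P_terms_def)
  next
    case 2
    have v: "u \<in> X 3" using u 2 by simp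
    have "conv_terms P3_terms (P3_terms u) (nhds_X 3 u)"
      unfolding P3_terms_def[abs_def]
      by (rule conv_X_rules[OF v] conv_term_rules | (simp; fail))+
    then show ?thesis by (simp add: 2 P_terms_def)
  next
    case 3
    have v: "u \<in> X 4" using u 3 by simp
    have "conv_terms P4_terms (P4_terms u) (nhds_X 4 u)"
      unfolding P4_terms_def[abs_def]
      by (rule conv_X_rules[OF v] conv_term_rules | (simp; fail))+
    then show ?thesis by (simp add: 3 P_terms_def)
  qed
qed

lemma E_well_defined_X: "u \<in> X k \<Longrightarrow> k \<in> {1..4} \<Longrightarrow> E_well_defined k u"
  using conv_terms_E derivatives_exist_X by (auto simp: E_well_defined_def conv_terms_def)

lemma P_well_defined_X: "u \<in> X k \<Longrightarrow> k \<in> {2..4} \<Longrightarrow> P_well_defined k u"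
  using conv_terms_P derivatives_exist_X by (auto simp: P_well_defined_def conv_terms_def)

lemma continuous_on_X_E: "k \<in> {1..4} \<Longrightarrow> continuous_on_X k (E k)"
  using conv_terms_E by (auto simp: continuous_on_X_iff conv_terms_def E_def[abs_def])

lemma continuous_on_X_P: "k \<in> {2..4} \<Longrightarrow> continuous_on_X k (P k)"
  using conv_terms_P by (auto simp: continuous_on_X_iff conv_terms_def P_def[abs_def])

section \<open>The phase\<close>

text \<open>The complement is open and null, whereas a point of it would be surrounded by an
  interval of positive length.\<close>

lemma AE_closed_imp_UNIV:
  fixes C :: "real set"
  assumes C: "closed C" and ae: "AE x in lborel. x \<in> C"
  shows "x \<in> C"
proof (rule ccontr)
  assume "x \<notin> C"
  then obtain e where e: "0 < e" "cball x e \<subseteq> - C"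
    using C open_contains_cball[of "- C"] by (auto simp: open_Compl)
  have "emeasure lborel {x - e..x + e} \<le> emeasure lborel (- C)"
    using e(2) C by (intro emeasure_mono) (auto simp: cball_eq_atLeastAtMost borel_closed)
  also have "emeasure lborel (- C) = 0"
    using ae C AE_iff_measurable[of "- C" lborel "\<lambda>x. x \<in> C"] by (auto simp: borel_closed)
  finally show False using e(1) by simp
qed

lemma AE_eq_continuous_imp_eq:
  fixes f g :: "real \<Rightarrow> 'a::t2_space"
  assumes "continuous_on UNIV f" "continuous_on UNIV g" "AE x in lborel. f x = g x"
  shows "f x = g x"
  using AE_closed_imp_UNIV[OF closed_Collect_eq[OF assms(1,2)]] assms(3) by simp

section \<open>A lower bound for the modulus\<close>

lemma exists_small_value:
  fixes f :: "real \<Rightarrow> real"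
  assumes f: "integrable lborel f" "\<And>x. 0 \<le> f x" and "a \<le> b" and lt: "(LINT x|lborel. f x) < e * (b - a)"
  shows "\<exists>y. a < y \<and> y \<le> b \<and> f y < e"
proof (rule ccontr)
  assume "\<not> ?thesis"
  then have ge: "e \<le> f y" if "a < y" "y \<le> b" for y using that by force
  have "e * (b - a) = (LINT x|lborel. e * indicat_real {a<..b} x)"
    using \<open>a \<le> b\<close> by simp
  also have "\<dots> \<le> (LINT x|lborel. f x)"
  proof (rule integral_mono[OF _ f(1)])
    show "integrable lborel (\<lambda>x. e * indicat_real {a<..b} x)"
      using emeasure_lborel_Ioc[OF \<open>a \<le> b\<close>]
      by (intro integrable_mult_right integrable_real_indicator) (auto simp: less_top[symmetric])
    show "e * indicat_real {a<..b} x \<le> f x" for x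
      using ge[of x] f(2)[of x] by (simp add: indicator_def)
  qed
  finally show False using lt by simp
qed

definition cubic :: "real \<Rightarrow> real" where
  "cubic r = r - r ^ 3 / 3"

text \<open>The Taylor expansion at \<open>p\<close>, where the derivative is
  \<open>1 - p\<^sup>2\<close>, is exact for a cubic polynomial; its remainder carries the factor
  \<open>(q + 2 * p) / 3\<close>, which is at most \<open>M\<close>.\<close>

lemma cubic_diff_bound:
  fixes p q :: real
  assumes "0 \<le> p" "p \<le> M" "0 \<le> q" "q \<le> M" "\<bar>q - p\<bar> \<le> d"
  shows "\<bar>cubic q - cubic p\<bar> \<le> \<bar>1 - p\<^sup>2\<bar> * d + M * d\<^sup>2"
proof -
  have "cubic q - cubic p = (q - p) * (1 - p\<^sup>2) - (q - p)\<^sup>2 * ((q + 2 * p) / 3)"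
    by (simp add: cubic_def field_simps power2_eq_square power3_eq_cube)
  then have "\<bar>cubic q - cubic p\<bar> \<le> \<bar>(q - p) * (1 - p\<^sup>2)\<bar> + \<bar>(q - p)\<^sup>2 * ((q + 2 * p) / 3)\<bar>"
    by (metis abs_triangle_ineq4)
  also have "\<bar>(q - p) * (1 - p\<^sup>2)\<bar> \<le> \<bar>1 - p\<^sup>2\<bar> * d"
    using mult_left_mono[OF assms(5), of "\<bar>1 - p\<^sup>2\<bar>"] by (simp add: abs_mult mult.commute)
  also have "\<bar>(q - p)\<^sup>2 * ((q + 2 * p) / 3)\<bar> = \<bar>q - p\<bar>\<^sup>2 * ((q + 2 * p) / 3)"
    using assms by (simp add: abs_mult)
  also have "\<dots> \<le> d\<^sup>2 * M"
    using assms by (intro mult_mono power_mono) auto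
  finally show ?thesis by (simp add: mult.commute)
qed

text \<open>A chain rule in the form of an inequality. At this stage \<open>V\<close> may have
  zeros, where its modulus need not be differentiable, so the bisection argument is applied directly
  to the excess of the left-hand side over the integral.\<close>

lemma modulus_increment:
  fixes V w :: "real \<Rightarrow> complex"
  assumes V: "primitive V w" and ab: "a \<le> b"
  shows "\<bar>cubic (cmod (V b)) - cubic (cmod (V a))\<bar>
    \<le> (LINT s:{a<..b}|lborel. \<bar>1 - (cmod (V s))\<^sup>2\<bar> * cmod (w s))"
proof -
  have w: "locally_integrable w" and cV: "continuous_on UNIV V"
    using V by (auto intro: primitive_locally_integrable primitive_continuous)
  have h: "locally_integrable (\<lambda>s. cmod (w s))" using w by (rule locally_integrable_norm)
  obtain H where H: "primitive H (\<lambda>s. cmod (w s))" using primitive_exists[OF h] by blast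
  let ?N = "\<lambda>s. \<bar>1 - (cmod (V s))\<^sup>2\<bar>"
  have mult: "locally_integrable (\<lambda>s. c s * cmod (w s))" if "continuous_on UNIV c" for c
    using locally_integrable_bilinear[OF bounded_bilinear_mult that h] .
  have N: "locally_integrable (\<lambda>s. ?N s * cmod (w s))"
    by (intro mult continuous_intros cV)
  have "compact (V ` {a..b})"
    by (intro compact_continuous_image continuous_on_subset[OF cV]) auto
  then obtain M where M: "\<And>x. x \<in> {a..b} \<Longrightarrow> cmod (V x) \<le> M"
    using compact_imp_bounded bounded_iff by (metis image_eqI)
  \<comment> \<open>In the constant \<open>3 * M\<close>, one \<open>M\<close> comes from the
    remainder of the cubic and \<open>2 * M\<close> from replacing the factor \<bar>1 -
    \<bar>V\<bar>^2\<bar> at \<open>x\<close> by its value at \<open>s\<close>.\<close>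
  have "\<bar>cubic (cmod (V b)) - cubic (cmod (V a))\<bar> - (LINT s:{a<..b}|lborel. ?N s * cmod (w s)) \<le> 0"
  proof (rule subadditive_quadratic_nonpos[where H = H and C = "3 * M" and
        D = "\<lambda>x y. \<bar>cubic (cmod (V y)) - cubic (cmod (V x))\<bar> - (LINT s:{x<..y}|lborel. ?N s * cmod (w s))"])
    show "a \<le> b" by (rule ab)
    show "continuous_on {a..b} H"
      using primitive_continuous[OF H] by (rule continuous_on_subset) simp
    show "H x \<le> H y" if "x \<le> y" for x y using primitive_mono[OF H norm_ge_zero that] .
    show "\<bar>cubic (cmod (V z)) - cubic (cmod (V x))\<bar> - (LINT s:{x<..z}|lborel. ?N s * cmod (w s))
      \<le> \<bar>cubic (cmod (V y)) - cubic (cmod (V x))\<bar> - (LINT s:{x<..y}|lborel. ?N s * cmod (w s))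
       + (\<bar>cubic (cmod (V z)) - cubic (cmod (V y))\<bar> - (LINT s:{y<..z}|lborel. ?N s * cmod (w s)))"
      if "x \<le> y" "y \<le> z" for x y z
      unfolding set_integral_Ioc_add[OF N that] by linarith
    show "\<bar>cubic (cmod (V y)) - cubic (cmod (V x))\<bar> - (LINT s:{x<..y}|lborel. ?N s * cmod (w s))
      \<le> 3 * M * (H y - H x)\<^sup>2" if xy: "a \<le> x" "x \<le> y" "y \<le> b" for x y
    proof -
      have bound: "\<bar>cmod (V s) - cmod (V x)\<bar> \<le> H y - H x" if "x \<le> s" "s \<le> y" for s
        using primitive_norm_diff_bound[OF V H order_refl order_refl that] norm_triangle_ineq3[of "V s" "V x"]
        by linarith
      have "\<bar>cubic (cmod (V y)) - cubic (cmod (V x))\<bar> \<le> ?N x * (H y - H x) + M * (H y - H x)\<^sup>2"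
        using M xy bound[of y] by (intro cubic_diff_bound) auto
      also have "?N x * (H y - H x) = (LINT s:{x<..y}|lborel. ?N x * cmod (w s))"
        using primitive_diff_eq[OF H xy(2)] by simp
      also have "\<dots> \<le> norm (LINT s:{x<..y}|lborel. ?N x * cmod (w s))" by simp
      also have "\<dots> \<le> (LINT s:{x<..y}|lborel. ?N s * cmod (w s) + 2 * M * (H y - H x) * cmod (w s))"
      proof (rule norm_set_integral_Ioc_le)
        show "locally_integrable (\<lambda>s. ?N x * cmod (w s))" by (intro mult continuous_intros)
        show "locally_integrable (\<lambda>s. ?N s * cmod (w s) + 2 * M * (H y - H x) * cmod (w s))"
          by (intro locally_integrable_add N mult continuous_intros)
        fix s assume s: "x < s" "s \<le> y"
        have "\<bar>(cmod (V s))\<^sup>2 - (cmod (V x))\<^sup>2\<bar> = \<bar>cmod (V s) - cmod (V x)\<bar> * (cmod (V s) + cmod (V x))"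
          by (simp add: power2_eq_square square_diff_square_factored abs_mult mult.commute)
        also have "\<dots> \<le> (H y - H x) * (2 * M)"
          using bound[of s] M[of s] M[of x] s xy by (intro mult_mono) auto
        finally have "?N x \<le> ?N s + 2 * M * (H y - H x)" by (simp add: mult_ac)
        then have "?N x * cmod (w s) \<le> (?N s + 2 * M * (H y - H x)) * cmod (w s)"
          by (rule mult_right_mono) simp
        then show "norm (?N x * cmod (w s)) \<le> ?N s * cmod (w s) + 2 * M * (H y - H x) * cmod (w s)"
          by (simp add: abs_mult distrib_right)
      qed
      also have "\<dots> = (LINT s:{x<..y}|lborel. ?N s * cmod (w s)) + 2 * M * (H y - H x) * (H y - H x)"
        using set_integral_add(2)[OF locally_integrable_Ioc[OF N] locally_integrable_Ioc[OF mult[OF continuous_on_const]], of x y "2 * M * (H y - H x)"]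
          primitive_diff_eq[OF H xy(2)] by simp
      finally show ?thesis by (simp add: power2_eq_square algebra_simps)
    qed
  qed
  then show ?thesis by simp
qed

text \<open>The maximum at 1 is nondegenerate:
  \<open>cubic r = 2/3 - (r - 1)\<^sup>2 * (r + 2) / 3\<close>. The hypotheses force
  \<open>(r - 1)\<^sup>2 < e\<close> and \<open>r \<le> 2\<close>, so that the last factor is at
  most 4/3, which is rounded up to 2.\<close>

lemma cubic_ge_near_1:
  assumes "0 \<le> r" "(1 - r\<^sup>2)\<^sup>2 < e" "e \<le> 1"
  shows "2 / 3 - 2 * e \<le> cubic r"
proof -
  have "(1 - r\<^sup>2)\<^sup>2 = (r - 1)\<^sup>2 * (r + 1)\<^sup>2"
    by (simp add: power2_eq_square algebra_simps)
  moreover have "(r - 1)\<^sup>2 * 1 \<le> (r - 1)\<^sup>2 * (r + 1)\<^sup>2"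
    using assms(1) by (intro mult_left_mono) (auto simp: one_le_power)
  ultimately have le: "(r - 1)\<^sup>2 < e" using assms(2) by linarith
  have "r \<le> 2"
  proof (rule ccontr)
    assume "\<not> r \<le> 2"
    then have "1\<^sup>2 \<le> (r - 1)\<^sup>2" by (intro power_mono) auto
    then show False using le assms(3) by simp
  qed
  moreover have "0 \<le> e" using le zero_le_power2[of "r - 1"] by linarith
  ultimately have "(r - 1)\<^sup>2 * ((r + 2) / 3) \<le> e * 2"
    using le assms(1) by (intro mult_mono) auto
  moreover have "cubic r = 2 / 3 - (r - 1)\<^sup>2 * ((r + 2) / 3)"
    by (simp add: cubic_def field_simps power2_eq_square power3_eq_cube)
  ultimately show ?thesis by simp
qed

lemma product_le_energy_density:
  fixes a b :: real
  shows "b * a \<le> sqrt 2 * (1/2 * a\<^sup>2 + 1/4 * b\<^sup>2)"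
proof -
  have "sqrt 2 * (1/2 * a\<^sup>2 + 1/4 * b\<^sup>2) - b * a = sqrt 2 / 4 * (sqrt 2 * a - b)\<^sup>2"
    by (simp add: power2_eq_square algebra_simps)
  also have "\<dots> \<ge> 0" by simp
  finally show ?thesis by simp
qed

lemma E_1_eq: "E 1 u = 1/2 * (l2 (wderiv 1 u))\<^sup>2 + 1/4 * (l2 (eta u))\<^sup>2"
  by (simp add: E_def E_terms_def E1_terms_def functional_of_def l2_power2 eta_def)

text \<open>Descending from a modulus near 1 on the left to the value at \<open>x\<close>, and
  ascending again on the right, uses two disjoint intervals, so twice
  \<open>2/3 - cubic (cmod (V x))\<close> is at most the whole integral \<open>J\<close>. As
  \<open>J \<le> sqrt 2 * E 1 u < 4/3\<close>, the lower bound \<open>2/3 - J/2\<close> is positive,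
  and \<open>cubic r \<le> r\<close> passes it on to the modulus.\<close>

lemma modulus_bounded_below:
  fixes V :: "real \<Rightarrow> complex"
  assumes u: "u \<in> X k" and k: "1 \<le> k" and E: "E 1 u < 2 * sqrt 2 / 3"
    and V: "primitive V (wderiv 1 u)" and uV: "AE x in lborel. u x = V x"
  shows "\<exists>c>0. \<forall>x. c \<le> cmod (V x)"
proof -
  let ?w = "wderiv 1 u"
  have w: "square_integrable ?w" using X_square_integrable[OF u _ k] by simp
  have eta_V: "AE x in lborel. eta V x = eta u x" using uV by eventually_elim (simp add: eta_def)
  have cV: "continuous_on UNIV V" using V by (rule primitive_continuous)
  have N: "square_integrable (eta V)" and l2_N: "l2 (eta V) = l2 (eta u)"
  proof -
    have "continuous_on UNIV (eta V)" unfolding eta_def[abs_def] by (intro continuous_intros cV)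
    then have "eta V \<in> borel_measurable borel" by (rule borel_measurable_continuous_onI)
    from square_integrable_cong_AE[OF eta_square_integrable[OF u] this eta_V]
    show "square_integrable (eta V)" "l2 (eta V) = l2 (eta u)" by auto
  qed
  let ?f = "\<lambda>x. \<bar>1 - (cmod (V x))\<^sup>2\<bar> * cmod (?w x)"
  have f: "integrable lborel ?f"
    using Cauchy_Schwarz_l2(1)[OF N w] by (simp add: eta_def)
  have fl: "locally_integrable ?f" using f by (rule locally_integrable_integrable)
  define J where "J = (LINT x|lborel. ?f x)"
  have J: "J \<le> sqrt 2 * E 1 u"
  proof -
    have iw: "integrable lborel (\<lambda>x. (cmod (?w x))\<^sup>2)" and iN: "integrable lborel (\<lambda>x. (norm (eta V x))\<^sup>2)"
      using w N by (auto dest: square_integrableD)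
    have "J \<le> (LINT x|lborel. sqrt 2 * (1/2 * (cmod (?w x))\<^sup>2 + 1/4 * (norm (eta V x))\<^sup>2))"
      unfolding J_def
    proof (rule integral_mono[OF f])
      show "integrable lborel (\<lambda>x. sqrt 2 * (1/2 * (cmod (?w x))\<^sup>2 + 1/4 * (norm (eta V x))\<^sup>2))"
        using iw iN by simp
      show "?f x \<le> sqrt 2 * (1/2 * (cmod (?w x))\<^sup>2 + 1/4 * (norm (eta V x))\<^sup>2)" for x
        using product_le_energy_density[of "norm (eta V x)" "cmod (?w x)"] by (simp add: eta_def)
    qed
    also have "\<dots> = sqrt 2 * (1/2 * (l2 ?w)\<^sup>2 + 1/4 * (l2 (eta V))\<^sup>2)"
      using iw iN unfolding l2_power2 by simp
    finally show ?thesis by (simp only: E_1_eq l2_N)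
  qed
  have bound: "2 / 3 - J / 2 \<le> cubic (cmod (V x))" for x
  proof (rule field_le_epsilon)
    fix e :: real assume "0 < e"
    \<comment> \<open>Each of the two outer points loses up to \<open>2 * d\<close> against 2/3, and
      the value at \<open>x\<close> is counted twice, so the total loss is
      \<open>2 * d \<le> e\<close>. The bound 1 is the range of
      \<open>cubic_ge_near_1\<close>.\<close>
    define d where "d = min 1 (e / 2)"
    have d: "0 < d" "d \<le> 1" "2 * d \<le> e" using \<open>0 < e\<close> by (auto simp: d_def)
    let ?N2 = "\<lambda>x. (norm (eta V x))\<^sup>2"
    have iN: "integrable lborel ?N2" using N by (rule square_integrableD)
    \<comment> \<open>By the Chebyshev inequality a window of this length contains a point where
      \<eta>^2 is below \<open>d\<close>; the summand 1 makes the required inequality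
      strict.\<close>
    define n where "n = (LINT x|lborel. ?N2 x) / d + 1"
    have n: "0 \<le> n" "(LINT x|lborel. ?N2 x) < d * n"
      using d(1) by (auto simp: n_def field_simps)
    have near: "2 / 3 - 2 * d \<le> cubic (cmod (V y))" if "?N2 y < d" for y
      using that d(2) by (intro cubic_ge_near_1) (auto simp: eta_def)
    have "\<exists>y. x < y \<and> y \<le> x + n \<and> ?N2 y < d"
      by (rule exists_small_value[OF iN]) (use n in auto)
    then obtain y where y: "x \<le> y" "2 / 3 - 2 * d \<le> cubic (cmod (V y))"
      using near by (meson less_imp_le)
    have "\<exists>z. x - n < z \<and> z \<le> x \<and> ?N2 z < d"
      by (rule exists_small_value[OF iN]) (use n in auto)
    then obtain z where z: "z \<le> x" "2 / 3 - 2 * d \<le> cubic (cmod (V z))"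
      using near by blast
    have "cubic (cmod (V y)) - cubic (cmod (V x)) \<le> (LINT s:{x<..y}|lborel. ?f s)"
      using modulus_increment[OF V y(1)] by (rule abs_le_D1)
    moreover have "- (cubic (cmod (V x)) - cubic (cmod (V z))) \<le> (LINT s:{z<..x}|lborel. ?f s)"
      using modulus_increment[OF V z(1)] by (rule abs_le_D2)
    ultimately have "(cubic (cmod (V y)) - cubic (cmod (V x))) - (cubic (cmod (V x)) - cubic (cmod (V z))) \<le>
      (LINT s:{z<..x}|lborel. ?f s) + (LINT s:{x<..y}|lborel. ?f s)"
      by simp
    also have "\<dots> = (LINT s:{z<..y}|lborel. ?f s)"
      using set_integral_Ioc_add[OF fl z(1) y(1)] by simp
    also have "\<dots> \<le> J"
      unfolding set_lebesgue_integral_def J_def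
      by (rule integral_mono) (use locally_integrable_Ioc[OF fl, of z y] f in
          \<open>auto simp: set_integrable_def indicator_def\<close>)
    finally show "2 / 3 - J / 2 \<le> cubic (cmod (V x)) + e" using d(3) y(2) z(2) by simp
  qed
  have "sqrt 2 * E 1 u < sqrt 2 * (2 * sqrt 2 / 3)" using E by (rule mult_strict_left_mono) simp
  also have "\<dots> = 4 / 3" by simp
  finally have "J / 2 < 2 / 3" using J by linarith
  moreover have "cubic (cmod (V x)) \<le> cmod (V x)" for x by (simp add: cubic_def)
  ultimately show ?thesis
    using bound by (intro exI[of _ "2 / 3 - J / 2"]) (auto intro: order_trans)
qed

section \<open>Exponential representation and phases\<close>

lemma primitive_bounded_linear:
  assumes T: "bounded_linear T" and L: "primitive L l"
  shows "primitive (\<lambda>x. T (L x)) (\<lambda>x. T (l x))"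
  unfolding primitive_def
proof (intro conjI allI impI)
  have l: "locally_integrable l" using L by (rule primitive_locally_integrable)
  then show "locally_integrable (\<lambda>x. T (l x))"
    unfolding locally_integrable_def using set_integral_bounded_linear(1)[OF T] by blast
  fix x y :: real assume "x \<le> y"
  then show "T (L y) - T (L x) = (LINT s:{x<..y}|lborel. T (l s))"
    using set_integral_bounded_linear(2)[OF T locally_integrable_Ioc[OF l]] primitive_diff_eq[OF L]
    by (simp add: bounded_linear.linear[OF T] linear_diff[symmetric])
qed

text \<open>The logarithm is built by integrating the logarithmic derivative \<open>w / V\<close>.
  By the product rule \<open>V exp(-L)\<close> has density 0, hence is a constant
  \<open>q\<close>.\<close>

lemma nonvanishing_primitive_eq_exp:
  fixes V w :: "real \<Rightarrow> complex"
  assumes V: "primitive V w" and nz: "\<And>x. V x \<noteq> 0"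
  obtains q L where "q \<noteq> 0" "primitive L (\<lambda>x. w x / V x)" "\<And>x. V x = q * exp (L x)"
proof -
  have w: "locally_integrable w" and cV: "continuous_on UNIV V"
    using V by (auto intro: primitive_locally_integrable primitive_continuous)
  have "continuous_on UNIV (\<lambda>x. inverse (V x))" using nz by (intro continuous_intros cV) auto
  from locally_integrable_bilinear[OF bounded_bilinear_mult this w]
  have l: "locally_integrable (\<lambda>x. w x / V x)" by (simp add: divide_inverse mult.commute)
  obtain L where L: "primitive L (\<lambda>x. w x / V x)" using primitive_exists[OF l] by blast
  have "primitive (\<lambda>x. - L x) (\<lambda>x. - (w x / V x))"
    by (rule primitive_bounded_linear[OF bounded_linear_minus[OF bounded_linear_ident] L])
  from primitive_bilinear[OF bounded_bilinear_mult V primitive_exp[OF this]]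
  have "primitive (\<lambda>x. V x * exp (- L x)) (\<lambda>x. 0)"
    using nz by simp
  then have step: "V y * exp (- L y) = V x * exp (- L x)" if "x \<le> y" for x y
    using primitive_diff_eq[of _ _ x y] that by fastforce
  have const: "V x * exp (- L x) = V 0 * exp (- L 0)" for x
  proof (cases "x \<le> 0")
    case True
    show ?thesis by (rule step[OF True, symmetric])
  next
    case False
    then have "0 \<le> x" by simp
    then show ?thesis by (rule step)
  qed
  have "V x = (V 0 * exp (- L 0)) * exp (L x)" for x
    using const[of x] by (simp add: exp_minus field_simps)
  moreover have "V 0 * exp (- L 0) \<noteq> 0" using nz by simp
  ultimately show thesis using that L by blast
qed

text \<open>The difference is continuous with values in the multiples of \<open>2 * pi\<close>, and
  distinct values are at least 1 apart.\<close>

lemma phases_differ_by_const: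
  fixes \<phi> \<psi> :: "real \<Rightarrow> real"
  assumes "continuous_on UNIV \<phi>" "continuous_on UNIV \<psi>"
    and eq: "\<And>x. exp (\<i> * complex_of_real (\<phi> x)) = exp (\<i> * complex_of_real (\<psi> x))"
  shows "\<exists>c. \<forall>x. \<phi> x = \<psi> x + c"
proof -
  have discrete: "\<exists>n::int. \<phi> x - \<psi> x = 2 * pi * n" for x
  proof -
    obtain n :: int where "\<i> * complex_of_real (\<phi> x) = \<i> * complex_of_real (\<psi> x) + of_real (real_of_int (2 * n) * pi) * \<i>"
      using eq[of x] unfolding exp_eq by blast
    then have "Im (\<i> * complex_of_real (\<phi> x)) = Im (\<i> * complex_of_real (\<psi> x) + of_real (real_of_int (2 * n) * pi) * \<i>)"
      by simp
    then have "\<phi> x - \<psi> x = 2 * pi * n" by simp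
    then show ?thesis ..
  qed
  have "(\<lambda>x. \<phi> x - \<psi> x) constant_on UNIV"
  proof (rule continuous_discrete_range_constant)
    show "continuous_on UNIV (\<lambda>x. \<phi> x - \<psi> x)" by (intro continuous_intros assms)
    fix x
    have "1 \<le> norm ((\<phi> y - \<psi> y) - (\<phi> x - \<psi> x))" if ne: "\<phi> y - \<psi> y \<noteq> \<phi> x - \<psi> x" for y
    proof -
      obtain m n :: int where mn: "\<phi> y - \<psi> y = 2 * pi * m" "\<phi> x - \<psi> x = 2 * pi * n"
        using discrete by metis
      then have "1 \<le> \<bar>m - n\<bar>" using ne by auto
      then have "1 \<le> \<bar>real_of_int (m - n)\<bar>" by linarith
      then have "1 * 1 \<le> (2 * pi) * \<bar>real_of_int (m - n)\<bar>"
        using pi_gt3 by (intro mult_mono) auto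
      also have "\<dots> = norm ((\<phi> y - \<psi> y) - (\<phi> x - \<psi> x))"
        unfolding mn by (simp add: abs_mult right_diff_distrib[symmetric])
      finally show ?thesis by simp
    qed
    then show "\<exists>e>0. \<forall>y. y \<in> UNIV \<and> \<phi> y - \<psi> y \<noteq> \<phi> x - \<psi> x \<longrightarrow> e \<le> norm ((\<phi> y - \<psi> y) - (\<phi> x - \<psi> x))"
      by (intro exI[of _ 1]) auto
  qed simp
  then obtain c where "\<And>x. \<phi> x - \<psi> x = c" unfolding constant_on_def by auto
  then show ?thesis by (intro exI[of _ c]) (simp add: algebra_simps)
qed

text \<open>One function \<open>d\<close>, the imaginary part of \<partial>\<Psi> / \<Psi>, serves
  all phases, since they differ by constants. The lower bound on the modulus enters twice: it gives
  the logarithm, and it makes \<open>d\<close> square integrable.\<close>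

lemma phase_exists_and_derivative:
  assumes u: "u \<in> X k" and k: "1 \<le> k" and E: "E 1 u < 2 * sqrt 2 / 3"
  obtains \<phi>\<^sub>0 d where "is_phase u \<phi>\<^sub>0" "square_integrable d"
    "\<And>\<phi>. is_phase u \<phi> \<Longrightarrow> has_weak_derivative 1 \<phi> d"
proof -
  let ?w = "wderiv 1 u"
  obtain V where V: "primitive V ?w" and uV: "AE x in lborel. u x = V x"
    using has_weak_derivative_obtain_primitive[OF X_has_weak_derivative_1[OF u]] by blast
  have cV: "continuous_on UNIV V" using V by (rule primitive_continuous)
  obtain c where c: "0 < c" "\<And>x. c \<le> cmod (V x)"
    using modulus_bounded_below[OF u k E V uV] by blast
  have nz: "V x \<noteq> 0" for x using c(1) c(2)[of x] by auto
  obtain q L where q: "q \<noteq> 0" and L: "primitive L (\<lambda>x. ?w x / V x)" and VL: "\<And>x. V x = q * exp (L x)"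
    using nonvanishing_primitive_eq_exp[OF V nz] by blast
  define \<phi>\<^sub>0 where "\<phi>\<^sub>0 x = Arg q + Im (L x)" for x
  define d where "d x = Im (?w x / V x)" for x
  have imL: "primitive (\<lambda>x. Im (L x)) d"
    unfolding d_def by (rule primitive_bounded_linear[OF bounded_linear_Im L])
  have c0: "continuous_on UNIV \<phi>\<^sub>0"
    unfolding \<phi>\<^sub>0_def[abs_def]
    by (rule continuous_on_add[OF continuous_on_const primitive_continuous[OF imL]])
  \<comment> \<open>The moduli of \<open>q\<close> and \<open>exp (L x)\<close> combine to the
    modulus of \<open>V x\<close>; the constant \<open>q\<close> is the reason for adding
    \<open>Arg q\<close> to the imaginary part of \<open>L\<close>.\<close>
  have V0: "V x = complex_of_real (cmod (V x)) * exp (\<i> * complex_of_real (\<phi>\<^sub>0 x))" for x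
  proof -
    have "exp (L x) = complex_of_real (exp (Re (L x))) * exp (\<i> * complex_of_real (Im (L x)))"
      unfolding exp_eq_polar[of "L x"] cis_conv_exp ..
    moreover have "q = complex_of_real (cmod q) * exp (\<i> * complex_of_real (Arg q))"
      using Arg_eq[OF q] .
    moreover have "exp (\<i> * complex_of_real (\<phi>\<^sub>0 x)) = exp (\<i> * complex_of_real (Arg q)) * exp (\<i> * complex_of_real (Im (L x)))"
      by (simp add: \<phi>\<^sub>0_def distrib_left exp_add)
    ultimately show ?thesis
      unfolding VL by (simp add: norm_mult mult_ac)
  qed
  have "is_phase u \<phi>\<^sub>0"
    unfolding is_phase_def using c0 uV V0 by (auto elim: eventually_mono)
  moreover have "square_integrable d"
  proof (rule square_integrableI_bound(1))
    have w: "square_integrable ?w" using X_square_integrable[OF u _ k] by simp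
    show "d \<in> borel_measurable borel"
      by (rule locally_integrable_measurable[OF primitive_locally_integrable[OF imL]])
    show "integrable lborel (\<lambda>x. (1 / c)\<^sup>2 * (cmod (?w x))\<^sup>2)"
      using square_integrableD(2)[OF w] by simp
    have "(norm (d x))\<^sup>2 \<le> (1 / c)\<^sup>2 * (cmod (?w x))\<^sup>2" for x
    proof -
      have "\<bar>d x\<bar> \<le> cmod (?w x / V x)" unfolding d_def by (rule abs_Im_le_cmod)
      also have "\<dots> \<le> cmod (?w x) / c"
        unfolding norm_divide using c by (intro divide_left_mono) (auto simp: nz)
      finally have "\<bar>d x\<bar>\<^sup>2 \<le> (cmod (?w x) / c)\<^sup>2" by (rule power_mono) simp
      then show ?thesis by (simp add: power_divide)
    qed
    then show "AE x in lborel. (norm (d x))\<^sup>2 \<le> (1 / c)\<^sup>2 * (cmod (?w x))\<^sup>2" by simp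
  qed
  moreover have "has_weak_derivative 1 \<phi> d" if "is_phase u \<phi>" for \<phi>
  proof -
    have c\<phi>: "continuous_on UNIV \<phi>" using that by (simp add: is_phase_def)
    have "AE x in lborel. V x = complex_of_real (cmod (V x)) * exp (\<i> * complex_of_real (\<phi> x))"
      using conjunct2[OF that[unfolded is_phase_def]] uV by eventually_elim simp
    \<comment> \<open>The polar form is given only almost everywhere, but it holds at every point
      for the continuous representative \<open>V\<close>, so that phases can be compared
      pointwise.\<close>
    then have V\<phi>: "V x = complex_of_real (cmod (V x)) * exp (\<i> * complex_of_real (\<phi> x))" for x
      by (rule AE_eq_continuous_imp_eq[rotated 2]) (intro continuous_intros cV c\<phi>)+
    have "exp (\<i> * complex_of_real (\<phi> x)) = exp (\<i> * complex_of_real (\<phi>\<^sub>0 x))" for x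
      using V\<phi>[of x] V0[of x] nz[of x] by (metis mult_cancel_left mult_eq_0_iff)
    then obtain a where "\<And>x. \<phi> x = \<phi>\<^sub>0 x + a"
      using phases_differ_by_const[OF c\<phi> c0] by blast
    then have "primitive \<phi> d"
      using imL by (simp add: primitive_def \<phi>\<^sub>0_def)
    then show ?thesis by (rule has_weak_derivative_primitive)
  qed
  ultimately show thesis by (rule that)
qed

section \<open>Independence of the representative\<close>

lemma X_dist_AE_eq:
  assumes u: "u \<in> X k" and v: "v \<in> X k" and ae: "AE x in lborel. v x = u x"
  shows "X_dist k u v = 0"
proof -
  have meas: "u \<in> borel_measurable borel" "v \<in> borel_measurable borel"
    using u v by (auto intro: locally_integrable_measurable X_locally_integrable)
  have zero: "has_weak_derivative j (\<lambda>x. 0) (\<lambda>x. 0::complex)" for j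
    using locally_integrable_continuous[OF continuous_on_const[of UNIV "0::complex"]]
    by (simp add: has_weak_derivative_def)
  let ?z = "wderiv 1 (\<lambda>x. u x - v x)"
  have "AE x in lborel. u x - v x = 0" using ae by eventually_elim simp
  then have "has_weak_derivative 1 (\<lambda>x. u x - v x) (\<lambda>x. 0)"
    using meas by (intro has_weak_derivative_cong_AE[OF zero]) auto
  then have z: "AE x in lborel. ?z x = 0" "?z \<in> borel_measurable borel"
    using wderiv_unique has_weak_derivative_imp_wderiv[THEN has_weak_derivative_locally_integrable(2), THEN locally_integrable_measurable]
    by blast+
  have zj: "has_weak_derivative j ?z (\<lambda>x. 0)" for j
    using z by (intro has_weak_derivative_cong_AE[OF zero]) auto
  have wj: "AE x in lborel. wderiv j ?z x = 0" "wderiv j ?z \<in> borel_measurable borel" for j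
    using wderiv_unique[OF zj] has_weak_derivative_imp_wderiv[OF zj, THEN has_weak_derivative_locally_integrable(2), THEN locally_integrable_measurable]
    by blast+
  have sq0: "square_integrable (\<lambda>x. 0::'b::{banach, second_countable_topology})" "l2 (\<lambda>x. 0::'b) = 0"
    by (auto simp: square_integrable_def l2_def)
  have "?z \<in> Sobolev_H (k - 1)"
    unfolding Sobolev_H_def using zj square_integrable_cong_AE(1)[OF sq0(1) wj(2,1)]
    by (auto simp: weakly_differentiable_def)
  moreover have "(LINT x|lborel. (norm (wderiv j ?z x))\<^sup>2) = 0" for j
    using square_integrable_cong_AE(2)[OF sq0(1) wj(2,1), of j] l2_power2[of "wderiv j ?z"]
    by (simp add: sq0(2))
  ultimately have S: "Sobolev_norm (k - 1) ?z = 0"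
    by (simp add: Sobolev_norm_def)
  have "Linf_norm (\<lambda>x. u x - v x) = esssup lborel (\<lambda>x::real. 0::ereal)"
    unfolding Linf_norm_def using meas ae
    by (intro esssup_AE_cong) (auto elim!: eventually_mono)
  also have "\<dots> = 0" by (subst esssup_const) auto
  finally have Li: "Linf_norm (\<lambda>x. u x - v x) = 0" .
  have ae2: "AE x in lborel. (cmod (u x))\<^sup>2 - (cmod (v x))\<^sup>2 = 0" using ae by eventually_elim simp
  have m2: "(\<lambda>x. (cmod (u x))\<^sup>2 - (cmod (v x))\<^sup>2) \<in> borel_measurable borel" using meas by measurable
  have "L2_norm (\<lambda>x. (cmod (u x))\<^sup>2 - (cmod (v x))\<^sup>2) = 0"
    using square_integrable_cong_AE[OF sq0(1) m2 ae2]
    by (simp add: L2_norm_def l2_def[symmetric] sq0(2) l2_def)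
  then show ?thesis using S Li by (simp add: X_dist_def)
qed

text \<open>Representatives of one class are at distance 0, so a nonzero gap between the values
  would contradict continuity with \<epsilon> equal to the gap. For \<open>P k\<close> the
  invariance thus follows from the continuity already shown.\<close>

lemma continuous_on_X_AE_eq:
  assumes "continuous_on_X k G" "u \<in> X k" "v \<in> X k" "AE x in lborel. v x = u x"
  shows "G v = G u"
proof (rule ccontr)
  assume "G v \<noteq> G u"
  then have "0 < \<bar>G v - G u\<bar>" by simp
  then obtain \<delta> :: real where "0 < \<delta>" "\<forall>w\<in>X k. X_dist k u w < ereal \<delta> \<longrightarrow> \<bar>G w - G u\<bar> < \<bar>G v - G u\<bar>"
    using assms(1,2) unfolding continuous_on_X_def by blast
  then show False using assms(3) X_dist_AE_eq[OF assms(2-4)] by (auto simp: zero_ereal_def)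
qed

text \<open>Both \<eta> and the common derivative \<open>d\<close> of all phases are square
  integrable, and the integral of their product is the same for every phase and every
  representative.\<close>

lemma p_well_defined_X:
  assumes u: "u \<in> X k" and k: "k \<in> {1..4}" and E: "E 1 u < 2 * sqrt 2 / 3"
  shows "p_well_defined k u"
proof -
  have k1: "1 \<le> k" using k by simp
  obtain \<phi>\<^sub>0 d where phase0: "is_phase u \<phi>\<^sub>0" and d: "square_integrable d"
    and wd: "\<And>\<phi>. is_phase u \<phi> \<Longrightarrow> has_weak_derivative 1 \<phi> d"
    using phase_exists_and_derivative[OF u k1 E] by blast
  have eta: "square_integrable (eta u)" using u by (rule eta_square_integrable)
  have int_d: "integrable lborel (\<lambda>x. eta u x * d x)"
  proof (rule Bochner_Integration.integrable_bound[OF Cauchy_Schwarz_l2(1)[OF eta d]])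
    show "(\<lambda>x. eta u x * d x) \<in> borel_measurable lborel"
      using square_integrableD(1)[OF eta] square_integrableD(1)[OF d] by simp
  qed (simp add: abs_mult)
  \<comment> \<open>The representative \<open>v\<close> is allowed to differ from \<open>u\<close>
    so that the same computation evaluates both \<open>p1 u\<close> and \<open>p1 v\<close>.\<close>
  have phase: "weakly_differentiable 1 \<phi>" "integrable lborel (\<lambda>x. eta u x * wderiv 1 \<phi> x)"
    "p1_via \<phi> v = 1/2 * (LINT x|lborel. eta u x * d x)"
    if \<phi>: "is_phase u \<phi>" and v: "v \<in> borel_measurable borel" "AE x in lborel. v x = u x" for \<phi> v
  proof -
    note w = wd[OF \<phi>]
    show "weakly_differentiable 1 \<phi>" using w by (auto simp: weakly_differentiable_def)
    have m: "wderiv 1 \<phi> \<in> borel_measurable borel"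
      by (rule locally_integrable_measurable[OF has_weak_derivative_locally_integrable(2)[OF has_weak_derivative_imp_wderiv[OF w]]])
    have mv: "eta v \<in> borel_measurable borel" using v(1) unfolding eta_def[abs_def] by measurable
    have ae: "AE x in lborel. eta v x * wderiv 1 \<phi> x = eta u x * d x"
      using wderiv_unique[OF w] v(2) by eventually_elim (simp add: eta_def)
    have ae': "AE x in lborel. eta u x * wderiv 1 \<phi> x = eta u x * d x"
      using wderiv_unique[OF w] by eventually_elim simp
    show "integrable lborel (\<lambda>x. eta u x * wderiv 1 \<phi> x)"
      using m square_integrableD(1)[OF eta] square_integrableD(1)[OF d]
      by (subst integrable_cong_AE[OF _ _ ae']) (simp_all add: int_d)
    show "p1_via \<phi> v = 1/2 * (LINT x|lborel. eta u x * d x)"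
      unfolding p1_via_def
      using m mv borel_measurable_integrable[OF int_d] by (subst integral_cong_AE[OF _ _ ae]) simp_all
  qed
  have meas: "u \<in> borel_measurable borel"
    by (intro locally_integrable_measurable X_locally_integrable[OF u])
  have some: "is_phase u (SOME \<phi>. is_phase u \<phi>)" using phase0 by (rule someI[of "is_phase u"])
  have p1_u: "p1 u = 1/2 * (LINT x|lborel. eta u x * d x)"
    unfolding p1_def by (rule phase(3)[OF some meas]) simp
  have p1_via_eq: "p1_via \<phi> u = p1 u" if "is_phase u \<phi>" for \<phi>
    unfolding p1_u by (rule phase(3)[OF that meas]) simp
  have "p k v = p k u" if v: "v \<in> X k" and ae: "AE x in lborel. v x = u x" for v
  proof -
    \<comment> \<open>Equality of the predicates makes the phases selected by choice for
      \<open>u\<close> and \<open>v\<close> identical.\<close>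
    have phases: "is_phase v = is_phase u"
    proof
      fix \<phi>
      have "(AE x in lborel. v x = complex_of_real (cmod (v x)) * exp (\<i> * complex_of_real (\<phi> x))) \<longleftrightarrow>
        (AE x in lborel. u x = complex_of_real (cmod (u x)) * exp (\<i> * complex_of_real (\<phi> x)))"
        by (rule eventually_subst) (use ae in \<open>auto elim: eventually_mono\<close>)
      then show "is_phase v \<phi> = is_phase u \<phi>" by (simp add: is_phase_def)
    qed
    have "p1 v = p1 u"
      unfolding p1_u unfolding p1_def phases
      by (rule phase(3)[OF some _ ae])
        (rule locally_integrable_measurable[OF X_locally_integrable[OF v]])
    moreover have "P k v = P k u" if "2 \<le> k"
      using continuous_on_X_AE_eq[OF continuous_on_X_P u v ae] that k by simp
    moreover have "k = 1 \<or> k = 2 \<or> k = 3 \<or> k = 4" using k by auto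
    ultimately show ?thesis by (auto simp: p_def)
  qed
  moreover have "2 \<le> k \<Longrightarrow> P_well_defined k u" using P_well_defined_X[OF u] k by simp
  ultimately show ?thesis
    unfolding p_well_defined_def using phase0 phase(1,2)[OF _ meas] p1_via_eq by auto
qed

theorem lemma3p1:
  shows "(\<forall>k\<in>{1..4}. (\<forall>\<Psi>\<in>X k. E_well_defined k \<Psi>) \<and> continuous_on_X k (E k)) \<and>
         (\<forall>k\<in>{2..4}. (\<forall>\<Psi>\<in>X k. P_well_defined k \<Psi>) \<and> continuous_on_X k (P k)) \<and>
         (\<forall>k\<in>{1..4}. \<forall>\<Psi>\<in>X k. E 1 \<Psi> < 2 * sqrt 2 / 3 \<longrightarrow> p_well_defined k \<Psi>)"
  using E_well_defined_X continuous_on_X_E P_well_defined_X continuous_on_X_P p_well_defined_X by blast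

end
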